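(* Let $\kappa$ be a singular cardinal with $\operatorname{cf}(\kappa)=\lambda>\omega$ such that $\tau^\lambda<\kappa$ for all $\tau<\kappa$. Let $\mathbb{P}$ be any of the forcings $\mathbb{M}_\kappa$, $\mathbb{M}^{\mathrm{stat}}_\kappa$, $\mathbb{M}^{\mathrm{club}}_\kappa$, ${}^{\mathrm{scl}}\mathbb{M}_\kappa$, ${}^{\mathrm{scl}}\mathbb{M}^{\mathrm{club}}_\kappa$, $\mathbb{L}_\kappa$, $\mathbb{L}^{\mathrm{stat}}_\kappa$, $\mathbb{L}^{\mathrm{club}}_\kappa$. Then $\mathbb{P}$ is not $(\lambda,2)$-distributive, i.e. forcing with $\mathbb{P}$ adds a function from $\lambda$ to $2$ that is not in the ground model.
   Context: Fix a strictly increasing sequence $\vec\kappa=\langle\kappa_\alpha:\alpha<\lambda\rangle$ of regular infinite cardinals with supremum $\kappa$. Let $N=\bigcup_{\alpha<\lambda}\prod_{\beta<\alpha}\kappa_\beta$ (functions $t$ with $\mathrm{dom}(t)$ an ordinal $<\lambda$ and $t(\beta)<\kappa_\beta$), ordered by end-extension $\sqsubseteq$. A tree is a nonempty $T\subseteq N$ closed under initial segments. For $t\in T$, $\mathrm{Succ}_T(t)$ is the set of immediate successors $t^\frown\langle\beta\rangle\in T$ and $\mathrm{OSucc}_T(t)=\{\beta: t^\frown\langle\beta\rangle\in T\}$. $T$ is $(<\lambda)$-closed if every node has a proper extension in $T$ and whenever $\delta<\lambda$ is a limit and $f$ has domain $\delta$ with $f\restriction\beta\in T$ for all $\beta<\delta$,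 then $f\in T$. $T$ is ever-branching if for all $s\in T$ and $\alpha<\lambda$ there is $t\in T$, $s\sqsubseteq t$, with $|\mathrm{Succ}_T(t)|\ge\kappa_\alpha$ ($t$ is then called $\kappa_\alpha$-splitting). $T$ is perfect if it is $(<\lambda)$-closed and ever-branching. All forcings are ordered by inclusion. $\mathbb{M}_\kappa$: perfect trees. $\mathbb{M}^{\mathrm{stat}}_\kappa$ (resp. $\mathbb{M}^{\mathrm{club}}_\kappa$): perfect trees $p$ such that every node has an extension $t\in p$ with $\mathrm{OSucc}_p(t)$ a stationary subset of $\{\beta<\kappa_{\mathrm{dom}(t)}:\operatorname{cf}\beta=\omega\}$ (resp. containing a club subset of $\kappa_{\mathrm{dom}(t)}$). The splitting-closed versions ${}^{\mathrm{scl}}\mathbb{M}_\kappa$, ${}^{\mathrm{scl}}\mathbb{M}^{\mathrm{club}}_\kappa$ consist of conditions $p$ of the respective forcing such that for every $\delta<\lambda$ and every $\sqsubseteq$-increasing sequence $\langle t_\alpha:\alpha<\delta\rangle$ of nodes of $p$ with $t_\alpha$ $\kappa_\alpha$-splitting, the union $\bigcup_\alpha t_\alpha$ is a $\kappa_\delta$-splitting node of $p$ (in the club version, splitting in the sense that the ordinal successor set contains a club). $\mathbb{L}_\kappa$: $(<\lambda)$-closed trees $p$ with a node $s$ (the stem) comparable with every node of $p$ such that every $t\in p$ with $s\sqsubseteq t$ satisfies $|\mathrm{Succ}_p(t)|=\kappa_{\mathrm{dom}(t)}$; $\mathbb{L}^{\mathrm{stat}}_\kappa$ (resp. $\mathbb{L}^{\mathrm{club}}_\kappa$)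 additionally requires $\mathrm{OSucc}_p(t)$ to be a stationary subset of $\{\beta<\kappa_{\mathrm{dom}(t)}:\operatorname{cf}\beta=\omega\}$ (resp. to contain a club subset of $\kappa_{\mathrm{dom}(t)}$) for all such $t$.
   Formalization: In the splitting-closed forcings, δ ranges only over limit ordinals below λ and the sequences of nodes are strictly increasing; with δ=0 and δ=1 allowed, the root would have to be κ_1-splitting although it has at most κ_0 successors, so those forcings would be empty. *)

theory Defs
  imports Main "HOL-Library.FuncSet"
begin

unbundle cardinal_syntax

section \<open>Ordinals and cardinals\<close>

text \<open>
  Ordinals are the elements of an arbitrary type of class \<^class>\<open>wellorder\<close>; the ordinal \<open>a\<close> is
  identified with the set \<open>{..<a}\<close> of its predecessors.  The relation below presents \<open>a\<close> in
  the form used by the library of cardinals.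
\<close>

definition ord_rel :: "'o::wellorder \<Rightarrow> 'o rel" where
  "ord_rel a = {(x, y). x \<le> y \<and> y < a}"

definition is_cardinal :: "'o::wellorder \<Rightarrow> bool" where
  "is_cardinal a \<longleftrightarrow> Card_order (ord_rel a)"

definition regular_infinite_cardinal :: "'o::wellorder \<Rightarrow> bool" where
  "regular_infinite_cardinal a \<longleftrightarrow> Cinfinite (ord_rel a) \<and> regularCard (ord_rel a)"

definition is_limit :: "'o::wellorder \<Rightarrow> bool" where
  "is_limit d \<longleftrightarrow> (\<exists>x. x < d) \<and> (\<forall>x<d. \<exists>y<d. x < y)"

definition cf :: "'o::wellorder \<Rightarrow> 'o" where
  "cf a = (LEAST b. \<exists>f. f ` {..<b} \<subseteq> {..<a} \<and> (\<forall>x<a. \<exists>y<b. x \<le> f y))"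

text \<open>Only meaningful if the type has an element with infinitely many predecessors.\<close>

definition omega :: "'o::wellorder" where
  "omega = (LEAST b. infinite {..<b})"

definition singular_cardinal :: "'o::wellorder \<Rightarrow> bool" where
  "singular_cardinal a \<longleftrightarrow> Cinfinite (ord_rel a) \<and> cf a < a"

definition club_in :: "'o::wellorder set \<Rightarrow> 'o \<Rightarrow> bool" where
  "club_in C m \<longleftrightarrow> C \<subseteq> {..<m} \<and> (\<forall>x<m. \<exists>y\<in>C. x \<le> y) \<and>
     (\<forall>d<m. is_limit d \<and> (\<forall>x<d. \<exists>y\<in>C. x < y \<and> y < d) \<longrightarrow> d \<in> C)"

definition stationary_in :: "'o::wellorder set \<Rightarrow> 'o \<Rightarrow> bool" where
  "stationary_in S m \<longleftrightarrow> S \<subseteq> {..<m} \<and> (\<forall>C. club_in C m \<longrightarrow> S \<inter> C \<noteq> {})"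

definition cardinal_sequence :: "'o::wellorder \<Rightarrow> 'o \<Rightarrow> ('o \<Rightarrow> 'o) \<Rightarrow> bool" where
  "cardinal_sequence \<kappa> lam k \<longleftrightarrow>
     (\<forall>\<alpha><lam. regular_infinite_cardinal (k \<alpha>)) \<and>
     strict_mono_on {..<lam} k \<and>
     (\<forall>\<alpha><lam. k \<alpha> \<le> \<kappa>) \<and> (\<forall>b. (\<forall>\<alpha><lam. k \<alpha> \<le> b) \<longrightarrow> \<kappa> \<le> b)"


section \<open>Trees\<close>

text \<open>
  Nodes are partial functions whose domain is an ordinal; on such functions end-extension is
  \<^const>\<open>map_le\<close>.  Throughout, \<open>lam\<close> is the height and \<open>k\<close> the sequence of cardinals.
\<close>

type_synonym 'o node = "'o \<rightharpoonup> 'o"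

definition nodes :: "'o::wellorder \<Rightarrow> ('o \<Rightarrow> 'o) \<Rightarrow> 'o node set" where
  "nodes lam k = {t. \<exists>\<alpha><lam. dom t = {..<\<alpha>} \<and> (\<forall>\<beta><\<alpha>. the (t \<beta>) < k \<beta>)}"

definition len :: "'o::wellorder node \<Rightarrow> 'o" where
  "len t = (THE \<alpha>. dom t = {..<\<alpha>})"

definition is_tree :: "'o::wellorder \<Rightarrow> ('o \<Rightarrow> 'o) \<Rightarrow> 'o node set \<Rightarrow> bool" where
  "is_tree lam k T \<longleftrightarrow> T \<noteq> {} \<and> T \<subseteq> nodes lam k \<and>
     (\<forall>t\<in>T. \<forall>s\<in>nodes lam k. s \<subseteq>\<^sub>m t \<longrightarrow> s \<in> T)"

definition OSucc :: "'o::wellorder node set \<Rightarrow> 'o node \<Rightarrow> 'o set" where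
  "OSucc T t = {\<beta>. t(len t \<mapsto> \<beta>) \<in> T}"

definition Succ :: "'o::wellorder node set \<Rightarrow> 'o node \<Rightarrow> 'o node set" where
  "Succ T t = {t(len t \<mapsto> \<beta>) |\<beta>. t(len t \<mapsto> \<beta>) \<in> T}"

definition lt_closed :: "'o::wellorder \<Rightarrow> 'o node set \<Rightarrow> bool" where
  "lt_closed lam T \<longleftrightarrow> (\<forall>t\<in>T. \<exists>u\<in>T. t \<subseteq>\<^sub>m u \<and> t \<noteq> u) \<and>
     (\<forall>\<delta> f. \<delta> < lam \<and> is_limit \<delta> \<and> dom f = {..<\<delta>} \<and> (\<forall>\<beta><\<delta>. f |` {..<\<beta>} \<in> T) \<longrightarrow> f \<in> T)"

definition splitting :: "('o::wellorder \<Rightarrow> 'o) \<Rightarrow> 'o node set \<Rightarrow> 'o \<Rightarrow> 'o node \<Rightarrow> bool" where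
  "splitting k T \<alpha> t \<longleftrightarrow> |{..<k \<alpha>}| \<le>o |Succ T t|"

definition stat_branching :: "('o::wellorder \<Rightarrow> 'o) \<Rightarrow> 'o node set \<Rightarrow> 'o node \<Rightarrow> bool" where
  "stat_branching k T t \<longleftrightarrow> OSucc T t \<subseteq> {\<beta>. \<beta> < k (len t) \<and> cf \<beta> = omega} \<and>
     stationary_in (OSucc T t) (k (len t))"

definition club_branching :: "('o::wellorder \<Rightarrow> 'o) \<Rightarrow> 'o node set \<Rightarrow> 'o node \<Rightarrow> bool" where
  "club_branching k T t \<longleftrightarrow> (\<exists>C. club_in C (k (len t)) \<and> C \<subseteq> OSucc T t)"

definition ever_branching :: "'o::wellorder \<Rightarrow> ('o \<Rightarrow> 'o) \<Rightarrow> 'o node set \<Rightarrow> bool" where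
  "ever_branching lam k T \<longleftrightarrow> (\<forall>s\<in>T. \<forall>\<alpha><lam. \<exists>t\<in>T. s \<subseteq>\<^sub>m t \<and> splitting k T \<alpha> t)"

definition perfect_tree :: "'o::wellorder \<Rightarrow> ('o \<Rightarrow> 'o) \<Rightarrow> 'o node set \<Rightarrow> bool" where
  "perfect_tree lam k T \<longleftrightarrow> is_tree lam k T \<and> lt_closed lam T \<and> ever_branching lam k T"

text \<open>
  Closure under unions of increasing sequences of splitting nodes, where \<open>spl \<alpha> t\<close> says that
  \<open>t\<close> is \<open>k \<alpha>\<close>-splitting.  Here \<open>\<delta>\<close> ranges over limit ordinals and the sequences are strictly
  increasing: for \<open>\<delta> = 0\<close> the condition would make the root \<open>k 0\<close>-splitting and for \<open>\<delta> = 1\<close> it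
  would then make the root \<open>k 1\<close>-splitting, which is impossible.
\<close>

definition splitting_closed ::
  "'o::wellorder \<Rightarrow> ('o \<Rightarrow> 'o node \<Rightarrow> bool) \<Rightarrow> 'o node set \<Rightarrow> bool" where
  "splitting_closed lam spl T \<longleftrightarrow>
     (\<forall>\<delta> t. \<delta> < lam \<and> is_limit \<delta> \<and>
        (\<forall>\<alpha><\<delta>. t \<alpha> \<in> T \<and> spl \<alpha> (t \<alpha>)) \<and>
        (\<forall>\<alpha> \<beta>. \<alpha> < \<beta> \<and> \<beta> < \<delta> \<longrightarrow> t \<alpha> \<subseteq>\<^sub>m t \<beta> \<and> t \<alpha> \<noteq> t \<beta>) \<longrightarrow>
        (\<exists>u\<in>T. Map.graph u = (\<Union>\<alpha>\<in>{..<\<delta>}. Map.graph (t \<alpha>)) \<and> spl \<delta> u))"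


section \<open>The tree forcings\<close>

definition MM :: "'o::wellorder \<Rightarrow> ('o \<Rightarrow> 'o) \<Rightarrow> 'o node set set" where
  "MM lam k = {p. perfect_tree lam k p}"

definition MM_stat :: "'o::wellorder \<Rightarrow> ('o \<Rightarrow> 'o) \<Rightarrow> 'o node set set" where
  "MM_stat lam k = {p. perfect_tree lam k p \<and> (\<forall>s\<in>p. \<exists>t\<in>p. s \<subseteq>\<^sub>m t \<and> stat_branching k p t)}"

definition MM_club :: "'o::wellorder \<Rightarrow> ('o \<Rightarrow> 'o) \<Rightarrow> 'o node set set" where
  "MM_club lam k = {p. perfect_tree lam k p \<and> (\<forall>s\<in>p. \<exists>t\<in>p. s \<subseteq>\<^sub>m t \<and> club_branching k p t)}"

definition scl_MM :: "'o::wellorder \<Rightarrow> ('o \<Rightarrow> 'o) \<Rightarrow> 'o node set set" where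
  "scl_MM lam k = {p \<in> MM lam k. splitting_closed lam (splitting k p) p}"

definition scl_MM_club :: "'o::wellorder \<Rightarrow> ('o \<Rightarrow> 'o) \<Rightarrow> 'o node set set" where
  "scl_MM_club lam k = {p \<in> MM_club lam k.
     splitting_closed lam (\<lambda>\<alpha> t. splitting k p \<alpha> t \<and> club_branching k p t) p}"

definition laver_stem ::
  "'o::wellorder \<Rightarrow> ('o \<Rightarrow> 'o) \<Rightarrow> 'o node set \<Rightarrow> 'o node \<Rightarrow> bool" where
  "laver_stem lam k p s \<longleftrightarrow> s \<in> p \<and> (\<forall>t\<in>p. s \<subseteq>\<^sub>m t \<or> t \<subseteq>\<^sub>m s) \<and>
     (\<forall>t\<in>p. s \<subseteq>\<^sub>m t \<longrightarrow> |Succ p t| =o |{..<k (len t)}| )"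

definition LL :: "'o::wellorder \<Rightarrow> ('o \<Rightarrow> 'o) \<Rightarrow> 'o node set set" where
  "LL lam k = {p. is_tree lam k p \<and> lt_closed lam p \<and> (\<exists>s. laver_stem lam k p s)}"

definition LL_stat :: "'o::wellorder \<Rightarrow> ('o \<Rightarrow> 'o) \<Rightarrow> 'o node set set" where
  "LL_stat lam k = {p. is_tree lam k p \<and> lt_closed lam p \<and>
     (\<exists>s. laver_stem lam k p s \<and> (\<forall>t\<in>p. s \<subseteq>\<^sub>m t \<longrightarrow> stat_branching k p t))}"

definition LL_club :: "'o::wellorder \<Rightarrow> ('o \<Rightarrow> 'o) \<Rightarrow> 'o node set set" where
  "LL_club lam k = {p. is_tree lam k p \<and> lt_closed lam p \<and>
     (\<exists>s. laver_stem lam k p s \<and> (\<forall>t\<in>p. s \<subseteq>\<^sub>m t \<longrightarrow> club_branching k p t))}"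


section \<open>Forcing\<close>

text \<open>
  A forcing is a set \<open>P\<close> of conditions with an order \<open>le\<close> (\<open>le q p\<close>: \<open>q\<close> is stronger than \<open>p\<close>).
  A statement of the forcing language is represented by the predicate \<open>\<lambda>p. p \<tturnstile> \<phi>\<close> on conditions;
  the definitions are the usual recursive clauses of the forcing relation, quantifiers being
  bounded by ground-model sets.

  A set \<open>\<tau>\<close> of pairs \<open>(x, u)\<close> with \<open>x \<in> A\<close> and \<open>u \<in> P\<close> is a name for the subset
  \<open>{x. \<exists>u\<in>G. (x, u) \<in> \<tau>}\<close> of the ground-model set \<open>A\<close> in the extension by a generic filter \<open>G\<close>.
  Every subset of \<open>A\<close> in the extension has such a name.
\<close>

type_synonym 'c stmt = "'c \<Rightarrow> bool"

definition f_mem :: "'c set \<Rightarrow> ('c \<Rightarrow> 'c \<Rightarrow> bool) \<Rightarrow> 'x \<Rightarrow> ('x \<times> 'c) set \<Rightarrow> 'c stmt" where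
  "f_mem P le x \<tau> = (\<lambda>p. \<forall>q\<in>P. le q p \<longrightarrow> (\<exists>r\<in>P. le r q \<and> (\<exists>u\<in>P. (x, u) \<in> \<tau> \<and> le r u)))"

definition f_not :: "'c set \<Rightarrow> ('c \<Rightarrow> 'c \<Rightarrow> bool) \<Rightarrow> 'c stmt \<Rightarrow> 'c stmt" where
  "f_not P le \<phi> = (\<lambda>p. \<forall>q\<in>P. le q p \<longrightarrow> \<not> \<phi> q)"

definition f_and :: "'c stmt \<Rightarrow> 'c stmt \<Rightarrow> 'c stmt" where
  "f_and \<phi> \<psi> = (\<lambda>p. \<phi> p \<and> \<psi> p)"

definition f_all :: "'i set \<Rightarrow> ('i \<Rightarrow> 'c stmt) \<Rightarrow> 'c stmt" where
  "f_all I \<phi> = (\<lambda>p. \<forall>i\<in>I. \<phi> i p)"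

definition f_ex :: "'c set \<Rightarrow> ('c \<Rightarrow> 'c \<Rightarrow> bool) \<Rightarrow> 'i set \<Rightarrow> ('i \<Rightarrow> 'c stmt) \<Rightarrow> 'c stmt" where
  "f_ex P le I \<phi> = (\<lambda>p. \<forall>q\<in>P. le q p \<longrightarrow> (\<exists>r\<in>P. le r q \<and> (\<exists>i\<in>I. \<phi> i r)))"

text \<open>\<open>\<tau>\<close> is a function from \<open>X\<close> to \<open>Y\<close>, for a name \<open>\<tau>\<close> of a subset of \<open>X \<times> Y\<close>.\<close>

definition f_is_function ::
  "'c set \<Rightarrow> ('c \<Rightarrow> 'c \<Rightarrow> bool) \<Rightarrow> 'x set \<Rightarrow> 'y set \<Rightarrow> (('x \<times> 'y) \<times> 'c) set \<Rightarrow> 'c stmt" where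
  "f_is_function P le X Y \<tau> =
     f_all X (\<lambda>x. f_and
       (f_ex P le Y (\<lambda>y. f_mem P le (x, y) \<tau>))
       (f_all {(y, z). y \<in> Y \<and> z \<in> Y \<and> y \<noteq> z} (\<lambda>(y, z).
          f_not P le (f_and (f_mem P le (x, y) \<tau>) (f_mem P le (x, z) \<tau>)))))"

text \<open>\<open>\<tau>\<close> is a ground-model function, for a name \<open>\<tau>\<close> of a function from \<open>X\<close> to \<open>Y\<close>.\<close>

definition f_in_ground_model ::
  "'c set \<Rightarrow> ('c \<Rightarrow> 'c \<Rightarrow> bool) \<Rightarrow> 'x set \<Rightarrow> 'y set \<Rightarrow> (('x \<times> 'y) \<times> 'c) set \<Rightarrow> 'c stmt" where
  "f_in_ground_model P le X Y \<tau> =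
     f_ex P le (X \<rightarrow>\<^sub>E Y) (\<lambda>g. f_all X (\<lambda>x. f_mem P le (x, g x) \<tau>))"

text \<open>
  Distributivity: every condition forces that all functions from \<open>X\<close> to \<open>Y\<close> lie in the ground
  model.  Adding a new function: some name is forced, by every condition, to be a function from
  \<open>X\<close> to \<open>Y\<close> outside the ground model.
\<close>

definition distributive :: "'c set \<Rightarrow> ('c \<Rightarrow> 'c \<Rightarrow> bool) \<Rightarrow> 'x set \<Rightarrow> 'y set \<Rightarrow> bool" where
  "distributive P le X Y \<longleftrightarrow>
     (\<forall>\<tau>. \<tau> \<subseteq> (X \<times> Y) \<times> P \<longrightarrow>
        (\<forall>p\<in>P. f_is_function P le X Y \<tau> p \<longrightarrow> f_in_ground_model P le X Y \<tau> p))"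

definition adds_new_function :: "'c set \<Rightarrow> ('c \<Rightarrow> 'c \<Rightarrow> bool) \<Rightarrow> 'x set \<Rightarrow> 'y set \<Rightarrow> bool" where
  "adds_new_function P le X Y \<longleftrightarrow>
     (\<exists>\<tau>. \<tau> \<subseteq> (X \<times> Y) \<times> P \<and>
        (\<forall>p\<in>P. f_and (f_is_function P le X Y \<tau>) (f_not P le (f_in_ground_model P le X Y \<tau>)) p))"

end

theory Submission
  imports Defs "HOL-Library.Countable_Set"
begin

text \<open>
  A name for a subset of the height \<open>lam\<close> is a family \<open>(D \<beta>)\<close> of open sets of conditions; it is
  new if no condition decides all of them. Three kinds of names are used.

  \<^item> Laver trees: at level \<open>\<gamma> + \<omega>\<close> there are an infinite set \<open>B\<close> of naturals and a scale in
    \<open>\<Prod>n. k (\<gamma> + n)\<close> that dominates on \<open>B\<close>. Fix \<open>A \<subseteq> B\<close> infinite and co-infinite in \<open>B\<close>, and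
    colour a node \<open>x\<close> of that level by whether \<open>{n \<in> B. f n \<le> x (\<gamma> + n)}\<close> equals \<open>A\<close> modulo finite
    for some \<open>f\<close> in the scale. For a large \<open>f\<close> every Laver tree has nodes realising \<open>A\<close> and
    \<open>B - A\<close>; as the scale is linearly ordered, the second node cannot also realise \<open>A\<close>.

  \<^item> Splitting-closed trees with clubs: a club of \<open>k \<beta>\<close> has points of cofinality \<open>\<omega>\<close> and of
    cofinality \<open>lam\<close>, so this cofinality for the successive values of the branch is undecided.

  \<^item> Other perfect trees: refine maximal antichains \<open>\<A> 0, \<A> 1, \<dots>\<close> such that passing from an
    element of \<open>\<A> n\<close> to one of \<open>\<A> (n + 1)\<close> lowers an ordinal rank at every splitting node: the
    order type of the splitting nodes below it or, for splitting-closed trees, the position of a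
    successor among its siblings. The name is the sequence of the sets \<open>A n\<close> of splitting levels,
    along the generic branch, of the generic element of \<open>\<A> n\<close>. If a condition decided them, the
    \<open>A n\<close> would have empty intersection by well-foundedness. But in the splitting-closed case each
    \<open>A n\<close> contains a club of \<open>lam\<close>, and otherwise, as \<open>lam\<close> has uncountable cofinality, the
    condition can be thinned out to split only at levels outside one fixed \<open>A n\<close>.
\<close>

section \<open>New functions in generic extensions\<close>

locale forcing =
  fixes P :: "'c set" and le :: "'c \<Rightarrow> 'c \<Rightarrow> bool"
  assumes reflexive: "p \<in> P \<Longrightarrow> le p p"
    and transitive: "p \<in> P \<Longrightarrow> q \<in> P \<Longrightarrow> r \<in> P \<Longrightarrow> le p q \<Longrightarrow> le q r \<Longrightarrow> le p r"
begin

definition compatible :: "'c \<Rightarrow> 'c \<Rightarrow> bool" where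
  "compatible p q \<longleftrightarrow> (\<exists>r\<in>P. le r p \<and> le r q)"

definition open_in :: "'c set \<Rightarrow> bool" where
  "open_in D \<longleftrightarrow> D \<subseteq> P \<and> (\<forall>u\<in>D. \<forall>r\<in>P. le r u \<longrightarrow> r \<in> D)"

definition dense_below :: "'c set \<Rightarrow> 'c \<Rightarrow> bool" where
  "dense_below D p \<longleftrightarrow> (\<forall>q\<in>P. le q p \<longrightarrow> (\<exists>r\<in>D. le r q))"

definition negation :: "'c set \<Rightarrow> 'c set" where
  "negation D = {u \<in> P. \<forall>r\<in>P. le r u \<longrightarrow> r \<notin> D}"

definition undecided :: "'c set \<Rightarrow> 'c \<Rightarrow> bool" where
  "undecided D q \<longleftrightarrow> (\<exists>r\<in>D. le r q) \<and> (\<exists>r\<in>negation D. le r q)"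

lemma open_in_negation: "open_in (negation D)"
  unfolding open_in_def negation_def using transitive by blast

lemma dense_below_le:
  assumes "dense_below D p" "p \<in> P" "q \<in> P" "le q p" shows "dense_below D q"
  using assms transitive unfolding dense_below_def by meson

lemma dense_below_open:
  assumes "open_in D" "p \<in> D" shows "dense_below D p"
  using assms reflexive unfolding open_in_def dense_below_def by blast

lemma not_dense_below_negation:
  assumes "open_in D" "p \<in> P" "dense_below D p" shows "\<not> dense_below (negation D) p"
proof
  assume "dense_below (negation D) p"
  then obtain r where r: "r \<in> negation D" "le r p"
    using assms(2) reflexive unfolding dense_below_def by blast
  then obtain r' where "r' \<in> D" "le r' r"
    using assms(3) unfolding dense_below_def negation_def by blast
  then show False
    using r(1) assms(1) unfolding negation_def open_in_def by blast
qed

lemma dense_below_or_negation: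
  assumes "open_in D" "p \<in> P"
  obtains r where "r \<in> P" "le r p" "dense_below D r \<or> dense_below (negation D) r"
proof (cases "\<exists>r\<in>D. le r p")
  case True
  then show ?thesis
    using that assms dense_below_open unfolding open_in_def by blast
next
  case False
  then have "p \<in> negation D"
    using assms unfolding negation_def open_in_def by blast
  then show ?thesis
    using that assms(2) reflexive dense_below_open[OF open_in_negation] by blast
qed

lemma undecided_not_dense_below:
  assumes "open_in D" "p \<in> P" "undecided D p"
  shows "\<not> dense_below D p" "\<not> dense_below (negation D) p"
proof -
  obtain r s where "r \<in> D" "le r p" "s \<in> negation D" "le s p"
    using assms(3) unfolding undecided_def by blast
  moreover have "r \<in> P" "s \<in> P"
    using assms(1) \<open>r \<in> D\<close> \<open>s \<in> negation D\<close> unfolding open_in_def negation_def by blast+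
  ultimately show "\<not> dense_below D p" "\<not> dense_below (negation D) p"
    using assms(1,2) dense_below_le not_dense_below_negation
      dense_below_open[OF assms(1)] dense_below_open[OF open_in_negation]
    by meson+
qed

lemma dense_below_of_decided:
  assumes "\<not> undecided D p" "d \<in> D" "le d p" shows "dense_below D p"
  unfolding dense_below_def
proof (intro ballI impI)
  fix q assume "q \<in> P" "le q p"
  then have "q \<notin> negation D"
    using assms unfolding undecided_def by blast
  then show "\<exists>r\<in>D. le r q"
    using \<open>q \<in> P\<close> unfolding negation_def by blast
qed

lemma f_mem_iff_dense_below:
  assumes "open_in {u. (x, u) \<in> \<tau>}"
  shows "f_mem P le x \<tau> p \<longleftrightarrow> dense_below {u. (x, u) \<in> \<tau>} p"
proof -
  have "(\<exists>u\<in>P. (x, u) \<in> \<tau> \<and> le r u) \<longleftrightarrow> (x, r) \<in> \<tau>" if "r \<in> P" for r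
    using assms that reflexive unfolding open_in_def by blast
  moreover have "r \<in> P" if "(x, r) \<in> \<tau>" for r
    using assms that unfolding open_in_def by blast
  ultimately have "(\<exists>r\<in>P. le r q \<and> (\<exists>u\<in>P. (x, u) \<in> \<tau> \<and> le r u)) \<longleftrightarrow> (\<exists>r\<in>{u. (x, u) \<in> \<tau>}. le r q)"
    for q
    by auto
  then show ?thesis
    unfolding f_mem_def dense_below_def by simp
qed

definition indicator_name :: "'x set \<Rightarrow> ('x \<Rightarrow> 'c set) \<Rightarrow> (('x \<times> nat) \<times> 'c) set" where
  "indicator_name X D = {((x, i), u). x \<in> X \<and> (i = 1 \<and> u \<in> D x \<or> i = 0 \<and> u \<in> negation (D x))}"

context
  fixes X :: "'x set" and D :: "'x \<Rightarrow> 'c set"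
  assumes D: "\<And>x. x \<in> X \<Longrightarrow> open_in (D x)"
begin

lemma f_mem_indicator_name:
  assumes "x \<in> X"
  shows "f_mem P le (x, 1) (indicator_name X D) p \<longleftrightarrow> dense_below (D x) p"
    and "f_mem P le (x, 0) (indicator_name X D) p \<longleftrightarrow> dense_below (negation (D x)) p"
proof -
  have "{u. ((x, 1), u) \<in> indicator_name X D} = D x"
    "{u. ((x, 0), u) \<in> indicator_name X D} = negation (D x)"
    using assms unfolding indicator_name_def by auto
  then show "f_mem P le (x, 1) (indicator_name X D) p \<longleftrightarrow> dense_below (D x) p"
    "f_mem P le (x, 0) (indicator_name X D) p \<longleftrightarrow> dense_below (negation (D x)) p"
    using D[OF assms] open_in_negation f_mem_iff_dense_below[of "(x, _)"] by metis+
qed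

lemma f_is_function_indicator_name:
  assumes "p \<in> P" shows "f_is_function P le X {0, 1} (indicator_name X D) p"
  unfolding f_is_function_def f_all_def
proof
  fix x assume x: "x \<in> X"
  let ?\<phi> = "\<lambda>i. f_mem P le (x, i) (indicator_name X D)"
  note mem = f_mem_indicator_name[OF x]
  have total: "\<exists>r\<in>P. le r q \<and> (\<exists>i\<in>{0, 1}. ?\<phi> i r)" if "q \<in> P" for q
    by (rule dense_below_or_negation[OF D[OF x] that]) (use mem in auto)
  have "\<not> (?\<phi> 0 q \<and> ?\<phi> 1 q)" if "q \<in> P" for q
    unfolding mem using not_dense_below_negation[OF D[OF x] that] by blast
  then have unique: "f_not P le (f_and (?\<phi> y) (?\<phi> z)) p" if "y \<in> {0, 1}" "z \<in> {0, 1}" "y \<noteq> z"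
    for y z
    using that unfolding f_not_def f_and_def by auto
  show "f_and (f_ex P le {0, 1} ?\<phi>)
    (\<lambda>p. \<forall>i\<in>{(y, z). y \<in> {0, 1} \<and> z \<in> {0, 1} \<and> y \<noteq> z}.
      (case i of (y, z) \<Rightarrow> f_not P le (f_and (?\<phi> y) (?\<phi> z))) p) p"
    unfolding f_ex_def using total unique by (auto simp: f_and_def)
qed

lemma indicator_name_not_in_ground_model:
  assumes undecided: "\<And>q. q \<in> P \<Longrightarrow> \<exists>x\<in>X. undecided (D x) q" and "p \<in> P"
  shows "\<not> f_in_ground_model P le X {0, 1} (indicator_name X D) p"
proof
  assume "f_in_ground_model P le X {0, 1} (indicator_name X D) p"
  then have "\<exists>q\<in>P. \<exists>g\<in>X \<rightarrow>\<^sub>E {0, 1 :: nat}. \<forall>x\<in>X. f_mem P le (x, g x) (indicator_name X D) q"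
    using \<open>p \<in> P\<close> reflexive[OF \<open>p \<in> P\<close>]
    unfolding f_in_ground_model_def f_ex_def f_all_def by meson
  then obtain q g where q: "q \<in> P" "g \<in> X \<rightarrow>\<^sub>E {0, 1 :: nat}"
    and g: "\<And>x. x \<in> X \<Longrightarrow> f_mem P le (x, g x) (indicator_name X D) q"
    by blast
  obtain x where x: "x \<in> X" "undecided (D x) q"
    using undecided[OF q(1)] by blast
  have "g x \<in> {0, 1}"
    using PiE_mem[OF q(2) x(1)] .
  then show False
    using g[OF x(1)] undecided_not_dense_below[OF D[OF x(1)] q(1) x(2)]
      f_mem_indicator_name[OF x(1)]
    by auto
qed

theorem adds_new_functionI:
  assumes "\<And>q. q \<in> P \<Longrightarrow> \<exists>x\<in>X. undecided (D x) q"
  shows "adds_new_function P le X {0, 1 :: nat}"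
  unfolding adds_new_function_def
proof (intro exI conjI ballI)
  show "indicator_name X D \<subseteq> (X \<times> {0, 1}) \<times> P"
    using D unfolding indicator_name_def negation_def open_in_def by auto
  show "f_and (f_is_function P le X {0, 1} (indicator_name X D))
      (f_not P le (f_in_ground_model P le X {0, 1} (indicator_name X D))) p" if "p \<in> P" for p
    using f_is_function_indicator_name[OF that] indicator_name_not_in_ground_model[OF assms]
    unfolding f_and_def f_not_def by blast
qed

end

lemma adds_new_function_not_distributive:
  assumes "adds_new_function P le X Y" "P \<noteq> {}" shows "\<not> distributive P le X Y"
  using assms reflexive unfolding adds_new_function_def distributive_def f_and_def f_not_def
  by blast

subsection \<open>Refining maximal antichains\<close>

definition antichain :: "'c set \<Rightarrow> bool" where
  "antichain M \<longleftrightarrow> (\<forall>x\<in>M. \<forall>y\<in>M. compatible x y \<longrightarrow> x = y)"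

definition predense :: "'c set \<Rightarrow> bool" where
  "predense M \<longleftrightarrow> (\<forall>p\<in>P. \<exists>x\<in>M. compatible p x)"

lemma compatible_sym: "compatible p q \<longleftrightarrow> compatible q p"
  unfolding compatible_def by blast

lemma compatible_le: "compatible r q \<Longrightarrow> r \<in> P \<Longrightarrow> p \<in> P \<Longrightarrow> le r p \<Longrightarrow> compatible p q"
  unfolding compatible_def using transitive by blast

lemma maximal_antichain:
  assumes dense: "\<And>p. p \<in> P \<Longrightarrow> \<exists>x\<in>E. x \<in> P \<and> le x p"
  obtains M where "M \<subseteq> E" "antichain M" "predense M"
proof -
  interpret pred_on E "\<lambda>x y. \<not> compatible x y" .
  obtain M where M: "maxchain M"
    using Hausdorff by blast
  then have sub: "M \<subseteq> E" and anti: "antichain M"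
    unfolding maxchain_def chain_def antichain_def using compatible_sym by blast+
  have "\<exists>y\<in>M. compatible x y" if x: "x \<in> E" "x \<in> P" for x
  proof (rule ccontr)
    assume no: "\<not> (\<exists>y\<in>M. compatible x y)"
    then have "chain (insert x M)"
      using M x(1) unfolding maxchain_def chain_def by (blast dest: compatible_sym[THEN iffD1])
    then have "x \<in> M"
      using M unfolding maxchain_def by blast
    moreover have "compatible x x"
      unfolding compatible_def using x(2) reflexive by blast
    ultimately show False
      using no by blast
  qed
  then have "predense M"
    unfolding predense_def using dense compatible_le by meson
  with sub anti show ?thesis by (rule that)
qed

lemma refining_antichains:
  assumes dense: "\<And>p r. p \<in> P \<Longrightarrow> r \<in> P \<Longrightarrow> le r p \<Longrightarrow> \<exists>r'\<in>P. le r' r \<and> R p r'"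
  obtains \<A> :: "nat \<Rightarrow> 'c set" where "\<And>n. \<A> n \<subseteq> P" "\<And>n. antichain (\<A> n)" "\<And>n. predense (\<A> n)"
    "\<And>n x. x \<in> \<A> (Suc n) \<Longrightarrow> \<exists>a\<in>\<A> n. le x a \<and> R a x"
proof -
  define max_antichain where "max_antichain M \<longleftrightarrow> M \<subseteq> P \<and> antichain M \<and> predense M" for M
  define refines where "refines M N \<longleftrightarrow> (\<forall>x\<in>N. \<exists>a\<in>M. le x a \<and> R a x)" for M N
  have "\<exists>\<A>. \<forall>n::nat. max_antichain (\<A> n) \<and> refines (\<A> n) (\<A> (Suc n))"
  proof (rule dependent_nat_choice)
    show "\<exists>M. max_antichain M"
      using maximal_antichain[of P] reflexive unfolding max_antichain_def by metis
  next
    fix M assume M: "max_antichain M"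
    define E where "E = {x \<in> P. \<exists>a\<in>M. le x a \<and> R a x}"
    have "\<exists>x\<in>E. x \<in> P \<and> le x p" if p: "p \<in> P" for p
    proof -
      obtain a r where a: "a \<in> M" "r \<in> P" "le r p" "le r a"
        using M p unfolding max_antichain_def predense_def compatible_def by blast
      then have "a \<in> P"
        using M unfolding max_antichain_def by blast
      with a obtain x where "x \<in> P" "le x r" "R a x"
        using dense by blast
      then show ?thesis
        using a \<open>a \<in> P\<close> p transitive unfolding E_def by blast
    qed
    then obtain N where "N \<subseteq> E" "antichain N" "predense N"
      using maximal_antichain[of E] by blast
    then show "\<exists>N. max_antichain N \<and> refines M N"
      unfolding max_antichain_def refines_def E_def by blast
  qed
  then show ?thesis
    using that unfolding max_antichain_def refines_def by metis
qed

end

section \<open>Ordinals\<close>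

definition zero_ord :: "'o::wellorder" where
  "zero_ord = (LEAST x. True)"

lemma zero_ord_le [simp]: "zero_ord \<le> x"
  unfolding zero_ord_def by (simp add: Least_le)

lemma not_less_zero_ord [simp]: "\<not> x < zero_ord"
  by (simp add: not_less)

definition next_ord :: "'o::wellorder \<Rightarrow> 'o" where
  "next_ord a = (LEAST x. a < x)"

lemma
  assumes "a < b"
  shows less_next_ord: "a < next_ord a"
    and next_ord_le: "next_ord a \<le> b"
    and less_next_ord_iff: "x < next_ord a \<longleftrightarrow> x \<le> a"
proof -
  show less: "a < next_ord a"
    unfolding next_ord_def using assms by (rule LeastI)
  show "next_ord a \<le> b"
    unfolding next_ord_def using assms by (rule Least_le)
  show "x < next_ord a \<longleftrightarrow> x \<le> a"
    using less not_less_Least[of x "\<lambda>x. a < x"] unfolding next_ord_def by (meson leI le_less_trans)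
qed

lemma is_limitD: "is_limit d \<Longrightarrow> x < d \<Longrightarrow> \<exists>y<d. x < y"
  unfolding is_limit_def by blast

lemma next_ord_less_limit:
  assumes "is_limit d" "a < d" shows "next_ord a < d"
  using is_limitD[OF assms] next_ord_le le_less_trans by blast

lemma ord_cases [case_names zero succ limit]:
  fixes b :: "'o::wellorder"
  obtains "b = zero_ord" | a where "a < b" "b = next_ord a" | "is_limit b"
proof -
  have "b = next_ord a" if "a < b" "\<forall>y<b. \<not> a < y" for a
    using less_next_ord[OF that(1)] next_ord_le[OF that(1)] that(2) by (metis le_less)
  moreover have "b = zero_ord" if "\<forall>x. \<not> x < b"
    using that by (meson antisym leI zero_ord_le)
  ultimately show ?thesis
    using that unfolding is_limit_def by blast
qed

definition strict_sup :: "'i set \<Rightarrow> ('i \<Rightarrow> 'o::wellorder) \<Rightarrow> 'o" where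
  "strict_sup I g = (LEAST z. \<forall>i\<in>I. g i < z)"

lemma strict_sup_le: "(\<And>i. i \<in> I \<Longrightarrow> g i < z) \<Longrightarrow> strict_sup I g \<le> z"
  unfolding strict_sup_def by (rule Least_le) blast

lemma less_strict_sup:
  assumes "\<And>i. i \<in> I \<Longrightarrow> g i < z" "i \<in> I" shows "g i < strict_sup I g"
  using LeastI[of "\<lambda>z. \<forall>i\<in>I. g i < z"] assms unfolding strict_sup_def by blast

lemma less_strict_supD: "x < strict_sup I g \<Longrightarrow> \<exists>i\<in>I. x \<le> g i"
  using not_less_Least[of x "\<lambda>z. \<forall>i\<in>I. g i < z"] unfolding strict_sup_def by (auto simp: not_less)

lemma less_strict_supD_strict:
  assumes "\<And>i. i \<in> I \<Longrightarrow> \<exists>j\<in>I. g i < g j" "x < strict_sup I g" shows "\<exists>i\<in>I. x < g i"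
  using less_strict_supD[OF assms(2)] assms(1) le_less_trans by blast

lemma is_limit_strict_sup:
  assumes "\<And>i. i \<in> I \<Longrightarrow> g i < z" "\<And>i. i \<in> I \<Longrightarrow> \<exists>j\<in>I. g i < g j" "I \<noteq> {}"
  shows "is_limit (strict_sup I g)"
  unfolding is_limit_def
proof (intro conjI allI impI)
  have below: "g i < strict_sup I g" if "i \<in> I" for i
    using less_strict_sup[OF assms(1) that] .
  then show "\<exists>x. x < strict_sup I g"
    using assms(3) by blast
  fix x assume "x < strict_sup I g"
  then show "\<exists>y<strict_sup I g. x < y"
    using less_strict_supD_strict[OF assms(2)] below by blast
qed

subsection \<open>Cofinality\<close>

lemma cf_le:
  assumes "f ` {..<b} \<subseteq> {..<a}" "\<And>x. x < a \<Longrightarrow> \<exists>y<b. x \<le> f y" shows "cf a \<le> b"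
  unfolding cf_def using assms by (intro Least_le) blast

lemma cf_cofinal:
  fixes a :: "'o::wellorder"
  obtains f where "f ` {..<cf a} \<subseteq> {..<a}" "\<And>x. x < a \<Longrightarrow> \<exists>y<cf a. x \<le> f y"
proof -
  have "\<exists>f. f ` {..<a} \<subseteq> {..<a} \<and> (\<forall>x<a. \<exists>y<a. x \<le> f y)"
    by (intro exI[of _ id]) auto
  then have "\<exists>f. f ` {..<cf a} \<subseteq> {..<a} \<and> (\<forall>x<a. \<exists>y<cf a. x \<le> f y)"
    unfolding cf_def by (rule LeastI)
  then show ?thesis using that by blast
qed

lemma less_cf_bounded:
  assumes "b < cf a" "f ` {..<b} \<subseteq> {..<a}" shows "\<exists>z<a. \<forall>y<b. f y < z"
  using cf_le[OF assms(2)] assms(1) by (meson leD leI)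

lemma cf_eq_cf_of_strict_mono_cofinal:
  fixes c :: "'o::wellorder \<Rightarrow> 'o"
  assumes mono: "strict_mono_on {..<l} c" and range: "c ` {..<l} \<subseteq> {..<d}"
    and cofinal: "\<And>x. x < d \<Longrightarrow> \<exists>i<l. x \<le> c i"
  shows "cf d = cf l"
proof (rule antisym)
  obtain f where f: "f ` {..<cf l} \<subseteq> {..<l}" "\<And>x. x < l \<Longrightarrow> \<exists>y<cf l. x \<le> f y"
    using cf_cofinal by blast
  show "cf d \<le> cf l"
  proof (rule cf_le)
    show "(c \<circ> f) ` {..<cf l} \<subseteq> {..<d}"
      using f(1) range by fastforce
    fix x assume "x < d"
    then obtain i where i: "i < l" "x \<le> c i"
      using cofinal by blast
    then obtain y where "y < cf l" "i \<le> f y" "f y < l"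
      using f by blast
    then show "\<exists>y<cf l. x \<le> (c \<circ> f) y"
      using i strict_mono_on_leD[OF mono, of i "f y"] order_trans by auto
  qed
next
  obtain f where f: "f ` {..<cf d} \<subseteq> {..<d}" "\<And>x. x < d \<Longrightarrow> \<exists>y<cf d. x \<le> f y"
    using cf_cofinal by blast
  then have "\<exists>i<l. f y \<le> c i" if "y < cf d" for y
    using cofinal that by blast
  then obtain h where h: "\<And>y. y < cf d \<Longrightarrow> h y < l \<and> f y \<le> c (h y)"
    by metis
  show "cf l \<le> cf d"
  proof (rule cf_le)
    show "h ` {..<cf d} \<subseteq> {..<l}"
      using h by blast
    fix x assume x: "x < l"
    then obtain y where y: "y < cf d" "c x \<le> f y"
      using f(2) range by blast
    then have "c x \<le> c (h y)"
      using h order_trans by blast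
    then show "\<exists>y<cf d. x \<le> h y"
      using y(1) h x strict_mono_onD[OF mono] by (metis leD leI lessThan_iff)
  qed
qed

lemma finite_below_omega: "c < omega \<Longrightarrow> finite {..<c}"
  using not_less_Least unfolding omega_def by blast

lemma infinite_below_omega: "infinite {..<b::'o::wellorder} \<Longrightarrow> infinite {..<omega::'o}"
  unfolding omega_def by (rule LeastI)

lemma is_limit_omega:
  assumes "infinite {..<omega::'o::wellorder}" shows "is_limit (omega::'o)"
  unfolding is_limit_def
proof (intro conjI allI impI)
  show "\<exists>x::'o. x < omega"
    using infinite_imp_nonempty[OF assms] by blast
  fix x :: 'o assume "x < omega"
  then have "finite {..x}"
    using finite_below_omega[of x]
    by (simp add: lessThan_Suc_atMost ivl_disj_un_singleton(2)[symmetric])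
  then show "\<exists>y. y < omega \<and> x < y"
    using assms finite_subset[of "{..<omega}" "{..x}"]
    by (meson atMost_iff lessThan_iff not_le subsetI)
qed

lemma cf_omega:
  assumes "infinite {..<omega::'o::wellorder}" shows "cf omega = (omega::'o)"
proof (rule antisym)
  show "cf omega \<le> (omega::'o)"
    by (rule cf_le[of id]) auto
  show "omega \<le> cf (omega::'o)"
  proof (rule leI, rule notI)
    obtain f :: "'o \<Rightarrow> 'o" where f: "f ` {..<cf omega} \<subseteq> {..<omega}"
      "\<And>x. x < omega \<Longrightarrow> \<exists>y<cf omega. x \<le> f y"
      using cf_cofinal by blast
    assume "cf omega < (omega::'o)"
    then have fin: "finite (f ` {..<cf omega})"
      using finite_below_omega by blast
    have "f ` {..<cf omega} \<noteq> {}"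
      using f(2) is_limit_omega[OF assms] unfolding is_limit_def by blast
    then have "Max (f ` {..<cf omega}) < omega"
      using Max_in[OF fin] f(1) by blast
    then obtain x where "x < omega" "Max (f ` {..<cf omega}) < x"
      using is_limitD[OF is_limit_omega[OF assms]] by blast
    then show False
      using f(2) Max_ge[OF fin] by (meson imageI leD le_less_trans lessThan_iff order_trans)
  qed
qed

lemma regular_unbounded_not_inj:
  assumes "cf l = l" "a < l" and Z: "Z \<subseteq> {..<l}" "\<And>x. x < l \<Longrightarrow> \<exists>y\<in>Z. x \<le> y"
    and g: "inj_on g Z"
  shows "\<exists>z\<in>Z. a \<le> g z"
proof (rule ccontr)
  assume "\<not> (\<exists>z\<in>Z. a \<le> g z)"
  then have less: "g z < a" if "z \<in> Z" for z
    using that not_le by blast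
  define f where "f j = (if j \<in> g ` Z then inv_into Z g j else a)" for j
  have "f ` {..<a} \<subseteq> {..<l}"
    using Z(1) \<open>a < l\<close> inv_into_into[of _ g Z] unfolding f_def by auto
  then obtain z where z: "z < l" "\<forall>j<a. f j < z"
    using less_cf_bounded[of a l f] assms by auto
  then obtain y where "y \<in> Z" "z \<le> y"
    using Z(2) by blast
  moreover from this have "f (g y) = y"
    using g unfolding f_def by simp
  ultimately show False
    using z(2) less[of y] by auto
qed

locale regular_uncountable =
  fixes lam :: "'o::wellorder"
  assumes cf_lam: "cf lam = lam" and omega_less_lam: "omega < lam"
    and infinite_lam: "infinite {..<lam}"
begin

lemma countable_bounded:
  assumes "\<And>n::nat. g n < lam" shows "\<exists>z<lam. \<forall>n. g n < z"
proof -
  obtain i :: "nat \<Rightarrow> 'o" where i: "inj i" "range i \<subseteq> {..<omega}"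
    using infinite_countable_subset[OF infinite_below_omega[OF infinite_lam]] by blast
  have "(g \<circ> inv i) ` {..<omega} \<subseteq> {..<lam}"
    using assms by auto
  then obtain z where "z < lam" "\<forall>y. y < omega \<longrightarrow> (g \<circ> inv i) y < z"
    using less_cf_bounded[of omega lam] cf_lam omega_less_lam by metis
  then show ?thesis
    using i inv_f_f[OF i(1)] by (metis comp_apply lessThan_iff rangeI subsetD)
qed

lemma is_limit_lam: "is_limit lam"
  unfolding is_limit_def using countable_bounded[of "\<lambda>_. _"] omega_less_lam by blast

lemma next_ord_lam: "a < lam \<Longrightarrow> next_ord a < lam"
  by (rule next_ord_less_limit[OF is_limit_lam])

lemma zero_ord_lam: "zero_ord < lam"
  using omega_less_lam zero_ord_le le_less_trans by blast

end

subsection \<open>Regular cardinals\<close>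

lemma Field_ord_rel: "Field (ord_rel a) = {..<a}"
  unfolding Field_def ord_rel_def by force

lemma underS_ord_rel: "b < a \<Longrightarrow> underS (ord_rel a) b = {..<b}"
  unfolding underS_def ord_rel_def by auto

lemma card_of_lessThan_ordIso: "Card_order (ord_rel m) \<Longrightarrow> |{..<m}| =o ord_rel m"
  using card_of_Field_ordIso unfolding Field_ord_rel[symmetric] .

lemma card_of_lessThan_ordLess:
  assumes "Card_order (ord_rel m)" "b < m" shows "|{..<b}| <o |{..<m}|"
proof -
  have "|{..<b}| <o ord_rel m"
    using card_of_underS[OF assms(1), of b] assms(2)
    unfolding Field_ord_rel underS_ord_rel[OF assms(2)] by simp
  then show ?thesis
    using card_of_lessThan_ordIso[OF assms(1)] ordIso_symmetric ordLess_ordIso_trans by blast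
qed

lemma card_of_finite_ordLess_infinite: "finite A \<Longrightarrow> infinite B \<Longrightarrow> |A| <o |B|"
  using finite_ordLess_infinite[OF card_of_Well_order card_of_Well_order] by (metis Field_card_of)

lemma ordLess_card_of_lessThan:
  assumes "|A| <o ord_rel m" obtains a where "a < m" "|A| \<le>o |{..<a}|"
proof -
  have "Well_order (ord_rel m)"
    using assms unfolding ordLess_def by blast
  then obtain a where a: "a \<in> Field (ord_rel m)" "|A| =o Restr (ord_rel m) (underS (ord_rel m) a)"
    using ordLess_iff_ordIso_Restr assms card_of_Well_order by blast
  then have "a < m"
    unfolding Field_ord_rel by simp
  then have "Field (Restr (ord_rel m) (underS (ord_rel m) a)) \<subseteq> {..<a}"
    unfolding underS_ord_rel[OF \<open>a < m\<close>] Field_def by blast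
  moreover have "|A| =o |Field (Restr (ord_rel m) (underS (ord_rel m) a))|"
    using card_of_cong[OF a(2)] unfolding Field_card_of .
  ultimately have "|A| \<le>o |{..<a}|"
    using card_of_mono1 ordIso_ordLeq_trans by blast
  with \<open>a < m\<close> show ?thesis by (rule that)
qed

context
  fixes m :: "'o::wellorder"
  assumes m: "regular_infinite_cardinal m"
begin

lemma Card_order_regular_cardinal: "Card_order (ord_rel m)"
  using m unfolding regular_infinite_cardinal_def by blast

lemma infinite_regular_cardinal: "infinite {..<m}"
  using m unfolding regular_infinite_cardinal_def cinfinite_def Field_ord_rel by blast

lemma is_limit_regular_cardinal: "is_limit m"
proof -
  have "\<exists>y<m. x < y" if "x < m" for x
    using infinite_Card_order_limit[OF Card_order_regular_cardinal, of x] infinite_regular_cardinal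
      that
    unfolding Field_ord_rel by (auto simp: ord_rel_def)
  then show ?thesis
    using infinite_imp_nonempty[OF infinite_regular_cardinal] unfolding is_limit_def by blast
qed

lemma regular_cardinal_bounded:
  assumes X: "X \<subseteq> {..<m}" "|X| <o |{..<m}|" shows "\<exists>z<m. \<forall>x\<in>X. x < z"
proof (rule ccontr)
  assume unbounded: "\<not> (\<exists>z<m. \<forall>x\<in>X. x < z)"
  have "\<exists>b\<in>X. a \<noteq> b \<and> (a, b) \<in> ord_rel m" if a: "a < m" for a
  proof -
    obtain b where b: "b < m" "a < b"
      using is_limitD[OF is_limit_regular_cardinal a] by blast
    then obtain x where "x \<in> X" "b \<le> x"
      using unbounded not_less by blast
    then show ?thesis
      using b X(1) unfolding ord_rel_def by (intro bexI[of _ x]) auto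
  qed
  then have "cofinal X (ord_rel m)"
    unfolding cofinal_def Field_ord_rel by blast
  then have "|X| =o ord_rel m"
    using m X(1) unfolding regular_infinite_cardinal_def regularCard_def Field_ord_rel by blast
  then have "|X| =o |{..<m}|"
    using card_of_lessThan_ordIso[OF Card_order_regular_cardinal] ordIso_symmetric
      ordIso_transitive by blast
  then show False
    using X(2) not_ordLess_ordIso by blast
qed

lemma regular_cardinal_unbounded_iff:
  assumes "X \<subseteq> {..<m}" shows "(\<forall>x<m. \<exists>y\<in>X. x \<le> y) \<longleftrightarrow> |{..<m}| \<le>o |X|"
proof
  assume "\<forall>x<m. \<exists>y\<in>X. x \<le> y"
  then have "\<not> |X| <o |{..<m}|"
    using regular_cardinal_bounded[OF assms] by (meson leD)
  then show "|{..<m}| \<le>o |X|"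
    using not_ordLess_iff_ordLeq[OF card_of_Well_order card_of_Well_order] by blast
next
  assume le: "|{..<m}| \<le>o |X|"
  show "\<forall>x<m. \<exists>y\<in>X. x \<le> y"
  proof (rule ccontr)
    assume "\<not> (\<forall>x<m. \<exists>y\<in>X. x \<le> y)"
    then obtain x where x: "x < m" "X \<subseteq> {..<x}"
      by (meson lessThan_iff not_le subsetI)
    have "|X| \<le>o |{..<x}|"
      using x(2) by (rule card_of_mono1)
    then show False
      using le card_of_lessThan_ordLess[OF Card_order_regular_cardinal x(1)]
        ordLeq_transitive not_ordLess_ordLeq by blast
  qed
qed

lemma cf_regular_cardinal: "cf m = m"
proof (rule antisym)
  show "cf m \<le> m"
    by (rule cf_le[of id]) auto
  show "m \<le> cf m"
  proof (rule leI, rule notI)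
    obtain f where f: "f ` {..<cf m} \<subseteq> {..<m}" "\<And>x. x < m \<Longrightarrow> \<exists>y<cf m. x \<le> f y"
      using cf_cofinal by blast
    assume "cf m < m"
    then have "|f ` {..<cf m}| <o |{..<m}|"
      using card_of_image card_of_lessThan_ordLess[OF Card_order_regular_cardinal]
        ordLeq_ordLess_trans by blast
    then show False
      using regular_cardinal_bounded[OF f(1)] f(2) by (meson imageI leD lessThan_iff)
  qed
qed

end

subsection \<open>Closed unbounded and stationary sets\<close>

lemma club_in_strict_sup:
  assumes C: "club_in C m" and "\<And>i. i \<in> I \<Longrightarrow> g i \<in> C" "\<And>i. i \<in> I \<Longrightarrow> \<exists>j\<in>I. g i < g j"
    and "I \<noteq> {}" "strict_sup I g < m"
  shows "strict_sup I g \<in> C"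
proof -
  have bound: "g i < m" if "i \<in> I" for i
    using C assms(2)[OF that] unfolding club_in_def by blast
  have "is_limit (strict_sup I g)"
    using is_limit_strict_sup[of I g m] bound assms(3,4) by blast
  moreover have "\<exists>y\<in>C. x < y \<and> y < strict_sup I g" if "x < strict_sup I g" for x
    using less_strict_supD_strict[OF assms(3) that] less_strict_sup[of I g m] bound assms(2)
    by blast
  ultimately show ?thesis
    using C assms(5) unfolding club_in_def by blast
qed

lemma club_in_full: "club_in {..<m} m"
  unfolding club_in_def by auto

lemma stationary_in_unbounded:
  assumes S: "stationary_in S m" and x: "x < m" shows "\<exists>y\<in>S. x \<le> y"
proof -
  have "club_in {x..<m} m"
    unfolding club_in_def
  proof (intro conjI allI impI)
    show "\<exists>y\<in>{x..<m}. z \<le> y" if "z < m" for z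
      using that x by (intro bexI[of _ "max x z"]) auto
    fix d assume d: "d < m" "is_limit d \<and> (\<forall>z<d. \<exists>y\<in>{x..<m}. z < y \<and> y < d)"
    then obtain z where "z < d"
      unfolding is_limit_def by blast
    then obtain y where "x \<le> y" "y < d"
      using d(2) by fastforce
    then show "d \<in> {x..<m}"
      using d(1) by auto
  qed auto
  then show ?thesis
    using S unfolding stationary_in_def by fastforce
qed

lemma (in regular_uncountable) countably_many_clubs_intersect:
  assumes C: "\<And>n::nat. club_in (C n) lam" shows "\<exists>b<lam. \<forall>n. b \<in> C n"
proof -
  have above: "\<exists>c\<in>C n. x < c" if "x < lam" for x n
    using C[of n] is_limitD[OF is_limit_lam that] unfolding club_in_def by (meson less_le_trans)
  have less: "c < lam" if "c \<in> C n" for c n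
    using C[of n] that unfolding club_in_def by blast
  have "\<exists>g. \<forall>m::nat. g m < lam \<and> (\<forall>n. \<exists>c\<in>C n. g m < c \<and> c < g (Suc m))"
  proof (rule dependent_nat_choice)
    show "\<exists>x. x < lam"
      using omega_less_lam by blast
    fix x assume "x < lam"
    then obtain c where c: "\<And>n. c n \<in> C n \<and> x < c n"
      using above by metis
    then show "\<exists>y<lam. \<forall>n. \<exists>c\<in>C n. x < c \<and> c < y"
      using countable_bounded[of c] less by meson
  qed
  then obtain g where g: "\<And>m. g m < lam" and between: "\<And>m n. \<exists>c\<in>C n. g m < c \<and> c < g (Suc m)"
    by metis
  obtain z where z: "z < lam" "\<And>m. g m < z"
    using countable_bounded[of g] g by blast
  have sup: "strict_sup UNIV g < lam"
    using strict_sup_le[of UNIV g z] z by (meson le_less_trans)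
  have "strict_sup UNIV g \<in> C n" for n
  proof -
    obtain c where c: "\<And>m. c m \<in> C n" "\<And>m. g m < c m" "\<And>m. c m < g (Suc m)"
      using between[where n = n] by metis
    have "strict_sup UNIV c = strict_sup UNIV g"
      unfolding strict_sup_def using c(2,3) by (metis UNIV_I less_trans)
    moreover have "c m < c (Suc m)" for m
      using c(2,3) less_trans by blast
    ultimately show ?thesis
      using club_in_strict_sup[OF C, of UNIV c] c(1) sup by (metis UNIV_I UNIV_not_empty)
  qed
  with sup show ?thesis by blast
qed

context
  fixes m :: "'o::wellorder" and C
  assumes m: "regular_infinite_cardinal m" and C: "club_in C m"
begin

lemma club_in_regular_cardinal_bounded:
  assumes "i < m" "\<And>j. j < i \<Longrightarrow> c j \<in> C" shows "\<exists>z<m. \<forall>j<i. c j < z"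
proof -
  have "|c ` {..<i}| <o |{..<m}|"
    using card_of_image card_of_lessThan_ordLess[OF Card_order_regular_cardinal[OF m] assms(1)]
    by (rule ordLeq_ordLess_trans)
  moreover have "c ` {..<i} \<subseteq> {..<m}"
    using assms(2) C unfolding club_in_def by blast
  ultimately show ?thesis
    using regular_cardinal_bounded[OF m] by (meson imageI lessThan_iff)
qed

lemma club_in_regular_cardinal_strictly_increasing:
  assumes "l < m"
  obtains c where "\<And>i. i < l \<Longrightarrow> c i \<in> C" "strict_mono_on {..<l} c"
proof -
  have "\<exists>c. \<forall>i. i < l \<longrightarrow> c i \<in> C \<and> (\<forall>j<i. c j < c i)"
  proof (rule dependent_wellorder_choice)
    fix i and c :: "'o \<Rightarrow> 'o"
    assume below: "\<And>j. j < i \<Longrightarrow> j < l \<longrightarrow> c j \<in> C \<and> (\<forall>j'<j. c j' < c j)"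
    show "\<exists>x. i < l \<longrightarrow> x \<in> C \<and> (\<forall>j<i. c j < x)"
    proof (cases "i < l")
      case True
      then have "i < m" "\<And>j. j < i \<Longrightarrow> c j \<in> C"
        using below assms less_trans by blast+
      then obtain z where "z < m" "\<forall>j<i. c j < z"
        using club_in_regular_cardinal_bounded by blast
      moreover from this obtain x where "x \<in> C" "z \<le> x"
        using C unfolding club_in_def by blast
      ultimately show ?thesis
        using less_le_trans by blast
    qed blast
  qed auto
  then obtain c where c: "\<And>i. i < l \<Longrightarrow> c i \<in> C \<and> (\<forall>j<i. c j < c i)"
    by blast
  have "strict_mono_on {..<l} c"
    by (rule strict_mono_onI) (use c in simp)
  then show ?thesis
    using that[of c] c by blast
qed

lemma club_in_regular_cardinal_has_cofinality:
  assumes l: "l < m" "cf l = l" "is_limit l" shows "\<exists>b\<in>C. cf b = l"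
proof -
  obtain c where c: "\<And>i. i < l \<Longrightarrow> c i \<in> C" "strict_mono_on {..<l} c"
    using club_in_regular_cardinal_strictly_increasing[OF l(1)] by blast
  obtain z where z: "z < m" "\<And>j. j < l \<Longrightarrow> c j < z"
    using club_in_regular_cardinal_bounded[of l c] l(1) c(1) by blast
  let ?d = "strict_sup {..<l} c"
  have below_sup: "c i < ?d" if "i < l" for i
    using less_strict_sup[of "{..<l}" c z i] z(2) that by simp
  have "?d \<in> C"
  proof (rule club_in_strict_sup[OF C])
    show "{..<l} \<noteq> {}"
      using l(3) unfolding is_limit_def by blast
    show "?d < m"
      using strict_sup_le[of "{..<l}" c z] z by (simp add: le_less_trans)
    show "\<exists>j\<in>{..<l}. c i < c j" if "i \<in> {..<l}" for i
      using is_limitD[OF l(3), of i] that strict_mono_onD[OF c(2)] by auto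
  qed (use c(1) in simp)
  moreover have "cf ?d = cf l"
    using c(2)
  proof (rule cf_eq_cf_of_strict_mono_cofinal)
    show "c ` {..<l} \<subseteq> {..<?d}"
      using below_sup by blast
    show "\<exists>i<l. x \<le> c i" if "x < ?d" for x
      using less_strict_supD[OF that] by blast
  qed
  ultimately show ?thesis
    using l(2) by auto
qed

end

subsection \<open>Elements with an immediate predecessor\<close>

definition pred_in :: "'o::wellorder set \<Rightarrow> 'o \<Rightarrow> 'o \<Rightarrow> bool" where
  "pred_in X b a \<longleftrightarrow> a \<in> X \<and> a < b \<and> (\<forall>c\<in>X. \<not> (a < c \<and> c < b))"

definition successor_elements :: "'o::wellorder set \<Rightarrow> 'o set" where
  "successor_elements X = {b \<in> X. \<exists>a. pred_in X b a}"

lemma pred_in_strict_mono: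
  assumes "pred_in X b a" "pred_in X b' a'" "b' \<in> X" "b' < b" shows "a' < a"
proof -
  have "\<not> a < b'"
    using assms unfolding pred_in_def by blast
  then show ?thesis
    using assms(2) unfolding pred_in_def by (meson leI less_le_trans)
qed

lemma card_of_infinite_insert: "infinite A \<Longrightarrow> |insert a A| \<le>o |A|"
  using infinite_imp_bij_betw2[of A a] card_of_ordIsoI[of _ "insert a A" A] bij_betw_inv
    ordIso_imp_ordLeq
  by (metis Un_insert_right sup_bot_right)

lemma card_of_successor_elements:
  assumes "infinite X" shows "|X| \<le>o |successor_elements X|"
proof -
  define X' where "X' = {x \<in> X. \<exists>y\<in>X. x < y}"
  define g where "g x = (LEAST y. y \<in> X \<and> x < y)" for x
  have g: "g x \<in> X" "x < g x" "\<And>c. c \<in> X \<Longrightarrow> x < c \<Longrightarrow> g x \<le> c" if "x \<in> X'" for x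
    using that LeastI[of "\<lambda>y. y \<in> X \<and> x < y"] Least_le[of "\<lambda>y. y \<in> X \<and> x < y"]
    unfolding X'_def g_def by blast+
  have "pred_in X (g x) x" if "x \<in> X'" for x
    using g[OF that] that unfolding pred_in_def X'_def by (auto dest: leD)
  then have "g ` X' \<subseteq> successor_elements X"
    using g(1) unfolding successor_elements_def by blast
  moreover have "strict_mono_on X' g"
  proof (rule strict_mono_onI)
    fix x y assume "x \<in> X'" "y \<in> X'" "x < y"
    then have "g x \<le> y" "y < g y"
      using g(2,3) unfolding X'_def by blast+
    then show "g x < g y" by (rule le_less_trans)
  qed
  ultimately have le: "|X'| \<le>o |successor_elements X|"
    using card_of_ordLeq strict_mono_on_imp_inj_on by blast
  have maximum_unique: "x = y" if "x \<in> X - X'" "y \<in> X - X'" for x y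
    using that linorder_neqE[of x y] unfolding X'_def by blast
  have "\<exists>m. X \<subseteq> insert m X'"
  proof (cases "X \<subseteq> X'")
    case False
    then obtain m where "m \<in> X - X'" by blast
    then have "x \<in> insert m X'" if "x \<in> X" for x
      using that maximum_unique[of x m] by blast
    then show ?thesis by blast
  qed auto
  then obtain m where m: "X \<subseteq> insert m X'" ..
  then have "infinite X'"
    using assms finite_subset by blast
  then have "|X| \<le>o |X'|"
    using ordLeq_transitive[OF card_of_mono1[OF m] card_of_infinite_insert] by blast
  then show ?thesis
    using le by (rule ordLeq_transitive)
qed

subsection \<open>Regressive maps\<close>

lemma no_infinite_regression:
  assumes "wfp R"
    and regressive: "\<And>n x. x \<in> Z (Suc n) \<Longrightarrow> e n x \<in> Z n \<and> R (e n x) x"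
    and mono: "\<And>n x y. x \<in> Z (Suc n) \<Longrightarrow> y \<in> Z (Suc n) \<Longrightarrow> R x y \<Longrightarrow> R (e n x) (e n y)"
  shows "\<exists>n::nat. x \<notin> Z n"
proof (rule ccontr)
  assume "\<not> (\<exists>n. x \<notin> Z n)"
  then have x: "x \<in> Z n" for n by blast
  define descent where "descent = rec_nat id (\<lambda>n f. f \<circ> e n)"
  have descent: "descent 0 y = y" "descent (Suc n) y = descent n (e n y)" for n y
    unfolding descent_def by simp_all
  have "R (descent n y) (descent n z)" if "y \<in> Z n" "z \<in> Z n" "R y z" for n y z
    using that by (induction n arbitrary: y z) (use regressive mono in \<open>auto simp: descent\<close>)
  then have "R (descent (Suc n) x) (descent n x)" for n
    using regressive[OF x] x by (simp add: descent)
  then have "\<exists>f. \<forall>n. R (f (Suc n)) (f n)"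
    by (intro exI[of _ "\<lambda>n. descent n x"]) simp
  then show False
    using \<open>wfp R\<close> unfolding wfp_def wf_iff_no_infinite_down_chain by simp
qed

section \<open>Sequences\<close>

definition is_seq :: "'o::wellorder node \<Rightarrow> bool" where
  "is_seq t \<longleftrightarrow> (\<exists>a. dom t = {..<a})"

definition prefix_less :: "'o::wellorder node \<Rightarrow> 'o node \<Rightarrow> bool" (infix "\<sqsubset>" 50) where
  "s \<sqsubset> t \<longleftrightarrow> is_seq s \<and> is_seq t \<and> s \<subseteq>\<^sub>m t \<and> s \<noteq> t"

abbreviation snoc :: "'o::wellorder node \<Rightarrow> 'o \<Rightarrow> 'o node" (infixl "\<frown>" 65) where
  "t \<frown> b \<equiv> t(len t \<mapsto> b)"

lemma len_eq: "dom t = {..<a} \<Longrightarrow> len t = a"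
  unfolding len_def by (auto simp: lessThan_eq_iff)

lemma is_seqI: "dom t = {..<a} \<Longrightarrow> is_seq t"
  unfolding is_seq_def by blast

lemma dom_seq: "is_seq t \<Longrightarrow> dom t = {..<len t}"
  unfolding is_seq_def using len_eq by blast

lemma seq_value: "is_seq t \<Longrightarrow> x < len t \<Longrightarrow> t x = Some (the (t x))"
  using dom_seq[of t] by (metis domIff lessThan_iff option.exhaust_sel)

lemma restrict_restrict_lessThan: "a \<le> b \<Longrightarrow> t |` {..<b} |` {..<a} = t |` {..<(a::'o::wellorder)}"
  by (simp add: Int_absorb1)

lemma restrict_cong: "(\<And>y. y < x \<Longrightarrow> s y = t y) \<Longrightarrow> s |` {..<x} = t |` {..<x}"
  by (auto simp: restrict_map_def fun_eq_iff)

lemma restrict_lessThan_map_le: "t |` A \<subseteq>\<^sub>m t"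
  by (auto simp: map_le_def)

lemma
  assumes "is_seq t" "a \<le> len t"
  shows is_seq_restrict: "is_seq (t |` {..<a})" and len_restrict: "len (t |` {..<a}) = a"
proof -
  have "dom (t |` {..<a}) = {..<a}"
    using assms dom_seq[OF assms(1)] by auto
  then show "is_seq (t |` {..<a})" "len (t |` {..<a}) = a"
    using is_seqI len_eq by blast+
qed

lemma restrict_all: "is_seq t \<Longrightarrow> len t \<le> a \<Longrightarrow> t |` {..<a} = t"
  using dom_seq[of t] by (intro map_le_antisym restrict_lessThan_map_le) (auto simp: map_le_def)

lemma seq_le_value: "s \<subseteq>\<^sub>m t \<Longrightarrow> is_seq s \<Longrightarrow> x < len s \<Longrightarrow> t x = s x"
  using dom_seq[of s] by (auto simp: map_le_def)

lemma seq_le_iff: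
  assumes "is_seq s" "is_seq t"
  shows "s \<subseteq>\<^sub>m t \<longleftrightarrow> len s \<le> len t \<and> t |` {..<len s} = s"
proof
  assume le: "s \<subseteq>\<^sub>m t"
  then have "len s \<le> len t"
    using map_le_implies_dom_le[OF le] assms dom_seq by (metis lessThan_subset_iff)
  moreover have "t |` {..<len s} = s |` {..<len s}"
    using seq_le_value[OF le assms(1)] by (rule restrict_cong)
  ultimately show "len s \<le> len t \<and> t |` {..<len s} = s"
    using restrict_all[OF assms(1)] by simp
next
  assume "len s \<le> len t \<and> t |` {..<len s} = s"
  then show "s \<subseteq>\<^sub>m t"
    using restrict_lessThan_map_le by metis
qed

lemma seq_le_len: "is_seq s \<Longrightarrow> is_seq t \<Longrightarrow> s \<subseteq>\<^sub>m t \<Longrightarrow> len s \<le> len t"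
  using seq_le_iff by blast

lemma seq_le_of_len_le:
  assumes "is_seq s" "is_seq t" "is_seq u" "s \<subseteq>\<^sub>m u" "t \<subseteq>\<^sub>m u" "len s \<le> len t"
  shows "s \<subseteq>\<^sub>m t"
proof -
  have initial: "u |` {..<len s} = s" "u |` {..<len t} = t"
    using assms seq_le_iff by blast+
  have "t |` {..<len s} = s"
    using restrict_restrict_lessThan[OF assms(6), of u] unfolding initial .
  then show ?thesis
    using assms seq_le_iff by blast
qed

lemma seq_le_linear:
  assumes "is_seq s" "is_seq t" "is_seq u" "s \<subseteq>\<^sub>m u" "t \<subseteq>\<^sub>m u"
  shows "s \<subseteq>\<^sub>m t \<or> t \<subseteq>\<^sub>m s"
  using seq_le_of_len_le[of s t u] seq_le_of_len_le[of t s u] assms linear[of "len s" "len t"]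
  by blast

lemma seq_le_len_eq: "is_seq s \<Longrightarrow> is_seq t \<Longrightarrow> s \<subseteq>\<^sub>m t \<Longrightarrow> len t \<le> len s \<Longrightarrow> s = t"
  using seq_le_iff[of s t] restrict_all[of t "len s"] by (metis (no_types))

lemma seq_comparable_same_len:
  "is_seq s \<Longrightarrow> is_seq t \<Longrightarrow> s \<subseteq>\<^sub>m t \<or> t \<subseteq>\<^sub>m s \<Longrightarrow> len s = len t \<Longrightarrow> s = t"
  using seq_le_len_eq[of s t] seq_le_len_eq[of t s] by auto

lemma seq_first_difference:
  assumes "is_seq s" "is_seq t" "\<not> s \<subseteq>\<^sub>m t" "\<not> t \<subseteq>\<^sub>m s"
  obtains x where "x < len s" "x < len t" "s |` {..<x} = t |` {..<x}" "s x \<noteq> t x"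
proof -
  define x where "x = (LEAST x. s x \<noteq> t x)"
  have "\<exists>x. s x \<noteq> t x"
    using assms(3) unfolding map_le_def by blast
  then have "s x \<noteq> t x"
    unfolding x_def by (rule LeastI_ex)
  have below: "s y = t y" if "y < x" for y
    using not_less_Least[of y "\<lambda>x. s x \<noteq> t x"] that unfolding x_def by blast
  then have "s |` {..<x} = t |` {..<x}"
    by (rule restrict_cong)
  moreover have "x < len s"
  proof (rule ccontr)
    assume "\<not> x < len s"
    then show False
      using assms(1,3) below dom_seq[OF assms(1)] unfolding map_le_def by auto
  qed
  moreover have "x < len t"
  proof (rule ccontr)
    assume "\<not> x < len t"
    then show False
      using assms(2,4) below dom_seq[OF assms(2)] unfolding map_le_def
      by (metis less_le_trans not_le lessThan_iff)
  qed
  ultimately show ?thesis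
    using \<open>s x \<noteq> t x\<close> that by blast
qed

lemma prefix_less_iff: "s \<sqsubset> t \<longleftrightarrow> is_seq s \<and> is_seq t \<and> s \<subseteq>\<^sub>m t \<and> len s < len t"
  unfolding prefix_less_def using seq_le_len_eq[of s t] by (auto simp: not_le[symmetric])

lemma prefix_lessD: "s \<sqsubset> t \<Longrightarrow> s \<subseteq>\<^sub>m t" "s \<sqsubset> t \<Longrightarrow> len s < len t"
  unfolding prefix_less_iff by blast+

lemma prefix_less_le_trans: "s \<sqsubset> t \<Longrightarrow> t \<subseteq>\<^sub>m u \<Longrightarrow> is_seq u \<Longrightarrow> s \<sqsubset> u"
  unfolding prefix_less_iff using map_le_trans seq_le_len less_le_trans by blast

lemma prefix_le_less_trans: "s \<subseteq>\<^sub>m t \<Longrightarrow> t \<sqsubset> u \<Longrightarrow> is_seq s \<Longrightarrow> s \<sqsubset> u"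
  unfolding prefix_less_iff using map_le_trans seq_le_len le_less_trans by blast

lemma prefix_less_not_map_le: "s \<sqsubset> t \<Longrightarrow> \<not> t \<subseteq>\<^sub>m s"
  unfolding prefix_less_def using map_le_antisym by blast

lemma prefix_less_restrict: "is_seq t \<Longrightarrow> x < len t \<Longrightarrow> t |` {..<x} \<sqsubset> t"
  unfolding prefix_less_iff by (simp add: is_seq_restrict len_restrict restrict_lessThan_map_le)

lemma restrict_prefix_less_restrict:
  assumes "is_seq t" "x < y" "y \<le> len t" shows "t |` {..<x} \<sqsubset> t |` {..<y}"
proof -
  have "t |` {..<y} |` {..<x} \<sqsubset> t |` {..<y}"
    using assms by (intro prefix_less_restrict is_seq_restrict) (simp_all add: len_restrict)
  then show ?thesis
    unfolding restrict_restrict_lessThan[OF less_imp_le[OF assms(2)]] .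
qed

lemma wfp_prefix_less: "wfp ((\<sqsubset>) :: 'o::wellorder node \<Rightarrow> 'o node \<Rightarrow> bool)"
  by (rule wfp_if_convertible_to_wfp[OF wfp_on_less, of _ len]) (rule prefix_lessD(2))

lemma
  assumes "is_seq t" "len t < m"
  shows is_seq_snoc: "is_seq (t \<frown> b)" and len_snoc: "len (t \<frown> b) = next_ord (len t)"
proof -
  have "dom (t \<frown> b) = insert (len t) {..<len t}"
    using dom_seq[OF assms(1)] by auto
  also have "\<dots> = {..<next_ord (len t)}"
    using less_next_ord_iff[OF assms(2)] by (auto simp: le_less)
  finally show "is_seq (t \<frown> b)" "len (t \<frown> b) = next_ord (len t)"
    using is_seqI len_eq by blast+
qed

lemma prefix_less_snoc:
  assumes "is_seq t" "len t < m" shows "t \<sqsubset> t \<frown> b"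
proof -
  have "t \<subseteq>\<^sub>m t \<frown> b"
    using dom_seq[OF assms(1)] by (auto simp: map_le_def)
  then show ?thesis
    unfolding prefix_less_iff using assms is_seq_snoc[OF assms] len_snoc[OF assms] less_next_ord
    by simp
qed

lemma prefix_less_snoc_iff:
  assumes "is_seq t" "len t < m" shows "s \<sqsubset> t \<frown> b \<longleftrightarrow> is_seq s \<and> s \<subseteq>\<^sub>m t"
proof
  assume s: "s \<sqsubset> t \<frown> b"
  then have "len s \<le> len t"
    using prefix_lessD(2)[OF s] len_snoc[OF assms] less_next_ord_iff[OF assms(2)] by simp
  then show "is_seq s \<and> s \<subseteq>\<^sub>m t"
    using seq_le_of_len_le[of s t "t \<frown> b"] s prefix_less_snoc[OF assms]
    unfolding prefix_less_def by blast
qed (use prefix_less_snoc[OF assms] prefix_le_less_trans in blast)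

lemma snoc_restrict: "is_seq t \<Longrightarrow> (t \<frown> b) |` {..<len t} = t"
  using restrict_all[of t "len t"] by (simp add: restrict_cong[of "len t" "t \<frown> b" t])

lemma snoc_le_iff:
  assumes "is_seq t" "t \<subseteq>\<^sub>m u" shows "t \<frown> b \<subseteq>\<^sub>m u \<longleftrightarrow> u (len t) = Some b"
  using assms by (auto simp: map_le_def)

lemma restrict_next_ord:
  assumes "is_seq t" "x < len t" "t x = Some b"
  shows "t |` {..<next_ord x} = t |` {..<x} \<frown> b"
  using assms less_next_ord_iff[OF assms(2)] len_restrict[OF assms(1), of x]
  by (auto simp: restrict_map_def fun_eq_iff le_less)

subsection \<open>Unions of increasing sequences\<close>

definition seq_union :: "'i set \<Rightarrow> ('i \<Rightarrow> 'o::wellorder node) \<Rightarrow> 'o node \<Rightarrow> bool" where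
  "seq_union I w u \<longleftrightarrow> (\<forall>i\<in>I. w i \<sqsubset> u) \<and> (\<forall>x<len u. \<exists>i\<in>I. x < len (w i))"

lemma seq_glue:
  assumes seq: "\<And>i. i \<in> I \<Longrightarrow> is_seq (w i)" and le: "\<And>i. i \<in> I \<Longrightarrow> len (w i) \<le> d"
    and chain: "\<And>i j. i \<in> I \<Longrightarrow> j \<in> I \<Longrightarrow> w i \<subseteq>\<^sub>m w j \<or> w j \<subseteq>\<^sub>m w i"
    and covered: "\<And>x. x < d \<Longrightarrow> \<exists>i\<in>I. x < len (w i)"
  obtains u where "is_seq u" "len u = d" "\<And>i. i \<in> I \<Longrightarrow> w i \<subseteq>\<^sub>m u"
proof -
  define u where "u x = (if x < d then w (SOME i. i \<in> I \<and> x < len (w i)) x else None)" for x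
  have u_eq: "u x = w i x" if i: "i \<in> I" "x < len (w i)" for i x
  proof -
    define j where "j = (SOME i. i \<in> I \<and> x < len (w i))"
    have j: "j \<in> I" "x < len (w j)"
      unfolding j_def using someI[of "\<lambda>i. i \<in> I \<and> x < len (w i)"] i by blast+
    have "u x = w j x"
      unfolding u_def j_def using le[OF i(1)] i(2) by auto
    also have "\<dots> = w i x"
      using chain[OF i(1) j(1)] seq_le_value[OF _ seq] i j by metis
    finally show ?thesis .
  qed
  have "u x \<noteq> None \<longleftrightarrow> x < d" for x
  proof
    assume "x < d"
    then obtain i where "i \<in> I" "x < len (w i)"
      using covered by blast
    then show "u x \<noteq> None"
      using u_eq dom_seq[OF seq] by (metis domIff lessThan_iff)
  qed (auto simp: u_def split: if_splits)
  then have dom: "dom u = {..<d}"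
    by (auto simp: dom_def)
  have "w i \<subseteq>\<^sub>m u" if "i \<in> I" for i
    using u_eq[OF that] dom_seq[OF seq[OF that]] by (auto simp: map_le_def)
  with is_seqI[OF dom] len_eq[OF dom] show ?thesis by (rule that)
qed

lemma seq_union_exists:
  assumes seq: "\<And>i. i \<in> I \<Longrightarrow> is_seq (w i)" and bounded: "\<And>i. i \<in> I \<Longrightarrow> len (w i) < z"
    and chain: "\<And>i j. i \<in> I \<Longrightarrow> j \<in> I \<Longrightarrow> w i \<subseteq>\<^sub>m w j \<or> w j \<subseteq>\<^sub>m w i"
    and no_max: "\<And>i. i \<in> I \<Longrightarrow> \<exists>j\<in>I. w i \<sqsubset> w j"
  obtains u where "is_seq u" "len u = strict_sup I (\<lambda>i. len (w i))" "seq_union I w u"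
proof -
  let ?d = "strict_sup I (\<lambda>i. len (w i))"
  have below_sup: "len (w i) < ?d" if "i \<in> I" for i
    using less_strict_sup[of I "\<lambda>i. len (w i)"] bounded that by blast
  have "\<exists>j\<in>I. len (w i) < len (w j)" if "i \<in> I" for i
    using no_max[OF that] prefix_lessD(2) by blast
  then have covered: "\<exists>i\<in>I. x < len (w i)" if "x < ?d" for x
    using less_strict_supD_strict[of I "\<lambda>i. len (w i)"] that by blast
  obtain u where u: "is_seq u" "len u = ?d" "\<And>i. i \<in> I \<Longrightarrow> w i \<subseteq>\<^sub>m u"
    using seq_glue[OF seq less_imp_le[OF below_sup] chain covered] by blast
  then have "seq_union I w u"
    unfolding seq_union_def prefix_less_iff using seq below_sup covered by auto
  with u(1,2) show ?thesis by (rule that)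
qed

lemma seq_union_is_limit:
  assumes "seq_union I w u" "I \<noteq> {}" shows "is_limit (len u)"
  unfolding is_limit_def
proof (intro conjI allI impI)
  show "\<exists>x. x < len u"
    using assms prefix_lessD(2) unfolding seq_union_def by blast
  show "\<exists>y<len u. x < y" if "x < len u" for x
    using assms(1) that prefix_lessD(2) unfolding seq_union_def by blast
qed

lemma seq_union_graph:
  assumes "is_seq u" "seq_union I w u" shows "Map.graph u = (\<Union>i\<in>I. Map.graph (w i))"
proof (intro set_eqI iffI)
  fix e assume "e \<in> Map.graph u"
  then obtain x y where xy: "e = (x, y)" "u x = Some y"
    by (metis in_graphD surj_pair)
  then have "x < len u"
    using dom_seq[OF assms(1)] by blast
  then obtain i where i: "i \<in> I" "x < len (w i)" "w i \<sqsubset> u"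
    using assms(2) unfolding seq_union_def by blast
  then have "w i x = Some y"
    using seq_le_value[of "w i" u x] xy(2) unfolding prefix_less_def by simp
  then have "e \<in> Map.graph (w i)"
    unfolding xy(1) by (rule in_graphI)
  with i(1) show "e \<in> (\<Union>i\<in>I. Map.graph (w i))"
    by blast
next
  fix e assume "e \<in> (\<Union>i\<in>I. Map.graph (w i))"
  then obtain i x y where i: "i \<in> I" "e = (x, y)" "w i x = Some y"
    by (metis UN_E in_graphD surj_pair)
  have "w i \<subseteq>\<^sub>m u"
    using i(1) assms(2) prefix_lessD(1) unfolding seq_union_def by blast
  then have "u x = Some y"
    using i(3) unfolding map_le_def by (metis domI)
  then show "e \<in> Map.graph u"
    unfolding i(2) by (rule in_graphI)
qed

lemma graph_inject: "Map.graph s = Map.graph t \<Longrightarrow> s = t"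
  by (intro ext) (metis in_graphD in_graphI not_None_eq)

section \<open>Closed trees\<close>

definition cone :: "'o::wellorder node set \<Rightarrow> 'o node \<Rightarrow> 'o node set" where
  "cone p t = {u \<in> p. u \<subseteq>\<^sub>m t \<or> t \<subseteq>\<^sub>m u}"

definition Split :: "'o::wellorder node set \<Rightarrow> 'o node set" where
  "Split p = {s \<in> p. \<exists>a\<in>OSucc p s. \<exists>b\<in>OSucc p s. a \<noteq> b}"

definition subtree :: "'o::wellorder node set \<Rightarrow> ('o node \<Rightarrow> 'o set) \<Rightarrow> 'o node set" where
  "subtree p Y = {t \<in> p. \<forall>\<beta><len t. the (t \<beta>) \<in> Y (t |` {..<\<beta>})}"

lemma cone_subset: "cone p t \<subseteq> p"
  unfolding cone_def by blast

lemma subtree_subset: "subtree p Y \<subseteq> p"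
  unfolding subtree_def by blast

lemma OSucc_mono: "q \<subseteq> p \<Longrightarrow> OSucc q s \<subseteq> OSucc p s"
  unfolding OSucc_def by blast

lemma Split_subset: "Split p \<subseteq> p"
  unfolding Split_def by blast

lemma Split_mono: "q \<subseteq> p \<Longrightarrow> Split q \<subseteq> Split p"
  unfolding Split_def OSucc_def by blast

lemma card_of_Succ: "|Succ T t| =o |OSucc T t|"
proof -
  have "inj_on (\<lambda>b. t \<frown> b) (OSucc T t)"
    by (rule inj_onI) (metis fun_upd_same option.inject)
  moreover have "Succ T t = (\<lambda>b. t \<frown> b) ` OSucc T t"
    unfolding Succ_def OSucc_def by blast
  ultimately show ?thesis
    using card_of_ordIsoI[OF inj_on_imp_bij_betw] ordIso_symmetric by metis
qed

lemma splitting_iff: "splitting k T \<alpha> t \<longleftrightarrow> |{..<k \<alpha>}| \<le>o |OSucc T t|"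
  unfolding splitting_def
  using ordLeq_ordIso_trans[OF _ card_of_Succ]
    ordLeq_ordIso_trans[OF _ ordIso_symmetric[OF card_of_Succ]]
  by (intro iffI)

locale cardinal_tower = regular_uncountable lam for lam :: "'o::wellorder" +
  fixes k :: "'o \<Rightarrow> 'o"
  assumes k_regular: "\<And>\<alpha>. \<alpha> < lam \<Longrightarrow> regular_infinite_cardinal (k \<alpha>)"
    and k_strict_mono: "strict_mono_on {..<lam} k"
begin

definition closed_tree :: "'o node set \<Rightarrow> bool" where
  "closed_tree p \<longleftrightarrow> is_tree lam k p \<and> lt_closed lam p"

definition branches :: "'o node set \<Rightarrow> 'o node set" where
  "branches p = {b. is_seq b \<and> len b = lam \<and> (\<forall>\<beta><lam. b |` {..<\<beta>} \<in> p)}"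

lemma k_infinite: "\<alpha> < lam \<Longrightarrow> infinite {..<k \<alpha>}"
  using infinite_regular_cardinal[OF k_regular] .

lemma k_mono: "\<alpha> \<le> \<beta> \<Longrightarrow> \<beta> < lam \<Longrightarrow> k \<alpha> \<le> k \<beta>"
  using strict_mono_on_leD[OF k_strict_mono] by simp

lemma nodes_iff:
  "t \<in> nodes lam k \<longleftrightarrow> is_seq t \<and> len t < lam \<and> (\<forall>\<beta><len t. the (t \<beta>) < k \<beta>)"
proof
  assume "t \<in> nodes lam k"
  then obtain \<alpha> where "\<alpha> < lam" "dom t = {..<\<alpha>}" "\<forall>\<beta><\<alpha>. the (t \<beta>) < k \<beta>"
    unfolding nodes_def by blast
  then show "is_seq t \<and> len t < lam \<and> (\<forall>\<beta><len t. the (t \<beta>) < k \<beta>)"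
    using is_seqI[of t \<alpha>] len_eq[of t \<alpha>] by simp
qed (use dom_seq in \<open>auto simp: nodes_def\<close>)

lemma closed_treeI:
  assumes "p \<noteq> {}" "p \<subseteq> nodes lam k"
    and "\<And>s t. t \<in> p \<Longrightarrow> is_seq s \<Longrightarrow> s \<subseteq>\<^sub>m t \<Longrightarrow> s \<in> p"
    and successor: "\<And>t. t \<in> p \<Longrightarrow> OSucc p t \<noteq> {}"
    and limit: "\<And>f. is_seq f \<Longrightarrow> len f < lam \<Longrightarrow> is_limit (len f) \<Longrightarrow>
      (\<And>\<beta>. \<beta> < len f \<Longrightarrow> f |` {..<\<beta>} \<in> p) \<Longrightarrow> f \<in> p"
  shows "closed_tree p"
  unfolding closed_tree_def
proof
  show "is_tree lam k p"
    unfolding is_tree_def using assms(1-3) nodes_iff by blast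
  have "\<exists>u\<in>p. t \<subseteq>\<^sub>m u \<and> t \<noteq> u" if t: "t \<in> p" for t
  proof -
    obtain b where "t \<frown> b \<in> p"
      using successor[OF t] unfolding OSucc_def by blast
    moreover have "t \<sqsubset> t \<frown> b"
      using t assms(2) nodes_iff prefix_less_snoc by blast
    ultimately show ?thesis
      unfolding prefix_less_def by blast
  qed
  moreover have "f \<in> p"
    if "\<delta> < lam" "is_limit \<delta>" "dom f = {..<\<delta>}" "\<forall>\<beta><\<delta>. f |` {..<\<beta>} \<in> p" for \<delta> f
    using limit[of f] that is_seqI[of f] len_eq[of f] by simp
  ultimately show "lt_closed lam p"
    unfolding lt_closed_def by blast
qed

context
  fixes p :: "'o node set"
  assumes p: "closed_tree p"
begin

lemma tree_node:
  assumes "t \<in> p"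
  shows tree_is_seq: "is_seq t" and tree_len_less: "len t < lam"
    and tree_value_less: "x < len t \<Longrightarrow> the (t x) < k x"
  using p assms nodes_iff unfolding closed_tree_def is_tree_def by blast+

lemma tree_le: "t \<in> p \<Longrightarrow> is_seq s \<Longrightarrow> s \<subseteq>\<^sub>m t \<Longrightarrow> s \<in> p"
proof -
  assume t: "t \<in> p" and s: "is_seq s" "s \<subseteq>\<^sub>m t"
  have "len s \<le> len t"
    using seq_le_len s tree_is_seq[OF t] by blast
  moreover have "t x = s x" if "x < len s" for x
    using seq_le_value s that by blast
  ultimately have "s \<in> nodes lam k"
    unfolding nodes_iff using s(1) tree_node[OF t] by (metis le_less_trans less_le_trans)
  then show "s \<in> p"
    using p t s(2) unfolding closed_tree_def is_tree_def by blast
qed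

lemma tree_restrict:
  assumes "t \<in> p" shows "t |` {..<a} \<in> p"
proof (cases "a \<le> len t")
  case True
  then show ?thesis
    using tree_le[OF assms is_seq_restrict restrict_lessThan_map_le] tree_is_seq[OF assms] by blast
next
  case False
  then show ?thesis
    using restrict_all[OF tree_is_seq[OF assms], of a] assms by simp
qed

lemma empty_in_tree: "Map.empty \<in> p"
proof -
  obtain t where "t \<in> p"
    using p unfolding closed_tree_def is_tree_def by blast
  moreover have "is_seq (Map.empty :: 'o node)"
    by (rule is_seqI[of _ zero_ord]) auto
  ultimately show ?thesis
    using tree_le by simp
qed

lemma tree_snoc:
  assumes "t \<in> p"
  shows "is_seq (t \<frown> b)" "len (t \<frown> b) = next_ord (len t)" "t \<sqsubset> t \<frown> b"
  using tree_node(1,2)[OF assms] is_seq_snoc len_snoc prefix_less_snoc by blast+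

lemma OSucc_less:
  assumes "t \<in> p" "b \<in> OSucc p t" shows "b < k (len t)"
proof -
  have "len t < len (t \<frown> b)"
    using tree_snoc(3)[OF assms(1)] prefix_lessD(2) by blast
  then show ?thesis
    using tree_value_less[of "t \<frown> b" "len t"] assms(2) unfolding OSucc_def by simp
qed

lemma value_in_OSucc:
  assumes "u \<in> p" "t \<sqsubset> u" shows "the (u (len t)) \<in> OSucc p t"
proof -
  have t: "is_seq t" "t \<subseteq>\<^sub>m u" "len t < len u"
    using assms(2) unfolding prefix_less_iff by blast+
  then have "t \<frown> the (u (len t)) \<subseteq>\<^sub>m u"
    using snoc_le_iff seq_value tree_is_seq[OF assms(1)] by blast
  then show ?thesis
    unfolding OSucc_def using tree_le[OF assms(1) is_seq_snoc[OF t(1,3)]] by blast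
qed

lemma OSucc_nonempty:
  assumes "t \<in> p" shows "OSucc p t \<noteq> {}"
proof -
  obtain u where "u \<in> p" "t \<subseteq>\<^sub>m u" "t \<noteq> u"
    using p assms unfolding closed_tree_def lt_closed_def by blast
  then have "t \<sqsubset> u"
    unfolding prefix_less_def using tree_is_seq assms by blast
  then show ?thesis
    using value_in_OSucc \<open>u \<in> p\<close> by blast
qed

lemma tree_limit:
  assumes "is_seq f" "len f < lam" "is_limit (len f)" "\<And>\<beta>. \<beta> < len f \<Longrightarrow> f |` {..<\<beta>} \<in> p"
  shows "f \<in> p"
proof -
  have "len f < lam \<and> is_limit (len f) \<and> dom f = {..<len f} \<and> (\<forall>\<beta><len f. f |` {..<\<beta>} \<in> p)"
    using assms dom_seq by blast
  moreover have "lt_closed lam p"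
    using p unfolding closed_tree_def by blast
  ultimately show ?thesis
    unfolding lt_closed_def by blast
qed

lemma tree_mem_of_steps:
  assumes f: "is_seq f" "len f < lam"
    and step: "\<And>x. x < len f \<Longrightarrow> f |` {..<x} \<in> p \<Longrightarrow> the (f x) \<in> OSucc p (f |` {..<x})"
  shows "f \<in> p"
proof -
  have "f |` {..<\<beta>} \<in> p" if "\<beta> \<le> len f" for \<beta>
    using that
  proof (induction \<beta> rule: less_induct)
    case (less \<beta>)
    show ?case
    proof (cases \<beta> rule: ord_cases)
      case zero
      then have "f |` {..<\<beta>} = Map.empty"
        by (auto simp: restrict_map_def)
      then show ?thesis
        using empty_in_tree by simp
    next
      case (succ \<alpha>)
      then have \<alpha>: "\<alpha> < len f" "f |` {..<\<alpha>} \<in> p"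
        using less by auto
      have "f |` {..<\<beta>} = f |` {..<\<alpha>} \<frown> the (f \<alpha>)"
        unfolding succ(2) using f(1) \<alpha>(1) seq_value[OF f(1) \<alpha>(1)] by (rule restrict_next_ord)
      with step[OF \<alpha>] show ?thesis
        unfolding OSucc_def by (simp only: mem_Collect_eq)
    next
      case limit
      have len: "len (f |` {..<\<beta>}) = \<beta>"
        using len_restrict[OF f(1) less.prems] .
      show ?thesis
      proof (rule tree_limit)
        show "f |` {..<\<beta>} |` {..<\<gamma>} \<in> p" if "\<gamma> < len (f |` {..<\<beta>})" for \<gamma>
        proof -
          have "f |` {..<\<gamma>} \<in> p"
            using less that len by simp
          then show ?thesis
            using restrict_restrict_lessThan[of \<gamma> \<beta> f] that len by simp
        qed
      qed (use is_seq_restrict[OF f(1) less.prems] len limit less.prems f(2) in simp_all)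
    qed
  qed
  then show ?thesis
    using restrict_all[OF f(1)] by (metis order_refl)
qed

lemma branchI:
  assumes b: "is_seq b" "len b = lam"
    and step: "\<And>x. x < lam \<Longrightarrow> b |` {..<x} \<in> p \<Longrightarrow> the (b x) \<in> OSucc p (b |` {..<x})"
  shows "b \<in> branches p"
proof -
  have "b |` {..<\<beta>} \<in> p" if \<beta>: "\<beta> < lam" for \<beta>
  proof (rule tree_mem_of_steps)
    have len: "len (b |` {..<\<beta>}) = \<beta>"
      using len_restrict[OF b(1), of \<beta>] b(2) \<beta> by simp
    then show "len (b |` {..<\<beta>}) < lam"
      using \<beta> by simp
    show "is_seq (b |` {..<\<beta>})"
      using is_seq_restrict[OF b(1), of \<beta>] b(2) \<beta> by simp
    fix x assume "x < len (b |` {..<\<beta>})" "b |` {..<\<beta>} |` {..<x} \<in> p"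
    then show "the ((b |` {..<\<beta>}) x) \<in> OSucc p (b |` {..<\<beta>} |` {..<x})"
      using step[of x] restrict_restrict_lessThan[of x \<beta> b] len \<beta> by simp
  qed
  then show ?thesis
    unfolding branches_def using b by blast
qed

lemma branch_exists:
  assumes t: "t \<in> p" obtains b where "b \<in> branches p" "t \<subseteq>\<^sub>m b"
proof -
  note seq = tree_is_seq[OF t] and len = tree_len_less[OF t]
  define step where "step b x r \<longleftrightarrow> (if x < len t then r = t x
    else if x < lam then r \<noteq> None \<and> (b |` {..<x} \<in> p \<longrightarrow> the r \<in> OSucc p (b |` {..<x}))
    else r = None)" for b :: "'o node" and x r
  have "\<exists>b. \<forall>x. step b x (b x)"
  proof (rule dependent_wellorder_choice)
    fix r and f g :: "'o node" and x
    assume "\<And>y. y < x \<Longrightarrow> f y = g y"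
    then show "step f x r = step g x r"
      unfolding step_def using restrict_cong[of x f g] by simp
  next
    fix x and f :: "'o node"
    have "\<exists>r. r \<noteq> None \<and> (f |` {..<x} \<in> p \<longrightarrow> the r \<in> OSucc p (f |` {..<x}))"
      using OSucc_nonempty[of "f |` {..<x}"] by (metis ex_in_conv option.distinct(1) option.sel)
    then show "\<exists>r. step f x r"
      unfolding step_def by auto
  qed
  then obtain b where step: "\<And>x. step b x (b x)" by blast
  have "b x \<noteq> None \<longleftrightarrow> x < lam" for x
    using step[of x] seq_value[OF seq, of x] len unfolding step_def by (auto split: if_splits)
  then have dom: "dom b = {..<lam}"
    by (auto simp: dom_def)
  have initial: "b x = t x" if "x < len t" for x
    using step[of x] that unfolding step_def by simp
  have "b \<in> branches p"
  proof (rule branchI[OF is_seqI[OF dom] len_eq[OF dom]])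
    fix x assume x: "x < lam" "b |` {..<x} \<in> p"
    show "the (b x) \<in> OSucc p (b |` {..<x})"
    proof (cases "x < len t")
      case True
      have "b |` {..<x} = t |` {..<x}"
        using initial True by (intro restrict_cong) simp
      then show ?thesis
        using value_in_OSucc[OF t prefix_less_restrict[OF seq True]] initial[OF True]
          len_restrict[OF seq] True
        by simp
    qed (use x step[of x] in \<open>simp add: step_def\<close>)
  qed
  moreover have "t \<subseteq>\<^sub>m b"
    using initial dom_seq[OF seq] by (auto simp: map_le_def)
  ultimately show ?thesis
    using that by blast
qed

lemma branch_restrict:
  assumes "b \<in> branches p" "\<beta> < lam"
  shows "b |` {..<\<beta>} \<in> p" "len (b |` {..<\<beta>}) = \<beta>"
  using assms len_restrict[of b \<beta>] unfolding branches_def by auto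

lemma branch_le_restrict:
  assumes "b \<in> branches p" "\<beta> < lam" "is_seq s" "s \<subseteq>\<^sub>m b" "len s \<le> \<beta>"
  shows "s \<subseteq>\<^sub>m b |` {..<\<beta>}"
  using assms seq_le_of_len_le[of s "b |` {..<\<beta>}" b] is_seq_restrict[of b] len_restrict[of b]
    restrict_lessThan_map_le
  unfolding branches_def by auto

lemma tree_extend_len:
  assumes t: "t \<in> p" and "\<beta> < lam" "len t \<le> \<beta>"
  obtains u where "u \<in> p" "t \<subseteq>\<^sub>m u" "len u = \<beta>"
proof -
  obtain b where "b \<in> branches p" "t \<subseteq>\<^sub>m b"
    using branch_exists[OF t] by blast
  then show ?thesis
    using that[of "b |` {..<\<beta>}"] branch_restrict branch_le_restrict tree_is_seq[OF t] assms by blast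
qed

lemma tree_has_len:
  assumes "\<beta> < lam" obtains u where "u \<in> p" "len u = \<beta>"
  using branch_exists[OF empty_in_tree] branch_restrict assms by metis

lemma tree_union:
  assumes w: "\<And>i. i \<in> I \<Longrightarrow> w i \<in> p" and bounded: "z < lam" "\<And>i. i \<in> I \<Longrightarrow> len (w i) < z"
    and chain: "\<And>i j. i \<in> I \<Longrightarrow> j \<in> I \<Longrightarrow> w i \<subseteq>\<^sub>m w j \<or> w j \<subseteq>\<^sub>m w i"
    and no_max: "\<And>i. i \<in> I \<Longrightarrow> \<exists>j\<in>I. w i \<sqsubset> w j" and "I \<noteq> {}"
  obtains u where "u \<in> p" "len u = strict_sup I (\<lambda>i. len (w i))" "seq_union I w u"
proof -
  obtain u where u: "is_seq u" "len u = strict_sup I (\<lambda>i. len (w i))" "seq_union I w u"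
    by (rule seq_union_exists[of I w z]) (use w bounded(2) chain no_max tree_is_seq that in auto)
  have "u \<in> p"
  proof (rule tree_limit[OF u(1)])
    show "len u < lam"
      unfolding u(2) using strict_sup_le[of I "\<lambda>i. len (w i)" z] bounded le_less_trans by blast
    show "is_limit (len u)"
      using seq_union_is_limit u(3) \<open>I \<noteq> {}\<close> by blast
    fix \<beta> assume "\<beta> < len u"
    then obtain i where i: "i \<in> I" "\<beta> < len (w i)" "w i \<sqsubset> u"
      using u(3) unfolding seq_union_def by blast
    then have "u |` {..<\<beta>} = w i |` {..<\<beta>}"
      using seq_le_value[of "w i" u] unfolding prefix_less_def by (intro restrict_cong) auto
    then show "u |` {..<\<beta>} \<in> p"
      using tree_restrict w[OF i(1)] by simp
  qed
  then show ?thesis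
    using u(2,3) by (rule that)
qed

lemma tree_countable_union:
  assumes T: "\<And>n::nat. T n \<in> p" "\<And>n. T n \<sqsubset> T (Suc n)"
  obtains u where "u \<in> p" "len u = strict_sup UNIV (\<lambda>n. len (T n))" "\<And>n. T n \<sqsubset> u"
proof -
  obtain z where z: "z < lam" "\<And>n. len (T n) < z"
    using countable_bounded[of "\<lambda>n. len (T n)"] tree_len_less[OF T(1)] by blast
  have mono: "T m \<subseteq>\<^sub>m T n" if "m \<le> n" for m n
    using that
  proof (induction n rule: dec_induct)
    case (step n)
    then show ?case
      using map_le_trans[OF _ prefix_lessD(1)[OF T(2)]] by blast
  qed simp
  obtain u where "u \<in> p" "len u = strict_sup UNIV (\<lambda>n. len (T n))" "seq_union UNIV T u"
  proof (rule tree_union[of UNIV T z])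
    show "T m \<subseteq>\<^sub>m T n \<or> T n \<subseteq>\<^sub>m T m" for m n
      using mono[of m n] mono[of n m] linear[of m n] by blast
  qed (use T z that in auto)
  then show ?thesis
    using that unfolding seq_union_def by blast
qed

lemma tree_increasing_union:
  assumes \<delta>: "\<delta> < lam" "is_limit \<delta>" and w: "\<And>\<alpha>. \<alpha> < \<delta> \<Longrightarrow> w \<alpha> \<in> p"
    and increasing: "\<And>\<alpha> \<beta>. \<alpha> < \<beta> \<Longrightarrow> \<beta> < \<delta> \<Longrightarrow> w \<alpha> \<sqsubset> w \<beta>"
  obtains u where "u \<in> p" "seq_union {..<\<delta>} w u"
proof -
  have "(\<lambda>\<alpha>. len (w \<alpha>)) ` {..<\<delta>} \<subseteq> {..<lam}"
    using w tree_len_less by blast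
  then obtain z where z: "z < lam" "\<forall>\<alpha><\<delta>. len (w \<alpha>) < z"
    using less_cf_bounded[of \<delta> lam] \<delta>(1) cf_lam by metis
  show ?thesis
  proof (rule tree_union[of "{..<\<delta>}" w z])
    show "w \<alpha> \<subseteq>\<^sub>m w \<beta> \<or> w \<beta> \<subseteq>\<^sub>m w \<alpha>" if "\<alpha> \<in> {..<\<delta>}" "\<beta> \<in> {..<\<delta>}" for \<alpha> \<beta>
      by (cases \<alpha> \<beta> rule: linorder_cases) (use that increasing prefix_lessD(1) in auto)
    show "\<exists>\<beta>\<in>{..<\<delta>}. w \<alpha> \<sqsubset> w \<beta>" if "\<alpha> \<in> {..<\<delta>}" for \<alpha>
      using is_limitD[OF \<delta>(2), of \<alpha>] that increasing by auto
    show "{..<\<delta>} \<noteq> {}"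
      using \<delta>(2) unfolding is_limit_def by blast
  qed (use w z that in auto)
qed

lemma splitting_closed_iff:
  "splitting_closed lam spl p \<longleftrightarrow>
     (\<forall>\<delta> w. \<forall>u\<in>p. \<delta> < lam \<and> is_limit \<delta> \<and> (\<forall>\<alpha><\<delta>. w \<alpha> \<in> p \<and> spl \<alpha> (w \<alpha>)) \<and>
        (\<forall>\<alpha> \<beta>. \<alpha> < \<beta> \<and> \<beta> < \<delta> \<longrightarrow> w \<alpha> \<sqsubset> w \<beta>) \<and> seq_union {..<\<delta>} w u \<longrightarrow> spl \<delta> u)"
  (is "_ \<longleftrightarrow> (\<forall>\<delta> w. \<forall>u\<in>p. ?increasing \<delta> w u \<longrightarrow> spl \<delta> u)")
proof (intro iffI allI ballI impI)
  fix \<delta> w u assume scl: "splitting_closed lam spl p" and u: "u \<in> p" and w: "?increasing \<delta> w u"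
  then have "\<exists>u'\<in>p. Map.graph u' = (\<Union>\<alpha>\<in>{..<\<delta>}. Map.graph (w \<alpha>)) \<and> spl \<delta> u'"
    unfolding prefix_less_def
    by (intro scl[unfolded splitting_closed_def, THEN spec, THEN spec, THEN mp]) simp
  moreover have "Map.graph u = (\<Union>\<alpha>\<in>{..<\<delta>}. Map.graph (w \<alpha>))"
    using seq_union_graph tree_is_seq[OF u] w by blast
  ultimately show "spl \<delta> u"
    using graph_inject by metis
next
  assume union: "\<forall>\<delta> w. \<forall>u\<in>p. ?increasing \<delta> w u \<longrightarrow> spl \<delta> u"
  have "\<exists>u\<in>p. Map.graph u = (\<Union>\<alpha>\<in>{..<\<delta>}. Map.graph (w \<alpha>)) \<and> spl \<delta> u"
    if \<delta>: "\<delta> < lam" "is_limit \<delta>" and w: "\<forall>\<alpha><\<delta>. w \<alpha> \<in> p \<and> spl \<alpha> (w \<alpha>)"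
      and inc: "\<forall>\<alpha> \<beta>. \<alpha> < \<beta> \<and> \<beta> < \<delta> \<longrightarrow> w \<alpha> \<subseteq>\<^sub>m w \<beta> \<and> w \<alpha> \<noteq> w \<beta>" for \<delta> w
  proof -
    have increasing: "w \<alpha> \<sqsubset> w \<beta>" if "\<alpha> < \<beta>" "\<beta> < \<delta>" for \<alpha> \<beta>
      unfolding prefix_less_def using that inc w tree_is_seq by (meson less_trans)
    obtain u where u: "u \<in> p" "seq_union {..<\<delta>} w u"
      by (rule tree_increasing_union[OF \<delta>, of w]) (use w increasing in auto)
    then have "spl \<delta> u"
      by (intro union[THEN spec, THEN spec[of _ w], THEN bspec, THEN mp])
        (use \<delta> w increasing in simp_all)
    then show ?thesis
      using u seq_union_graph tree_is_seq by blast
  qed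
  then show "splitting_closed lam spl p"
    unfolding splitting_closed_def by blast
qed

end

subsection \<open>Subtrees\<close>

lemma OSucc_nodes:
  assumes "t \<in> nodes lam k" shows "OSucc (nodes lam k) t = {..<k (len t)}"
proof -
  have t: "is_seq t" "len t < lam" "\<And>\<beta>. \<beta> < len t \<Longrightarrow> the (t \<beta>) < k \<beta>"
    using assms nodes_iff by blast+
  have "t \<frown> b \<in> nodes lam k \<longleftrightarrow> b < k (len t)" for b
    unfolding nodes_iff len_snoc[OF t(1,2)] less_next_ord_iff[OF t(2)]
    using is_seq_snoc[OF t(1,2)] next_ord_lam[OF t(2)] t(3) by (auto simp: le_less)
  then show ?thesis
    unfolding OSucc_def by auto
qed

lemma closed_tree_nodes: "closed_tree (nodes lam k)"
proof (rule closed_treeI)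
  have "dom (Map.empty :: 'o node) = {..<zero_ord}"
    by auto
  then have "Map.empty \<in> nodes lam k"
    unfolding nodes_iff using is_seqI len_eq zero_ord_lam by (metis not_less_zero_ord)
  then show "nodes lam k \<noteq> {}"
    by blast
next
  fix s t assume t: "t \<in> nodes lam k" and s: "is_seq s" "s \<subseteq>\<^sub>m t"
  then show "s \<in> nodes lam k"
    using seq_le_len[OF s(1)] seq_le_value[OF s(2,1)] unfolding nodes_iff
    by (metis le_less_trans less_le_trans)
next
  fix t assume t: "t \<in> nodes lam k"
  then show "OSucc (nodes lam k) t \<noteq> {}"
    unfolding OSucc_nodes[OF t] using infinite_imp_nonempty[OF k_infinite] nodes_iff by blast
next
  fix f assume f: "is_seq f" "len f < lam" "is_limit (len f)"
    "\<And>\<beta>. \<beta> < len f \<Longrightarrow> f |` {..<\<beta>} \<in> nodes lam k"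
  have "the (f \<beta>) < k \<beta>" if \<beta>: "\<beta> < len f" for \<beta>
  proof -
    obtain \<gamma> where \<gamma>: "\<beta> < \<gamma>" "\<gamma> < len f"
      using is_limitD[OF f(3) \<beta>] by blast
    then have "the ((f |` {..<\<gamma>}) \<beta>) < k \<beta>"
      using f(4)[OF \<gamma>(2)] len_restrict[OF f(1), of \<gamma>] unfolding nodes_iff by simp
    then show ?thesis
      using \<gamma>(1) by simp
  qed
  then show "f \<in> nodes lam k"
    unfolding nodes_iff using f(1,2) by blast
qed simp

context
  fixes p :: "'o node set"
  assumes p: "closed_tree p"
begin

lemma OSucc_subtree:
  assumes t: "t \<in> subtree p Y" shows "OSucc (subtree p Y) t = OSucc p t \<inter> Y t"
proof -
  have tp: "t \<in> p"
    using t subtree_subset by blast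
  have "(t \<frown> b) |` {..<\<beta>} = t |` {..<\<beta>}" if "\<beta> < len t" for b \<beta>
    by (rule restrict_cong) (use that in auto)
  then have "(\<forall>\<beta><len (t \<frown> b). the ((t \<frown> b) \<beta>) \<in> Y ((t \<frown> b) |` {..<\<beta>})) \<longleftrightarrow> b \<in> Y t" for b
    unfolding tree_snoc(2)[OF p tp] less_next_ord_iff[OF tree_len_less[OF p tp]]
    using t snoc_restrict[OF tree_is_seq[OF p tp]] unfolding subtree_def by (auto simp: le_less)
  then have "t \<frown> b \<in> subtree p Y \<longleftrightarrow> t \<frown> b \<in> p \<and> b \<in> Y t" for b
    unfolding subtree_def by simp
  then show ?thesis
    unfolding OSucc_def by blast
qed

lemma subtree_limit:
  assumes f: "f \<in> p" "is_limit (len f)" "\<And>\<beta>. \<beta> < len f \<Longrightarrow> f |` {..<\<beta>} \<in> subtree p Y"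
  shows "f \<in> subtree p Y"
proof -
  have "the (f \<beta>) \<in> Y (f |` {..<\<beta>})" if \<beta>: "\<beta> < len f" for \<beta>
  proof -
    obtain \<gamma> where \<gamma>: "\<beta> < \<gamma>" "\<gamma> < len f"
      using is_limitD[OF f(2) \<beta>] by blast
    have "the ((f |` {..<\<gamma>}) \<beta>) \<in> Y (f |` {..<\<gamma>} |` {..<\<beta>})"
      using f(3)[OF \<gamma>(2)] len_restrict[OF tree_is_seq[OF p f(1)], of \<gamma>] \<gamma>
      unfolding subtree_def by simp
    then show ?thesis
      using \<gamma>(1) restrict_restrict_lessThan[of \<beta> \<gamma> f] by simp
  qed
  then show ?thesis
    unfolding subtree_def using f(1) by blast
qed

lemma closed_tree_subtree:
  assumes Y: "\<And>t. t \<in> subtree p Y \<Longrightarrow> OSucc p t \<inter> Y t \<noteq> {}"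
  shows "closed_tree (subtree p Y)"
proof (rule closed_treeI)
  have "len (Map.empty :: 'o node) = zero_ord"
    by (rule len_eq) auto
  then show "subtree p Y \<noteq> {}"
    unfolding subtree_def using empty_in_tree[OF p] by force
  show "subtree p Y \<subseteq> nodes lam k"
    using p unfolding subtree_def closed_tree_def is_tree_def by blast
next
  fix s t assume t: "t \<in> subtree p Y" and s: "is_seq s" "s \<subseteq>\<^sub>m t"
  then have tp: "t \<in> p"
    using subtree_subset by blast
  have le: "len s \<le> len t" "t |` {..<len s} = s"
    using seq_le_iff s tree_is_seq[OF p tp] by blast+
  have "the (s \<beta>) \<in> Y (s |` {..<\<beta>})" if "\<beta> < len s" for \<beta>
  proof -
    have "s |` {..<\<beta>} = t |` {..<\<beta>}"
      using seq_le_value[OF s(2,1)] that by (intro restrict_cong) simp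
    moreover have "\<beta> < len t"
      using that le(1) by (rule less_le_trans)
    then have "the (t \<beta>) \<in> Y (t |` {..<\<beta>})"
      using t unfolding subtree_def by blast
    ultimately show ?thesis
      using seq_le_value[OF s(2,1) that] by simp
  qed
  then show "s \<in> subtree p Y"
    unfolding subtree_def using tree_le[OF p tp s] by blast
next
  show "OSucc (subtree p Y) t \<noteq> {}" if "t \<in> subtree p Y" for t
    unfolding OSucc_subtree[OF that] by (rule Y[OF that])
next
  fix f assume "is_seq f" "len f < lam" "is_limit (len f)"
    "\<And>\<beta>. \<beta> < len f \<Longrightarrow> f |` {..<\<beta>} \<in> subtree p Y"
  then show "f \<in> subtree p Y"
    using subtree_limit tree_limit[OF p] subtree_subset by blast
qed

lemma cone_eq_subtree:
  assumes t: "t \<in> p"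
  shows "cone p t = subtree p (\<lambda>s. if s \<sqsubset> t then {the (t (len s))} else UNIV)"
    (is "_ = subtree p ?Y")
proof -
  have "u \<subseteq>\<^sub>m t \<or> t \<subseteq>\<^sub>m u \<longleftrightarrow> (\<forall>\<beta><len u. the (u \<beta>) \<in> ?Y (u |` {..<\<beta>}))" if u: "u \<in> p" for u
  proof
    assume comparable: "u \<subseteq>\<^sub>m t \<or> t \<subseteq>\<^sub>m u"
    show "\<forall>\<beta><len u. the (u \<beta>) \<in> ?Y (u |` {..<\<beta>})"
    proof (intro allI impI)
      fix \<beta> assume \<beta>: "\<beta> < len u"
      have len: "len (u |` {..<\<beta>}) = \<beta>"
        using len_restrict[OF tree_is_seq[OF p u]] \<beta> by simp
      have "u \<beta> = t \<beta>" if "u |` {..<\<beta>} \<sqsubset> t"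
        using comparable seq_le_value tree_is_seq[OF p] t u \<beta> prefix_lessD(2)[OF that] len by metis
      then show "the (u \<beta>) \<in> ?Y (u |` {..<\<beta>})"
        by (simp add: len)
    qed
  next
    assume follows: "\<forall>\<beta><len u. the (u \<beta>) \<in> ?Y (u |` {..<\<beta>})"
    show "u \<subseteq>\<^sub>m t \<or> t \<subseteq>\<^sub>m u"
    proof (rule ccontr)
      assume "\<not> (u \<subseteq>\<^sub>m t \<or> t \<subseteq>\<^sub>m u)"
      then obtain x where x: "x < len u" "x < len t" "u |` {..<x} = t |` {..<x}" "u x \<noteq> t x"
        using seq_first_difference[of u t] tree_is_seq[OF p] t u by blast
      have "u |` {..<x} \<sqsubset> t"
        unfolding x(3) using prefix_less_restrict tree_is_seq[OF p t] x(2) by blast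
      then have "the (u x) = the (t x)"
        using follows x(1) len_restrict[OF tree_is_seq[OF p u]] by auto
      then show False
        using x seq_value tree_is_seq[OF p] t u by metis
    qed
  qed
  then show ?thesis
    unfolding cone_def subtree_def by blast
qed

lemma OSucc_cone_eq:
  assumes t: "t \<in> p" and u: "u \<in> cone p t"
  shows "OSucc (cone p t) u = (if u \<sqsubset> t then {the (t (len u))} else OSucc p u)"
  using OSucc_subtree[of u] u value_in_OSucc[OF p t, of u] unfolding cone_eq_subtree[OF t] by auto

lemma closed_tree_cone:
  assumes t: "t \<in> p" shows "closed_tree (cone p t)"
  unfolding cone_eq_subtree[OF t]
proof (rule closed_tree_subtree)
  show "OSucc p u \<inter> (if u \<sqsubset> t then {the (t (len u))} else UNIV) \<noteq> {}"
    if "u \<in> subtree p (\<lambda>s. if s \<sqsubset> t then {the (t (len s))} else UNIV)" for u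
    using that value_in_OSucc[OF p t, of u] OSucc_nonempty[OF p, of u] subtree_subset by auto
qed

lemma OSucc_cone: "t \<in> p \<Longrightarrow> u \<in> p \<Longrightarrow> t \<subseteq>\<^sub>m u \<Longrightarrow> OSucc (cone p t) u = OSucc p u"
  using OSucc_cone_eq[of t u] prefix_less_not_map_le unfolding cone_def by auto

lemma Split_cone:
  assumes t: "t \<in> p" and s: "s \<in> Split (cone p t)" shows "t \<subseteq>\<^sub>m s"
proof -
  have s': "s \<in> cone p t"
    using s Split_subset by blast
  then have "\<not> s \<sqsubset> t"
    using s OSucc_cone_eq[OF t s'] unfolding Split_def by auto
  then show ?thesis
    using s' t tree_is_seq[OF p] unfolding cone_def prefix_less_def by auto
qed

end

lemma splitting_mono:
  assumes "splitting k p \<alpha> s" "\<beta> \<le> \<alpha>" "\<alpha> < lam" shows "splitting k p \<beta> s"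
proof -
  have "{..<k \<beta>} \<subseteq> {..<k \<alpha>}"
    using k_mono[OF assms(2,3)] by simp
  then show ?thesis
    using assms(1) card_of_mono1 ordLeq_transitive unfolding splitting_def by blast
qed

lemma infinite_OSucc_of_splitting:
  "splitting k p \<alpha> s \<Longrightarrow> \<alpha> < lam \<Longrightarrow> infinite (OSucc p s)"
  unfolding splitting_iff using card_of_ordLeq_infinite k_infinite by blast

lemma Split_of_splitting:
  assumes "s \<in> p" "splitting k p \<alpha> s" "\<alpha> < lam" shows "s \<in> Split p"
proof -
  have "infinite (OSucc p s)"
    using infinite_OSucc_of_splitting assms(2,3) .
  then obtain a where "a \<in> OSucc p s"
    by fastforce
  moreover from this obtain b where "b \<in> OSucc p s" "b \<noteq> a"
    using \<open>infinite (OSucc p s)\<close> finite_subset[of _ "{a}"] by blast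
  ultimately show ?thesis
    using assms(1) unfolding Split_def by blast
qed

end

section \<open>New subsets from colourings and from descending ranks\<close>

locale tree_forcing = cardinal_tower lam k
  for lam :: "'o::wellorder" and k :: "'o \<Rightarrow> 'o" +
  fixes P :: "'o node set set"
  assumes closed: "p \<in> P \<Longrightarrow> closed_tree p"
    and cone_mem: "p \<in> P \<Longrightarrow> t \<in> p \<Longrightarrow> cone p t \<in> P"
begin

sublocale forcing P "(\<subseteq>)"
  by unfold_locales auto

definition passes_through :: "'o node set \<Rightarrow> 'o node \<Rightarrow> bool" where
  "passes_through r t \<longleftrightarrow> (\<forall>v\<in>r. v \<subseteq>\<^sub>m t \<or> t \<subseteq>\<^sub>m v)"

lemma passes_through_subset: "r \<subseteq> q \<Longrightarrow> passes_through q t \<Longrightarrow> passes_through r t"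
  unfolding passes_through_def by blast

lemma passes_through_cone: "passes_through (cone p t) t"
  unfolding passes_through_def cone_def by blast

lemma passes_through_mem:
  assumes r: "r \<in> P" and t: "passes_through r t" "is_seq t" "len t < lam" shows "t \<in> r"
proof -
  obtain u where u: "u \<in> r" "len u = len t"
    using tree_has_len[OF closed[OF r] t(3)] by blast
  then have "u = t"
    using seq_comparable_same_len t tree_is_seq[OF closed[OF r]] unfolding passes_through_def
    by blast
  with u(1) show ?thesis by simp
qed

theorem adds_new_function_of_level_colouring:
  assumes colour: "\<And>q. q \<in> P \<Longrightarrow>
    \<exists>\<gamma><lam. \<exists>t\<in>q. \<exists>u\<in>q. len t = \<rho> \<gamma> \<and> len u = \<rho> \<gamma> \<and> c \<gamma> t \<and> \<not> c \<gamma> u"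
  shows "adds_new_function P (\<subseteq>) {..<lam} {0, 1 :: nat}"
proof -
  define D where "D \<gamma> = {r \<in> P. \<exists>t. is_seq t \<and> len t < lam \<and> len t = \<rho> \<gamma> \<and> c \<gamma> t \<and>
    passes_through r t}" for \<gamma>
  have "\<exists>\<gamma>\<in>{..<lam}. undecided (D \<gamma>) q" if q: "q \<in> P" for q
  proof -
    obtain \<gamma> t u where \<gamma>: "\<gamma> < lam" and t: "t \<in> q" "len t = \<rho> \<gamma>" "c \<gamma> t"
      and u: "u \<in> q" "len u = \<rho> \<gamma>" "\<not> c \<gamma> u"
      using colour[OF q] by blast
    note t_node = tree_node[OF closed[OF q] t(1)] and u_node = tree_node[OF closed[OF q] u(1)]
    have "cone q t \<in> D \<gamma>"
      unfolding D_def using cone_mem[OF q t(1)] t(2,3) t_node passes_through_cone by blast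
    moreover have "r \<notin> D \<gamma>" if r: "r \<in> P" "r \<subseteq> cone q u" for r
    proof
      assume "r \<in> D \<gamma>"
      then obtain t' where t': "is_seq t'" "len t' < lam" "len t' = \<rho> \<gamma>" "c \<gamma> t'"
        "passes_through r t'"
        unfolding D_def by blast
      have "t' \<in> r"
        using passes_through_mem r(1) t' by blast
      then have "t' \<subseteq>\<^sub>m u \<or> u \<subseteq>\<^sub>m t'"
        using passes_through_cone[of q u] r(2) unfolding passes_through_def by blast
      then have "t' = u"
        using seq_comparable_same_len t' u(2) u_node by metis
      then show False
        using t'(4) u(3) by blast
    qed
    then have "cone q u \<in> negation (D \<gamma>)"
      unfolding negation_def using cone_mem[OF q u(1)] by blast
    ultimately show ?thesis
      unfolding undecided_def using \<gamma> cone_subset by blast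
  qed
  moreover have "open_in (D \<gamma>)" for \<gamma>
    unfolding open_in_def D_def using passes_through_subset by blast
  ultimately show ?thesis
    using adds_new_functionI[of "{..<lam}" D] by blast
qed

end

text \<open>The generic filter selects \<open>a n \<in> \<A> n\<close> for every \<open>n\<close>; the new subset of
  \<open>nat \<times> lam\<close> consists of the \<open>(n, \<beta>)\<close> such that the generic branch splits in \<open>a n\<close> at level \<open>\<beta>\<close>.\<close>

locale antichain_matrix = tree_forcing +
  fixes R :: "'a node set \<Rightarrow> 'a node set \<Rightarrow> bool" and \<A> :: "nat \<Rightarrow> 'a node set set"
  assumes \<A>_subset: "\<A> n \<subseteq> P" and \<A>_antichain: "antichain (\<A> n)" and \<A>_predense: "predense (\<A> n)"
    and \<A>_refines: "x \<in> \<A> (Suc n) \<Longrightarrow> \<exists>a\<in>\<A> n. x \<subseteq> a \<and> R a x"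
    and R_descent: "\<And>a s t. (\<And>n. a n \<in> P) \<Longrightarrow> (\<And>n::nat. R (a n) (a (Suc n))) \<Longrightarrow>
      (\<And>n. s \<in> Split (a n)) \<Longrightarrow> (\<And>n. t \<in> a n) \<Longrightarrow> s \<sqsubset> t \<Longrightarrow> False"
begin

definition splits_at :: "nat \<Rightarrow> 'a \<Rightarrow> 'a node set set" where
  "splits_at n \<beta> = {r \<in> P. \<exists>a\<in>\<A> n. r \<subseteq> a \<and> (\<exists>s\<in>Split a. len s = \<beta> \<and> passes_through r s)}"

definition splitting_levels :: "'a node set \<Rightarrow> nat \<Rightarrow> 'a set" where
  "splitting_levels q n = {\<beta>. \<beta> < lam \<and> (\<exists>r\<in>splits_at n \<beta>. r \<subseteq> q)}"

lemma splits_atI: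
  "r \<in> P \<Longrightarrow> a \<in> \<A> n \<Longrightarrow> r \<subseteq> a \<Longrightarrow> s \<in> Split a \<Longrightarrow> passes_through r s \<Longrightarrow> r \<in> splits_at n (len s)"
  unfolding splits_at_def by blast

lemma open_in_splits_at: "open_in (splits_at n \<beta>)"
  unfolding open_in_def
proof (intro conjI ballI impI)
  show "splits_at n \<beta> \<subseteq> P"
    unfolding splits_at_def by blast
  fix u r assume u: "u \<in> splits_at n \<beta>" "r \<in> P" "r \<subseteq> u"
  then obtain a s where "a \<in> \<A> n" "u \<subseteq> a" "s \<in> Split a" "len s = \<beta>" "passes_through u s"
    unfolding splits_at_def by blast
  then show "r \<in> splits_at n \<beta>"
    using splits_atI[of r a n s] passes_through_subset[of r u s] u(2,3) by blast
qed

lemma Split_in_splitting_levels: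
  assumes q: "r \<in> P" "r \<subseteq> q"
  shows "\<exists>r'\<in>P. r' \<subseteq> r \<and> (\<forall>s\<in>Split r'. len s \<in> splitting_levels q n)"
proof -
  obtain a r' where a: "a \<in> \<A> n" "r' \<in> P" "r' \<subseteq> r" "r' \<subseteq> a"
    using \<A>_predense q(1) unfolding predense_def compatible_def by blast
  have "len s \<in> splitting_levels q n" if s: "s \<in> Split r'" for s
  proof -
    have "s \<in> r'" "s \<in> Split a"
      using s Split_subset Split_mono[OF a(4)] by blast+
    then have "cone r' s \<in> splits_at n (len s)"
      using splits_atI[OF cone_mem[OF a(2)] a(1)] a(4) cone_subset[of r' s] passes_through_cone
      by blast
    moreover have "cone r' s \<subseteq> q"
      using cone_subset a(3) q(2) by blast
    ultimately show ?thesis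
      unfolding splitting_levels_def using tree_len_less[OF closed[OF a(2)] \<open>s \<in> r'\<close>] by blast
  qed
  with a(2,3) show ?thesis by blast
qed

lemma splits_at_member:
  assumes r: "r \<in> splits_at n \<beta>" and t: "t \<in> r" "is_seq t" "\<beta> < len t"
  shows "\<exists>a\<in>\<A> n. r \<subseteq> a \<and> t |` {..<\<beta>} \<in> Split a"
proof -
  obtain a s where a: "a \<in> \<A> n" "r \<subseteq> a" and s: "s \<in> Split a" "len s = \<beta>" "passes_through r s"
    using r unfolding splits_at_def by blast
  have "is_seq s"
    using s(1) Split_subset a(1) \<A>_subset closed tree_is_seq by (meson subsetD)
  moreover have "s \<subseteq>\<^sub>m t \<or> t \<subseteq>\<^sub>m s"
    using s(3) t(1) unfolding passes_through_def by blast
  ultimately have "s = t |` {..<\<beta>}"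
    using seq_le_iff[of s t] seq_le_len[of t s] s(2) t(2,3) by auto
  with a s(1) show ?thesis
    by blast
qed

lemma no_thread_of_splits_at:
  assumes q: "q \<in> P" and t: "t \<in> q" "\<beta> < len t"
    and r: "\<And>n. r n \<in> splits_at n \<beta>" "\<And>n. r (Suc n) \<subseteq> r n" "\<And>n. r n \<subseteq> cone q t"
  shows False
proof -
  note t_node = tree_node[OF closed[OF q] t(1)]
  have rP: "r n \<in> P" for n
    using r(1) unfolding splits_at_def by blast
  have t_mem: "t \<in> r n" for n
    using passes_through_mem[OF rP passes_through_subset[OF r(3) passes_through_cone] t_node(1,2)] .
  have "\<exists>a\<in>\<A> n. r n \<subseteq> a \<and> t |` {..<\<beta>} \<in> Split a" for n
    using splits_at_member[OF r(1) t_mem t_node(1) t(2)] .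
  then obtain a where a: "\<And>n. a n \<in> \<A> n" "\<And>n. r n \<subseteq> a n" "\<And>n. t |` {..<\<beta>} \<in> Split (a n)"
    by metis
  have aP: "a n \<in> P" for n
    using a(1) \<A>_subset by blast
  have "R (a n) (a (Suc n))" for n
  proof -
    obtain b where b: "b \<in> \<A> n" "a (Suc n) \<subseteq> b" "R b (a (Suc n))"
      using \<A>_refines[OF a(1)] by blast
    have "r (Suc n) \<subseteq> b" "r (Suc n) \<subseteq> a n"
      using a(2)[of "Suc n"] b(2) r(2)[of n] a(2)[of n] by simp_all
    then have "compatible b (a n)"
      unfolding compatible_def using rP by blast
    then have "b = a n"
      using \<A>_antichain b(1) a(1) unfolding antichain_def by blast
    with b(3) show ?thesis by simp
  qed
  moreover have "t |` {..<\<beta>} \<sqsubset> t"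
    using prefix_less_restrict t_node(1) t(2) by blast
  ultimately show False
    using R_descent[of a] aP a t_mem by blast
qed

lemma splitting_levels_Inter_empty:
  assumes q: "q \<in> P" and decided: "\<And>n \<beta>. \<beta> < lam \<Longrightarrow> \<not> undecided (splits_at n \<beta>) q" and \<beta>: "\<beta> < lam"
  shows "\<exists>n. \<beta> \<notin> splitting_levels q n"
proof (rule ccontr)
  assume "\<not> (\<exists>n. \<beta> \<notin> splitting_levels q n)"
  then have dense: "dense_below (splits_at n \<beta>) q" for n
    using dense_below_of_decided decided[OF \<beta>] unfolding splitting_levels_def by blast
  obtain t where t: "t \<in> q" "len t = next_ord \<beta>"
    using tree_has_len[OF closed[OF q] next_ord_lam[OF \<beta>]] by blast
  have below: "\<exists>r'\<in>splits_at n \<beta>. r' \<subseteq> r" if "r \<in> P" "r \<subseteq> cone q t" for r n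
    using dense that cone_subset unfolding dense_below_def by (meson subset_trans)
  have "\<exists>r. \<forall>n. (r n \<in> splits_at n \<beta> \<and> r n \<subseteq> cone q t) \<and> r (Suc n) \<subseteq> r n"
  proof (rule dependent_nat_choice)
    show "\<exists>r. r \<in> splits_at 0 \<beta> \<and> r \<subseteq> cone q t"
      using below[OF cone_mem[OF q t(1)]] by blast
    fix r n assume r: "r \<in> splits_at n \<beta> \<and> r \<subseteq> cone q t"
    then have "r \<in> P"
      unfolding splits_at_def by blast
    with r below[of r "Suc n"] show "\<exists>r'. (r' \<in> splits_at (Suc n) \<beta> \<and> r' \<subseteq> cone q t) \<and> r' \<subseteq> r"
      by blast
  qed
  then obtain r where "\<And>n. r n \<in> splits_at n \<beta>" "\<And>n. r (Suc n) \<subseteq> r n" "\<And>n. r n \<subseteq> cone q t"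
    by blast
  then show False
    using no_thread_of_splits_at[OF q t(1), of \<beta> r] t(2) less_next_ord[OF \<beta>] by simp
qed

end

lemma (in tree_forcing) adds_new_functionI_nat_times_lam:
  assumes "\<And>(n::nat) \<beta>. open_in (D n \<beta>)"
    and undecided: "\<And>q. q \<in> P \<Longrightarrow> \<exists>n. \<exists>\<beta><lam. undecided (D n \<beta>) q"
  shows "adds_new_function P (\<subseteq>) {..<lam} {0, 1 :: nat}"
proof -
  have "|(UNIV :: nat set) \<times> {..<lam}| =o |{..<lam}|"
    using card_of_Times_infinite[OF infinite_lam, of "UNIV :: nat set"] infinite_lam
    by (simp add: infinite_iff_card_of_nat)
  then obtain \<phi> where \<phi>: "bij_betw \<phi> {..<lam} ((UNIV :: nat set) \<times> {..<lam})"
    using card_of_ordIso ordIso_symmetric by blast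
  have "\<exists>x\<in>{..<lam}. undecided (case \<phi> x of (n, \<beta>) \<Rightarrow> D n \<beta>) q" if q: "q \<in> P" for q
  proof -
    obtain n \<beta> where n: "\<beta> < lam" "undecided (D n \<beta>) q"
      using undecided[OF q] by blast
    then have "(n, \<beta>) \<in> \<phi> ` {..<lam}"
      using bij_betw_imp_surj_on[OF \<phi>] by simp
    then obtain x where "x \<in> {..<lam}" "\<phi> x = (n, \<beta>)"
      by auto
    with n(2) show ?thesis
      by (intro bexI[of _ x]) simp_all
  qed
  then show ?thesis
    using assms(1) adds_new_functionI[of "{..<lam}" "\<lambda>x. case \<phi> x of (n, \<beta>) \<Rightarrow> D n \<beta>"]
    by (simp add: split_beta)
qed

theorem (in tree_forcing) adds_new_function_of_descent:
  assumes dense: "\<And>p r. p \<in> P \<Longrightarrow> r \<in> P \<Longrightarrow> r \<subseteq> p \<Longrightarrow> \<exists>r'\<in>P. r' \<subseteq> r \<and> R p r'"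
    and descent: "\<And>a s t. (\<And>n. a n \<in> P) \<Longrightarrow> (\<And>n::nat. R (a n) (a (Suc n))) \<Longrightarrow>
      (\<And>n. s \<in> Split (a n)) \<Longrightarrow> (\<And>n. t \<in> a n) \<Longrightarrow> s \<sqsubset> t \<Longrightarrow> False"
    and levels: "\<And>q A. q \<in> P \<Longrightarrow> (\<And>\<beta>. \<beta> < lam \<Longrightarrow> \<exists>n::nat. \<beta> \<notin> A n) \<Longrightarrow>
      (\<And>n r. r \<in> P \<Longrightarrow> r \<subseteq> q \<Longrightarrow> \<exists>r'\<in>P. r' \<subseteq> r \<and> (\<forall>s\<in>Split r'. len s \<in> A n)) \<Longrightarrow> False"
  shows "adds_new_function P (\<subseteq>) {..<lam} {0, 1 :: nat}"
proof -
  obtain \<A> where \<A>: "\<And>n. \<A> n \<subseteq> P" "\<And>n. antichain (\<A> n)" "\<And>n. predense (\<A> n)"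
    "\<And>n x. x \<in> \<A> (Suc n) \<Longrightarrow> \<exists>a\<in>\<A> n. x \<subseteq> a \<and> R a x"
    using refining_antichains[of R, OF dense] by blast
  interpret antichain_matrix lam k P R \<A>
    by unfold_locales (fact \<A> descent)+
  have undecided: "\<exists>n. \<exists>\<beta><lam. undecided (splits_at n \<beta>) q" if q: "q \<in> P" for q
  proof (rule ccontr)
    assume decided: "\<not> (\<exists>n. \<exists>\<beta><lam. undecided (splits_at n \<beta>) q)"
    show False
    proof (rule levels[OF q])
      show "\<exists>n. \<beta> \<notin> splitting_levels q n" if "\<beta> < lam" for \<beta>
        using splitting_levels_Inter_empty[OF q _ that] decided by blast
    qed (rule Split_in_splitting_levels)
  qed
  show ?thesis
    using adds_new_functionI_nat_times_lam[OF open_in_splits_at undecided] .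
qed

section \<open>Pruning towards a dense set of nodes\<close>

locale guided_tree = cardinal_tower lam k
  for lam :: "'o::wellorder" and k :: "'o \<Rightarrow> 'o" +
  fixes p Q :: "'o node set"
  assumes closed: "closed_tree p" and Q_subset: "Q \<subseteq> p"
    and Q_dense: "\<And>t. t \<in> p \<Longrightarrow> \<exists>s\<in>Q. t \<subseteq>\<^sub>m s"
begin

definition node_order :: "('o node \<times> 'o node) set" where
  "node_order = (SOME W. well_order_on UNIV W)"

definition target :: "'o node \<Rightarrow> 'o node" where
  "target t = wo_rel.minim node_order {s \<in> Q. t \<subseteq>\<^sub>m s}"

definition toward :: "'o node \<Rightarrow> 'o" where
  "toward t = the (target t (len t))"

definition next_Q :: "'o node \<Rightarrow> 'o node" where
  "next_Q t = target t |` {..<(LEAST \<gamma>. len t \<le> \<gamma> \<and> target t |` {..<\<gamma>} \<in> Q)}"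

definition prune :: "('o node \<Rightarrow> 'o set) \<Rightarrow> 'o node set" where
  "prune Y = subtree p (\<lambda>s. if s \<in> Q then Y s else {toward s})"

lemmas node_seq = tree_is_seq[OF closed]

lemma Q_seq: "s \<in> Q \<Longrightarrow> is_seq s"
  using Q_subset node_seq by blast

lemma
  shows wo_rel_node_order: "wo_rel node_order" and Field_node_order: "Field node_order = UNIV"
proof -
  have "well_order_on UNIV node_order"
    unfolding node_order_def using well_order_on by (rule someI_ex)
  then show "Field node_order = UNIV" "wo_rel node_order"
    using well_order_on_Field unfolding wo_rel_def by metis+
qed

lemma
  assumes "t \<in> p" shows target_in_Q: "target t \<in> Q" and map_le_target: "t \<subseteq>\<^sub>m target t"
  using wo_rel.minim_in[OF wo_rel_node_order, of "{s \<in> Q. t \<subseteq>\<^sub>m s}"] Q_dense[OF assms]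
  unfolding target_def Field_node_order by blast+

text \<open>Minimality makes the targets coherent, so that moving towards the current target reaches it.\<close>

lemma target_coherent:
  assumes t: "t \<in> p" "t \<subseteq>\<^sub>m u" "u \<subseteq>\<^sub>m target t" shows "target u = target t"
proof -
  have "(target t, s) \<in> node_order" if "s \<in> {s \<in> Q. u \<subseteq>\<^sub>m s}" for s
    unfolding target_def
    using that t(2) map_le_trans by (intro wo_rel.minim_least[OF wo_rel_node_order])
      (auto simp: Field_node_order)
  then have "target t = target u"
    using t target_in_Q[OF t(1)] unfolding target_def[of u]
    by (intro wo_rel.equals_minim[OF wo_rel_node_order]) (auto simp: Field_node_order)
  then show ?thesis by simp
qed

context
  fixes t
  assumes t: "t \<in> p"
begin

lemma
  shows next_Q_in_Q: "next_Q t \<in> Q" and map_le_next_Q: "t \<subseteq>\<^sub>m next_Q t"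
    and next_Q_map_le_target: "next_Q t \<subseteq>\<^sub>m target t"
    and next_Q_first: "\<And>u. u \<in> Q \<Longrightarrow> t \<subseteq>\<^sub>m u \<Longrightarrow> \<not> u \<sqsubset> next_Q t"
proof -
  note t_seq = node_seq[OF t] and s_seq = Q_seq[OF target_in_Q[OF t]]
  let ?P = "\<lambda>\<gamma>. len t \<le> \<gamma> \<and> target t |` {..<\<gamma>} \<in> Q"
  define \<gamma> where "\<gamma> = (LEAST \<gamma>. ?P \<gamma>)"
  have next_Q: "next_Q t = target t |` {..<\<gamma>}"
    unfolding next_Q_def \<gamma>_def ..
  have "?P (len (target t))"
    using seq_le_len[OF t_seq s_seq map_le_target[OF t]] restrict_all[OF s_seq] target_in_Q[OF t]
    by simp
  then have \<gamma>: "len t \<le> \<gamma>" "target t |` {..<\<gamma>} \<in> Q" "\<gamma> \<le> len (target t)"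
    unfolding \<gamma>_def using LeastI[of ?P] Least_le[of ?P] by blast+
  show "next_Q t \<in> Q"
    unfolding next_Q by (rule \<gamma>(2))
  show le_target: "next_Q t \<subseteq>\<^sub>m target t"
    unfolding next_Q by (rule restrict_lessThan_map_le)
  show "t \<subseteq>\<^sub>m next_Q t"
    using seq_le_of_len_le[OF t_seq Q_seq[OF \<open>next_Q t \<in> Q\<close>] s_seq map_le_target[OF t] le_target]
      \<gamma>(1) len_restrict[OF s_seq \<gamma>(3)] unfolding next_Q by simp
  show "\<not> u \<sqsubset> next_Q t" if u: "u \<in> Q" "t \<subseteq>\<^sub>m u" for u
  proof
    assume less: "u \<sqsubset> next_Q t"
    then have "u \<subseteq>\<^sub>m target t"
      using prefix_lessD(1) le_target map_le_trans by blast
    then have "target t |` {..<len u} = u"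
      using seq_le_iff Q_seq[OF u(1)] s_seq by blast
    then have "?P (len u)"
      using u seq_le_len[OF t_seq Q_seq[OF u(1)] u(2)] by simp
    moreover have "len u < \<gamma>"
      using prefix_lessD(2)[OF less] len_restrict[OF s_seq \<gamma>(3)] unfolding next_Q by simp
    ultimately show False
      using not_less_Least unfolding \<gamma>_def by blast
  qed
qed

lemma toward_next_Q:
  assumes u: "t \<subseteq>\<^sub>m u" "u \<sqsubset> next_Q t"
  shows "u \<notin> Q" "toward u = the (next_Q t (len u))"
proof -
  show "u \<notin> Q"
    using next_Q_first u by blast
  have "u \<subseteq>\<^sub>m target t"
    using prefix_lessD(1)[OF u(2)] next_Q_map_le_target map_le_trans by blast
  then have "target u = target t"
    using target_coherent t u(1) by blast
  then show "toward u = the (next_Q t (len u))"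
    unfolding toward_def
    using seq_le_value[OF next_Q_map_le_target Q_seq[OF next_Q_in_Q] prefix_lessD(2)[OF u(2)]]
    by simp
qed

end

lemma toward_in_OSucc:
  assumes "t \<in> p" "t \<notin> Q" shows "toward t \<in> OSucc p t"
proof -
  have "target t \<in> Q" "t \<subseteq>\<^sub>m target t"
    using target_in_Q map_le_target assms(1) by blast+
  then have "t \<sqsubset> target t"
    unfolding prefix_less_def using assms node_seq Q_seq by auto
  then show ?thesis
    unfolding toward_def using value_in_OSucc[OF closed] target_in_Q[OF assms(1)] Q_subset by blast
qed

lemma prune_subset: "prune Y \<subseteq> p"
  unfolding prune_def by (rule subtree_subset)

context
  fixes Y :: "'o node \<Rightarrow> 'o set"
  assumes Y: "\<And>s. s \<in> Q \<Longrightarrow> Y s \<noteq> {} \<and> Y s \<subseteq> OSucc p s"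
begin

lemma OSucc_prune:
  assumes t: "t \<in> prune Y" shows "OSucc (prune Y) t = (if t \<in> Q then Y t else {toward t})"
proof -
  have "OSucc (prune Y) t = OSucc p t \<inter> (if t \<in> Q then Y t else {toward t})"
    using t unfolding prune_def by (rule OSucc_subtree[OF closed])
  then show ?thesis
    using Y[of t] toward_in_OSucc[of t] t prune_subset by auto
qed

lemma closed_tree_prune: "closed_tree (prune Y)"
  unfolding prune_def
proof (rule closed_tree_subtree[OF closed])
  fix t assume "t \<in> subtree p (\<lambda>s. if s \<in> Q then Y s else {toward s})"
  then have "t \<in> p"
    using subtree_subset by blast
  then show "OSucc p t \<inter> (if t \<in> Q then Y t else {toward t}) \<noteq> {}"
    using Y[of t] toward_in_OSucc[of t] by auto
qed

lemma Split_prune: "s \<in> Split (prune Y) \<Longrightarrow> s \<in> Q \<and> OSucc (prune Y) s = Y s"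
  using OSucc_prune[of s] unfolding Split_def by (auto split: if_splits)

lemma next_Q_in_prune:
  assumes t: "t \<in> prune Y" shows "next_Q t \<in> prune Y"
proof -
  have tp: "t \<in> p"
    using t prune_subset by blast
  note seq = node_seq[OF tp] Q_seq[OF next_Q_in_Q[OF tp]]
  let ?v = "next_Q t"
  have "the (?v x) \<in> (if ?v |` {..<x} \<in> Q then Y (?v |` {..<x}) else {toward (?v |` {..<x})})"
    if x: "x < len ?v" for x
  proof (cases "x < len t")
    case True
    have "?v |` {..<x} = t |` {..<x}" "?v x = t x"
      using seq_le_value[OF map_le_next_Q[OF tp] seq(1)] True by (auto intro!: restrict_cong)
    moreover have "the (t x) \<in> (if t |` {..<x} \<in> Q then Y (t |` {..<x}) else {toward (t |` {..<x})})"
      using t True unfolding prune_def subtree_def by blast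
    ultimately show ?thesis
      by (simp only:)
  next
    case False
    have len: "len (?v |` {..<x}) = x"
      using len_restrict[OF seq(2)] x by simp
    have "t \<subseteq>\<^sub>m ?v |` {..<x}"
      using seq_le_of_len_le[OF seq(1) _ seq(2) map_le_next_Q[OF tp] restrict_lessThan_map_le]
        is_seq_restrict[OF seq(2)] len x False by simp
    then show ?thesis
      using toward_next_Q[OF tp _ prefix_less_restrict[OF seq(2) x]] len by simp
  qed
  then show ?thesis
    unfolding prune_def subtree_def using next_Q_in_Q[OF tp] Q_subset by blast
qed

lemma next_Q_comparable:
  assumes t: "t \<in> prune Y" and u: "u \<in> prune Y" "t \<subseteq>\<^sub>m u"
  shows "u \<subseteq>\<^sub>m next_Q t \<or> next_Q t \<subseteq>\<^sub>m u"
proof (rule ccontr)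
  assume incomparable: "\<not> (u \<subseteq>\<^sub>m next_Q t \<or> next_Q t \<subseteq>\<^sub>m u)"
  have tp: "t \<in> p" "u \<in> p"
    using t u(1) prune_subset by blast+
  note seq = node_seq[OF tp(1)] node_seq[OF tp(2)] Q_seq[OF next_Q_in_Q[OF tp(1)]]
  obtain x where x: "x < len u" "x < len (next_Q t)" "u |` {..<x} = next_Q t |` {..<x}"
    "u x \<noteq> next_Q t x"
    using seq_first_difference[OF seq(2,3)] incomparable by blast
  let ?w = "next_Q t |` {..<x}"
  have w: "is_seq ?w" "len ?w = x" "?w \<sqsubset> next_Q t"
    using is_seq_restrict[OF seq(3)] len_restrict[OF seq(3)] prefix_less_restrict[OF seq(3)] x(2)
    by auto
  have "\<not> x < len t"
    using x(4) seq_le_value[OF u(2) seq(1)] seq_le_value[OF map_le_next_Q[OF tp(1)] seq(1)] by metis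
  then have "t \<subseteq>\<^sub>m ?w"
    using seq_le_of_len_le[OF seq(1) w(1) seq(3) map_le_next_Q[OF tp(1)]] prefix_lessD(1)[OF w(3)]
      w(2) by simp
  then have "?w \<notin> Q" "toward ?w = the (next_Q t x)"
    using toward_next_Q[OF tp(1) _ w(3)] w(2) by auto
  moreover have "the (u x) \<in> (if ?w \<in> Q then Y ?w else {toward ?w})"
    using u(1) x(1,3) unfolding prune_def subtree_def by auto
  ultimately have "the (u x) = the (next_Q t x)"
    by simp
  then show False
    using x seq_value[OF seq(2)] seq_value[OF seq(3)] by metis
qed

lemma branch_meets_Q:
  assumes b: "b \<in> branches (prune Y)" and \<beta>: "\<beta> < lam"
  shows "\<exists>\<gamma><lam. \<beta> \<le> \<gamma> \<and> b |` {..<\<gamma>} \<in> Q"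
proof -
  note prune_branch = branch_restrict[OF closed_tree_prune b]
  define t where "t = b |` {..<\<beta>}"
  define \<gamma> where "\<gamma> = len (next_Q t)"
  have t: "t \<in> prune Y" "t \<in> p" "len t = \<beta>"
    using prune_branch[OF \<beta>] prune_subset unfolding t_def by blast+
  note next_Q = next_Q_in_Q[OF t(2)] map_le_next_Q[OF t(2)]
  have "\<gamma> < lam"
    unfolding \<gamma>_def using tree_len_less[OF closed] next_Q(1) Q_subset by blast
  moreover have "\<beta> \<le> \<gamma>"
    unfolding \<gamma>_def t(3)[symmetric] using seq_le_len node_seq[OF t(2)] Q_seq next_Q by blast
  moreover have "b |` {..<\<gamma>} = next_Q t"
  proof (rule seq_comparable_same_len)
    have "t \<subseteq>\<^sub>m b |` {..<\<gamma>}"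
      using branch_le_restrict[OF closed_tree_prune b \<open>\<gamma> < lam\<close> node_seq[OF t(2)]] t(3) \<open>\<beta> \<le> \<gamma>\<close>
      by (simp add: t_def restrict_lessThan_map_le)
    then show "b |` {..<\<gamma>} \<subseteq>\<^sub>m next_Q t \<or> next_Q t \<subseteq>\<^sub>m b |` {..<\<gamma>}"
      using next_Q_comparable t(1) prune_branch(1)[OF \<open>\<gamma> < lam\<close>] by blast
  qed (use prune_branch[OF \<open>\<gamma> < lam\<close>] prune_subset node_seq Q_seq next_Q(1) \<gamma>_def in auto)
  ultimately show ?thesis
    using next_Q(1) by metis
qed

end

end

section \<open>Indexed splitting nodes\<close>

text \<open>\<open>Q\<close> is the set of nodes of \<open>K\<close> with at least \<open>k i\<close> successors, where \<open>i\<close> is the order type of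
  the set of nodes of \<open>Q\<close> strictly below.\<close>

locale indexed_tree = cardinal_tower lam k
  for lam :: "'o::wellorder" and k :: "'o \<Rightarrow> 'o" +
  fixes p K :: "'o node set"
  assumes closed: "closed_tree p" and K_subset: "K \<subseteq> p"
    and K_dense: "\<And>t \<alpha>. t \<in> p \<Longrightarrow> \<alpha> < lam \<Longrightarrow> \<exists>s\<in>K. t \<subseteq>\<^sub>m s \<and> splitting k p \<alpha> s"
begin

function idx :: "'o node \<Rightarrow> 'o" where
  "idx s = (LEAST i. \<forall>u. u \<sqsubset> s \<longrightarrow> u \<in> K \<and> splitting k p (idx u) u \<longrightarrow> idx u < i)"
  by auto

termination
  by (relation "{(u, s). u \<sqsubset> s}") (use wfp_prefix_less in \<open>auto simp: wfp_def\<close>)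

declare idx.simps [simp del]

definition Q :: "'o node set" where
  "Q = {s \<in> K. splitting k p (idx s) s}"

lemma idx_eq_strict_sup: "idx s = strict_sup {u \<in> Q. u \<sqsubset> s} idx"
  unfolding idx.simps[of s] strict_sup_def Q_def by (rule arg_cong[of _ _ Least]) auto

lemma Q_subset: "Q \<subseteq> p"
  unfolding Q_def using K_subset by blast

lemma Q_seq: "s \<in> Q \<Longrightarrow> is_seq s"
  using Q_subset tree_is_seq[OF closed] by blast

lemma idx_le_len: "idx s \<le> len s"
proof (induction s rule: wfp_induct_rule[OF wfp_prefix_less])
  case (1 s)
  show ?case
    unfolding idx_eq_strict_sup[of s]
  proof (rule strict_sup_le)
    fix u assume "u \<in> {u \<in> Q. u \<sqsubset> s}"
    then show "idx u < len s"
      using 1[of u] prefix_lessD(2)[of u s] by simp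
  qed
qed

lemma idx_less_lam: "s \<in> p \<Longrightarrow> idx s < lam"
  using idx_le_len tree_len_less[OF closed] le_less_trans by blast

lemma idx_less:
  assumes "u \<in> Q" "u \<sqsubset> s" shows "idx u < idx s"
  unfolding idx_eq_strict_sup[of s]
proof (rule less_strict_sup)
  show "idx v < len s" if "v \<in> {v \<in> Q. v \<sqsubset> s}" for v
    using that idx_le_len[of v] prefix_lessD(2) le_less_trans by blast
qed (use assms in blast)

lemma idx_enumerates: "i < idx s \<Longrightarrow> \<exists>u\<in>Q. u \<sqsubset> s \<and> idx u = i"
proof (induction s rule: wfp_induct_rule[OF wfp_prefix_less])
  case (1 s)
  obtain u where u: "u \<in> Q" "u \<sqsubset> s" "i \<le> idx u"
    using less_strict_supD[of i "{u \<in> Q. u \<sqsubset> s}" idx] 1(2) idx_eq_strict_sup[of s] by auto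
  show ?case
  proof (cases "i = idx u")
    case False
    then have "i < idx u"
      using u(3) by simp
    then obtain v where "v \<in> Q" "v \<sqsubset> u" "idx v = i"
      using 1(1)[OF u(2)] by blast
    moreover from this have "v \<sqsubset> s"
      using prefix_less_le_trans u(2) unfolding prefix_less_def by blast
    ultimately show ?thesis by blast
  qed (use u in blast)
qed

lemma prefix_less_of_idx_less:
  assumes "u \<in> Q" "v \<in> Q" "is_seq w" "u \<subseteq>\<^sub>m w" "v \<subseteq>\<^sub>m w" "idx u < idx v" shows "u \<sqsubset> v"
proof -
  have "u \<noteq> v"
    using assms(6) by blast
  moreover have "\<not> v \<sqsubset> u"
    using assms(6) idx_less[OF assms(2)] by fastforce
  moreover have "u \<subseteq>\<^sub>m v \<or> v \<subseteq>\<^sub>m u"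
    using seq_le_linear[OF Q_seq[OF assms(1)] Q_seq[OF assms(2)] assms(3-5)] .
  ultimately show ?thesis
    unfolding prefix_less_def using Q_seq assms(1,2) by blast
qed

lemma idx_inject:
  assumes "u \<in> Q" "v \<in> Q" "is_seq w" "u \<subseteq>\<^sub>m w" "v \<subseteq>\<^sub>m w" "idx u = idx v" shows "u = v"
proof -
  have "u \<subseteq>\<^sub>m v \<or> v \<subseteq>\<^sub>m u"
    using seq_le_linear[OF Q_seq[OF assms(1)] Q_seq[OF assms(2)] assms(3-5)] .
  then show ?thesis
    using idx_less[OF assms(1), of v] idx_less[OF assms(2), of u] assms(6) Q_seq assms(1,2)
    unfolding prefix_less_def by force
qed

lemma idx_eq_of_no_Q_between:
  assumes seq: "is_seq t" "is_seq s" and "t \<subseteq>\<^sub>m s"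
    and between: "\<And>u. u \<in> Q \<Longrightarrow> t \<subseteq>\<^sub>m u \<Longrightarrow> \<not> u \<sqsubset> s"
  shows "idx s = idx t"
proof -
  have "u \<sqsubset> s \<longleftrightarrow> u \<sqsubset> t" if u: "u \<in> Q" for u
  proof
    assume us: "u \<sqsubset> s"
    have "u \<subseteq>\<^sub>m t \<or> t \<subseteq>\<^sub>m u"
      using seq_le_linear[OF Q_seq[OF u] seq prefix_lessD(1)[OF us] \<open>t \<subseteq>\<^sub>m s\<close>] .
    then show "u \<sqsubset> t"
      using between[OF u] us seq(1) Q_seq[OF u] unfolding prefix_less_def by auto
  qed (use prefix_less_le_trans \<open>t \<subseteq>\<^sub>m s\<close> seq(2) in blast)
  then have "{u \<in> Q. u \<sqsubset> s} = {u \<in> Q. u \<sqsubset> t}"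
    by blast
  then show ?thesis
    unfolding idx_eq_strict_sup[of s] idx_eq_strict_sup[of t] by simp
qed

lemma Q_dense:
  assumes t: "t \<in> p" shows "\<exists>s\<in>Q. t \<subseteq>\<^sub>m s"
proof (rule ccontr)
  assume none: "\<not> (\<exists>s\<in>Q. t \<subseteq>\<^sub>m s)"
  obtain s where s: "s \<in> K" "t \<subseteq>\<^sub>m s" "splitting k p (idx t) s"
    using K_dense[OF t idx_less_lam[OF t]] by blast
  have "idx s = idx t"
    using none s K_subset t tree_is_seq[OF closed] by (intro idx_eq_of_no_Q_between) blast+
  then have "s \<in> Q"
    unfolding Q_def using s by simp
  then show False
    using none s(2) by blast
qed

sublocale guided_tree lam k p Q
  by unfold_locales (use closed Q_subset Q_dense in blast)+

lemma Q_splitting: "s \<in> Q \<Longrightarrow> splitting k p (idx s) s"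
  unfolding Q_def by blast

lemma Q_subset_Split: "Q \<subseteq> Split p"
  using Split_of_splitting Q_splitting idx_less_lam Q_subset by blast

lemma idx_next_Q: "t \<in> p \<Longrightarrow> idx (next_Q t) = idx t"
  using idx_eq_of_no_Q_between[of t "next_Q t"] node_seq Q_seq next_Q_in_Q map_le_next_Q
    next_Q_first
  by blast

lemma idx_snoc:
  assumes u: "u \<in> Q" shows "idx (u \<frown> b) = next_ord (idx u)"
proof (rule antisym)
  have node: "is_seq u" "len u < lam" "idx u < lam"
    using u Q_subset tree_node[OF closed] idx_less_lam by blast+
  show "next_ord (idx u) \<le> idx (u \<frown> b)"
    using next_ord_le[OF idx_less[OF u prefix_less_snoc[OF node(1,2)]]] .
  show "idx (u \<frown> b) \<le> next_ord (idx u)"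
    unfolding idx_eq_strict_sup[of "u \<frown> b"]
  proof (rule strict_sup_le)
    fix v assume "v \<in> {v \<in> Q. v \<sqsubset> u \<frown> b}"
    then have "v \<in> Q" "is_seq v" "v \<subseteq>\<^sub>m u"
      using prefix_less_snoc_iff[OF node(1,2)] by blast+
    then have "idx v \<le> idx u"
      using idx_less[of v u] node(1) unfolding prefix_less_def by fastforce
    then show "idx v < next_ord (idx u)"
      unfolding less_next_ord_iff[OF node(3)] .
  qed
qed

context
  fixes Y :: "'o node \<Rightarrow> 'o set"
  assumes Y: "\<And>s. s \<in> Q \<Longrightarrow> Y s \<noteq> {} \<and> Y s \<subseteq> OSucc p s"
begin

lemma idx_unbounded_on_branch:
  assumes b: "b \<in> branches (prune Y)" and "\<alpha> < lam" "\<beta> < lam"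
  shows "\<exists>\<gamma><lam. \<beta> \<le> \<gamma> \<and> b |` {..<\<gamma>} \<in> Q \<and> \<alpha> \<le> idx (b |` {..<\<gamma>})"
proof -
  define Z where "Z = {\<gamma>. \<gamma> < lam \<and> \<beta> \<le> \<gamma> \<and> b |` {..<\<gamma>} \<in> Q}"
  have unbounded: "\<exists>\<gamma>\<in>Z. x \<le> \<gamma>" if "x < lam" for x
    using branch_meets_Q[OF Y b, of "max \<beta> x"] that \<open>\<beta> < lam\<close> unfolding Z_def by auto
  have "inj_on (\<lambda>\<gamma>. idx (b |` {..<\<gamma>})) Z"
  proof (rule inj_onI)
    fix \<gamma> \<gamma>' assume "\<gamma> \<in> Z" "\<gamma>' \<in> Z" "idx (b |` {..<\<gamma>}) = idx (b |` {..<\<gamma>'})"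
    moreover have "is_seq b"
      using b unfolding branches_def by blast
    ultimately have "b |` {..<\<gamma>} = b |` {..<\<gamma>'}"
      using idx_inject restrict_lessThan_map_le unfolding Z_def by blast
    then show "\<gamma> = \<gamma>'"
      using branch_restrict(2)[OF closed_tree_prune[OF Y] b] \<open>\<gamma> \<in> Z\<close> \<open>\<gamma>' \<in> Z\<close> unfolding Z_def
      by (metis (lifting) mem_Collect_eq)
  qed
  then have "\<exists>\<gamma>\<in>Z. \<alpha> \<le> idx (b |` {..<\<gamma>})"
    using regular_unbounded_not_inj[OF cf_lam \<open>\<alpha> < lam\<close> _ unbounded] unfolding Z_def by blast
  then show ?thesis
    unfolding Z_def by blast
qed

lemma idx_unbounded:
  assumes t: "t \<in> prune Y" and "\<alpha> < lam"
  shows "\<exists>s\<in>Q \<inter> prune Y. t \<subseteq>\<^sub>m s \<and> \<alpha> \<le> idx s"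
proof -
  note closed' = closed_tree_prune[OF Y]
  obtain b where b: "b \<in> branches (prune Y)" "t \<subseteq>\<^sub>m b"
    using branch_exists[OF closed' t] by blast
  obtain \<gamma> where \<gamma>: "\<gamma> < lam" "len t \<le> \<gamma>" "b |` {..<\<gamma>} \<in> Q" "\<alpha> \<le> idx (b |` {..<\<gamma>})"
    using idx_unbounded_on_branch[OF b(1) \<open>\<alpha> < lam\<close> tree_len_less[OF closed' t]] by blast
  have "b |` {..<\<gamma>} \<in> prune Y"
    using branch_restrict(1)[OF closed' b(1) \<gamma>(1)] .
  moreover have "t \<subseteq>\<^sub>m b |` {..<\<gamma>}"
    using branch_le_restrict[OF closed' b(1) \<gamma>(1) tree_is_seq[OF closed' t] b(2) \<gamma>(2)] .
  ultimately show ?thesis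
    using \<gamma>(3,4) by blast
qed

lemma idx_unbounded_successor:
  assumes t: "t \<in> prune Y" and "\<alpha> < lam"
  shows "\<exists>s\<in>Q \<inter> prune Y. t \<subseteq>\<^sub>m s \<and> \<alpha> \<le> idx s \<and> (\<exists>u\<in>Q. u \<sqsubset> s \<and> idx s = next_ord (idx u))"
proof -
  note closed' = closed_tree_prune[OF Y]
  obtain u where u: "u \<in> Q" "u \<in> prune Y" "t \<subseteq>\<^sub>m u" "\<alpha> \<le> idx u"
    using idx_unbounded[OF assms] by blast
  obtain b where b: "u \<frown> b \<in> prune Y"
    using OSucc_nonempty[OF closed' u(2)] unfolding OSucc_def by blast
  then have w: "u \<frown> b \<in> p" "u \<sqsubset> u \<frown> b"
    using prune_subset tree_snoc(3)[OF closed' u(2)] by blast+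
  let ?s = "next_Q (u \<frown> b)"
  have s: "?s \<in> Q \<inter> prune Y" "u \<sqsubset> ?s"
    using next_Q_in_Q[OF w(1)] next_Q_in_prune[OF Y b]
      prefix_less_le_trans[OF w(2) map_le_next_Q[OF w(1)]] Q_seq
    by blast+
  moreover have "idx ?s = next_ord (idx u)"
    unfolding idx_next_Q[OF w(1)] by (rule idx_snoc[OF u(1)])
  moreover have "\<alpha> \<le> idx ?s"
    using u(4) idx_less[OF u(1) s(2)] by simp
  moreover have "t \<subseteq>\<^sub>m ?s"
    using u(3) prefix_lessD(1)[OF s(2)] map_le_trans by blast
  ultimately show ?thesis
    using u(1) by blast
qed

end

lemma is_limit_idx:
  assumes u: "u \<in> p" "is_limit (len u)" and cofinal: "\<And>\<beta>. \<beta> < len u \<Longrightarrow> \<exists>v\<in>Q. v \<sqsubset> u \<and> \<beta> < len v"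
  shows "is_limit (idx u)"
  unfolding is_limit_def
proof (intro conjI allI impI)
  obtain v where "v \<in> Q" "v \<sqsubset> u"
    using cofinal u(2) unfolding is_limit_def by blast
  then show "\<exists>i. i < idx u"
    using idx_less by blast
  fix i assume "i < idx u"
  then obtain w where w: "w \<in> Q" "w \<sqsubset> u" "idx w = i"
    using idx_enumerates by blast
  obtain v where v: "v \<in> Q" "v \<sqsubset> u" "len w < len v"
    using cofinal[OF prefix_lessD(2)[OF w(2)]] by blast
  then have "w \<subseteq>\<^sub>m v"
    using seq_le_of_len_le[of w v u] w(2) unfolding prefix_less_iff by auto
  then have "w \<sqsubset> v"
    unfolding prefix_less_iff using v(1,3) w(1) Q_seq by blast
  then show "\<exists>j<idx u. i < j"
    using idx_less[OF w(1)] idx_less[OF v(1,2)] w(3) by blast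
qed

lemma limit_in_Q:
  assumes scl: "splitting_closed lam (\<lambda>\<alpha> t. splitting k p \<alpha> t \<and> t \<in> K) p"
    and u: "u \<in> p" "is_limit (len u)" and cofinal: "\<And>\<beta>. \<beta> < len u \<Longrightarrow> \<exists>v\<in>Q. v \<sqsubset> u \<and> \<beta> < len v"
  shows "u \<in> Q"
proof -
  note u_seq = node_seq[OF u(1)]
  obtain q where q: "\<And>i. i < idx u \<Longrightarrow> q i \<in> Q" "\<And>i. i < idx u \<Longrightarrow> q i \<sqsubset> u"
    "\<And>i. i < idx u \<Longrightarrow> idx (q i) = i"
    using idx_enumerates[of _ u] by metis
  have q_idx: "q (idx v) = v" if "v \<in> Q" "v \<sqsubset> u" for v
    using idx_inject[OF q(1)[OF idx_less[OF that]] that(1) u_seq] q[OF idx_less[OF that]] that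
      prefix_lessD(1) by blast
  have increasing: "q i \<sqsubset> q j" if "i < j" "j < idx u" for i j
  proof -
    have "i < idx u"
      using that by (rule less_trans)
    with that show ?thesis
      using prefix_less_of_idx_less[OF q(1) q(1) u_seq prefix_lessD(1)[OF q(2)] prefix_lessD(1)[OF q(2)]]
        q(3) by simp
  qed
  have "is_limit (idx u)"
    using is_limit_idx[OF u cofinal] .
  moreover have "seq_union {..<idx u} q u"
    unfolding seq_union_def using q(2) q_idx idx_less cofinal by (metis lessThan_iff)
  moreover have "q i \<in> p \<and> splitting k p i (q i) \<and> q i \<in> K" if "i < idx u" for i
    using q[OF that] Q_splitting[of "q i"] Q_subset unfolding Q_def by auto
  ultimately have "splitting k p (idx u) u \<and> u \<in> K"
    using scl[unfolded splitting_closed_iff[OF closed]] u(1) idx_less_lam increasing by blast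
  then show ?thesis
    unfolding Q_def by blast
qed

end

section \<open>Perfect trees\<close>

context cardinal_tower
begin

text \<open>\<open>\<Theta> l X\<close> is the requirement on the set \<open>X\<close> of ordinal successors of a node of length \<open>l\<close>.\<close>

definition branching :: "('o \<Rightarrow> 'o set \<Rightarrow> bool) \<Rightarrow> 'o node set \<Rightarrow> 'o \<Rightarrow> 'o node \<Rightarrow> bool" where
  "branching \<Theta> p \<alpha> s \<longleftrightarrow> splitting k p \<alpha> s \<and> \<Theta> (len s) (OSucc p s)"

definition perfect_forcing :: "('o \<Rightarrow> 'o set \<Rightarrow> bool) \<Rightarrow> 'o node set set" where
  "perfect_forcing \<Theta> = {p. closed_tree p \<and> (\<forall>t\<in>p. \<forall>\<alpha><lam. \<exists>s\<in>p. t \<subseteq>\<^sub>m s \<and> branching \<Theta> p \<alpha> s)}"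

lemma closed_tree_perfect: "p \<in> perfect_forcing \<Theta> \<Longrightarrow> closed_tree p"
  unfolding perfect_forcing_def by blast

lemma perfect_branching:
  "p \<in> perfect_forcing \<Theta> \<Longrightarrow> t \<in> p \<Longrightarrow> \<alpha> < lam \<Longrightarrow> \<exists>s\<in>p. t \<subseteq>\<^sub>m s \<and> branching \<Theta> p \<alpha> s"
  unfolding perfect_forcing_def by blast

lemma branching_cong: "OSucc q s = OSucc p s \<Longrightarrow> branching \<Theta> q \<alpha> s \<longleftrightarrow> branching \<Theta> p \<alpha> s"
  unfolding branching_def splitting_iff by simp

lemma branching_dense_cone:
  assumes p: "closed_tree p" and t: "t \<in> p"
    and dense: "\<And>v. v \<in> p \<Longrightarrow> t \<subseteq>\<^sub>m v \<Longrightarrow> \<exists>s\<in>p. v \<subseteq>\<^sub>m s \<and> branching \<Theta> p \<alpha> s \<and> G s"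
    and u: "u \<in> cone p t"
  shows "\<exists>s\<in>cone p t. u \<subseteq>\<^sub>m s \<and> branching \<Theta> (cone p t) \<alpha> s \<and> G s"
proof -
  obtain v where v: "v \<in> p" "t \<subseteq>\<^sub>m v" "u \<subseteq>\<^sub>m v"
    using u t unfolding cone_def by auto
  obtain s where s: "s \<in> p" "v \<subseteq>\<^sub>m s" "branching \<Theta> p \<alpha> s" "G s"
    using dense[OF v(1,2)] by blast
  have "t \<subseteq>\<^sub>m s"
    using v(2) s(2) by (rule map_le_trans)
  then have "s \<in> cone p t" "branching \<Theta> (cone p t) \<alpha> s"
    using s branching_cong[OF OSucc_cone[OF p t s(1)]] unfolding cone_def by blast+
  then show ?thesis
    using s(2,4) v(3) map_le_trans by blast
qed

lemma perfect_forcing_cone: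
  assumes p: "p \<in> perfect_forcing \<Theta>" and t: "t \<in> p" shows "cone p t \<in> perfect_forcing \<Theta>"
proof -
  note closed = closed_tree_perfect[OF p]
  have "\<exists>s\<in>cone p t. u \<subseteq>\<^sub>m s \<and> branching \<Theta> (cone p t) \<alpha> s" if "u \<in> cone p t" "\<alpha> < lam" for u \<alpha>
    using branching_dense_cone[OF closed t _ that(1), of \<Theta> \<alpha> "\<lambda>_. True"]
      perfect_branching[OF p _ that(2)]
    by blast
  then show ?thesis
    unfolding perfect_forcing_def using closed_tree_cone[OF closed t] by blast
qed

lemma tree_forcing_perfect: "tree_forcing lam k (perfect_forcing \<Theta>)"
  by unfold_locales (use closed_tree_perfect perfect_forcing_cone in blast)+

lemma indexed_tree_of_dense_branching:
  assumes "closed_tree p"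
    and "\<And>t \<alpha>. t \<in> p \<Longrightarrow> \<alpha> < lam \<Longrightarrow> \<exists>s\<in>p. t \<subseteq>\<^sub>m s \<and> branching \<Theta> p \<alpha> s \<and> G s"
  shows "indexed_tree lam k p {s \<in> p. \<Theta> (len s) (OSucc p s) \<and> G s}"
proof unfold_locales
  show "\<exists>s\<in>{s \<in> p. \<Theta> (len s) (OSucc p s) \<and> G s}. t \<subseteq>\<^sub>m s \<and> splitting k p \<alpha> s"
    if "t \<in> p" "\<alpha> < lam" for t \<alpha>
    using assms(2)[OF that] unfolding branching_def by blast
qed (use assms(1) in auto)

lemma indexed_tree_perfect:
  "p \<in> perfect_forcing \<Theta> \<Longrightarrow> indexed_tree lam k p {s \<in> p. \<Theta> (len s) (OSucc p s)}"
  using indexed_tree_of_dense_branching[of p \<Theta> "\<lambda>_. True"] closed_tree_perfect perfect_branching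
  by simp

end

lemma (in indexed_tree) prune_perfect:
  assumes Y: "\<And>s. s \<in> Q \<Longrightarrow> Y s \<noteq> {} \<and> Y s \<subseteq> OSucc p s"
    and dense: "\<And>t \<alpha>. t \<in> prune Y \<Longrightarrow> \<alpha> < lam \<Longrightarrow>
      \<exists>s\<in>Q \<inter> prune Y. t \<subseteq>\<^sub>m s \<and> \<alpha> \<le> idx s \<and> \<Theta> (len s) (Y s) \<and> |OSucc p s| \<le>o |Y s|"
  shows "prune Y \<in> perfect_forcing \<Theta>"
proof -
  have "\<exists>s\<in>prune Y. t \<subseteq>\<^sub>m s \<and> branching \<Theta> (prune Y) \<alpha> s" if t: "t \<in> prune Y" "\<alpha> < lam" for t \<alpha>
  proof -
    obtain s where s: "s \<in> Q" "s \<in> prune Y" "t \<subseteq>\<^sub>m s" "\<alpha> \<le> idx s" "\<Theta> (len s) (Y s)"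
      "|OSucc p s| \<le>o |Y s|"
      using dense[OF t] by blast
    have "splitting k p \<alpha> s"
      using splitting_mono[OF Q_splitting[OF s(1)] s(4)] idx_less_lam Q_subset s(1) by blast
    then have "|{..<k \<alpha>}| \<le>o |Y s|"
      unfolding splitting_iff using s(6) ordLeq_transitive by blast
    then have "branching \<Theta> (prune Y) \<alpha> s"
      unfolding branching_def splitting_iff using OSucc_prune[OF Y s(2)] s(1,5) by simp
    then show ?thesis
      using s(2,3) by blast
  qed
  then show ?thesis
    unfolding perfect_forcing_def using closed_tree_prune[OF Y] by blast
qed

subsection \<open>Lowering the order type of the splitting nodes\<close>

definition split_descent :: "'o::wellorder node set \<Rightarrow> 'o node set \<Rightarrow> bool" where
  "split_descent p r \<longleftrightarrow> (\<exists>e. \<forall>s\<in>Split r. e s \<in> Split p \<and> e s \<sqsubset> s \<and> (\<forall>s'\<in>Split r. s' \<sqsubset> s \<longrightarrow>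
    e s' \<sqsubset> e s))"

lemma no_split_descent_chain:
  assumes "\<And>n::nat. split_descent (a n) (a (Suc n))" shows "\<exists>n. s \<notin> Split (a n)"
proof -
  have "\<exists>e. \<forall>n. \<forall>s\<in>Split (a (Suc n)). e n s \<in> Split (a n) \<and> e n s \<sqsubset> s \<and>
     (\<forall>s'\<in>Split (a (Suc n)). s' \<sqsubset> s \<longrightarrow> e n s' \<sqsubset> e n s)"
    using assms unfolding split_descent_def by (rule choice[OF allI])
  then obtain e where "\<And>n s. s \<in> Split (a (Suc n)) \<Longrightarrow> e n s \<in> Split (a n) \<and> e n s \<sqsubset> s \<and>
     (\<forall>s'\<in>Split (a (Suc n)). s' \<sqsubset> s \<longrightarrow> e n s' \<sqsubset> e n s)"
    by blast
  then show ?thesis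
    by (intro no_infinite_regression[OF wfp_prefix_less, of "\<lambda>n. Split (a n)" e]) blast+
qed

context indexed_tree
begin

definition predecessor :: "'o node \<Rightarrow> 'o node \<Rightarrow> bool" where
  "predecessor s u \<longleftrightarrow> u \<in> Q \<and> u \<sqsubset> s \<and> idx s = next_ord (idx u)"

lemma predecessor_prefix_less:
  assumes "predecessor s u" "predecessor s' u'" "s' \<in> Q" "s' \<sqsubset> s" shows "u' \<sqsubset> u"
proof -
  have u: "u \<in> Q" "u \<sqsubset> s" "idx s = next_ord (idx u)" and u': "u' \<in> Q" "u' \<sqsubset> s'"
    using assms(1,2) unfolding predecessor_def by blast+
  have "idx u < lam"
    using u(1) Q_subset idx_less_lam by blast
  then have "idx s' \<le> idx u"
    using idx_less[OF assms(3,4)] less_next_ord_iff unfolding u(3) by blast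
  then have "idx u' < idx u"
    using idx_less[OF u'] by simp
  moreover have "is_seq s" "u' \<subseteq>\<^sub>m s"
    using u'(2) assms(4) map_le_trans unfolding prefix_less_def by blast+
  ultimately show ?thesis
    using prefix_less_of_idx_less[OF u'(1) u(1)] prefix_lessD(1)[OF u(2)] by blast
qed

definition successor_branching :: "'o node \<Rightarrow> 'o set" where
  "successor_branching s = (if \<exists>u. predecessor s u then OSucc p s else {SOME b. b \<in> OSucc p s})"

lemma successor_branching:
  assumes "s \<in> Q" shows "successor_branching s \<noteq> {} \<and> successor_branching s \<subseteq> OSucc p s"
proof -
  have "OSucc p s \<noteq> {}"
    using OSucc_nonempty[OF closed] assms Q_subset by blast
  then show ?thesis
    unfolding successor_branching_def by (simp add: some_in_eq)
qed

lemma split_descent_successor_branching: "split_descent p (prune successor_branching)"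
proof -
  define e where "e s = (SOME u. predecessor s u)" for s
  have e: "predecessor s (e s)" "s \<in> Q" if "s \<in> Split (prune successor_branching)" for s
  proof -
    have s: "s \<in> Q" "OSucc (prune successor_branching) s = successor_branching s"
      using Split_prune[OF successor_branching that] by blast+
    then have "\<exists>u. predecessor s u"
      using that unfolding Split_def successor_branching_def by (auto split: if_splits)
    then show "predecessor s (e s)"
      unfolding e_def by (rule someI_ex)
    show "s \<in> Q" by (rule s(1))
  qed
  have "e s \<in> Split p \<and> e s \<sqsubset> s" if "s \<in> Split (prune successor_branching)" for s
    using e(1)[OF that] Q_subset_Split unfolding predecessor_def by blast
  moreover have "e s' \<sqsubset> e s"
    if "s \<in> Split (prune successor_branching)" "s' \<in> Split (prune successor_branching)" "s' \<sqsubset> s"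
      for s s'
    using predecessor_prefix_less[OF e(1)[OF that(1)] e[OF that(2)] that(3)] .
  ultimately show ?thesis
    unfolding split_descent_def by blast
qed

end

context cardinal_tower
begin

lemma split_descent_dense:
  assumes r: "r \<in> perfect_forcing \<Theta>" and "r \<subseteq> p"
  shows "\<exists>r'\<in>perfect_forcing \<Theta>. r' \<subseteq> r \<and> split_descent p r'"
proof -
  interpret indexed_tree lam k r "{s \<in> r. \<Theta> (len s) (OSucc r s)}"
    by (rule indexed_tree_perfect[OF r])
  have "prune successor_branching \<in> perfect_forcing \<Theta>"
  proof (rule prune_perfect[OF successor_branching])
    fix t \<alpha> assume t: "t \<in> prune successor_branching" "\<alpha> < lam"
    then obtain s where s: "s \<in> Q \<inter> prune successor_branching" "t \<subseteq>\<^sub>m s" "\<alpha> \<le> idx s"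
      "\<exists>u. predecessor s u"
      using idx_unbounded_successor[OF successor_branching t] unfolding predecessor_def by blast
    moreover have "successor_branching s = OSucc r s"
      using s(4) unfolding successor_branching_def by simp
    moreover have "\<Theta> (len s) (OSucc r s)"
      using s(1) unfolding Q_def by simp
    ultimately show "\<exists>s\<in>Q \<inter> prune successor_branching. t \<subseteq>\<^sub>m s \<and> \<alpha> \<le> idx s \<and>
        \<Theta> (len s) (successor_branching s) \<and> |OSucc r s| \<le>o |successor_branching s|"
      by (intro bexI[of _ s]) (simp_all add: card_of_mono1)
  qed
  moreover have "split_descent p (prune successor_branching)"
    using split_descent_successor_branching Split_mono[OF \<open>r \<subseteq> p\<close>]
    unfolding split_descent_def by blast
  ultimately show ?thesis
    using prune_subset by blast
qed

subsection \<open>Avoiding a set of splitting levels\<close>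

lemma perfect_subtree_of_dense_branching:
  assumes p: "closed_tree p"
    and "\<And>t \<alpha>. t \<in> p \<Longrightarrow> \<alpha> < lam \<Longrightarrow> \<exists>s\<in>p. t \<subseteq>\<^sub>m s \<and> branching \<Theta> p \<alpha> s \<and> G s"
  obtains r where "r \<in> perfect_forcing \<Theta>" "r \<subseteq> p" "\<And>s. s \<in> Split r \<Longrightarrow> G s"
proof -
  interpret indexed_tree lam k p "{s \<in> p. \<Theta> (len s) (OSucc p s) \<and> G s}"
    using assms by (rule indexed_tree_of_dense_branching)
  have Y: "OSucc p s \<noteq> {} \<and> OSucc p s \<subseteq> OSucc p s" if "s \<in> Q" for s
    using OSucc_nonempty[OF closed] that Q_subset by blast
  have large: "\<Theta> (len s) (OSucc p s)" if "s \<in> Q" for s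
    using that unfolding Q_def by blast
  have "prune (OSucc p) \<in> perfect_forcing \<Theta>"
  proof (rule prune_perfect[OF Y])
    show "\<exists>s\<in>Q \<inter> prune (OSucc p). t \<subseteq>\<^sub>m s \<and> \<alpha> \<le> idx s \<and> \<Theta> (len s) (OSucc p s) \<and>
      |OSucc p s| \<le>o |OSucc p s|"
      if "t \<in> prune (OSucc p)" "\<alpha> < lam" for t \<alpha>
      using idx_unbounded[OF Y that] large card_of_mono1[OF subset_refl] by blast
  qed
  moreover have "G s" if "s \<in> Split (prune (OSucc p))" for s
    using Split_prune[OF Y that] unfolding Q_def by blast
  ultimately show ?thesis
    using that prune_subset by blast
qed

lemma branching_outside_some_level_set:
  assumes q: "q \<in> perfect_forcing \<Theta>" and empty: "\<And>\<beta>. \<beta> < lam \<Longrightarrow> \<exists>n::nat. \<beta> \<notin> A n"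
  shows "\<exists>n. \<exists>t\<in>q. \<forall>v\<in>q. t \<subseteq>\<^sub>m v \<longrightarrow> (\<forall>\<alpha><lam. \<exists>s\<in>q. v \<subseteq>\<^sub>m s \<and> branching \<Theta> q \<alpha> s \<and> len s \<notin> A n)"
proof (rule ccontr)
  note closed = closed_tree_perfect[OF q]
  define avoids where "avoids n \<alpha> v \<longleftrightarrow> (\<exists>s\<in>q. v \<subseteq>\<^sub>m s \<and> branching \<Theta> q \<alpha> s \<and> len s \<notin> A n)" for n \<alpha> v
  assume "\<not> (\<exists>n. \<exists>t\<in>q. \<forall>v\<in>q. t \<subseteq>\<^sub>m v \<longrightarrow> (\<forall>\<alpha><lam. \<exists>s\<in>q. v \<subseteq>\<^sub>m s \<and> branching \<Theta> q \<alpha> s \<and> len s \<notin> A n))"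
  then have extend: "\<exists>v\<in>q. t \<subseteq>\<^sub>m v \<and> (\<exists>\<alpha><lam. \<not> avoids n \<alpha> v)" if "t \<in> q" for n t
    using that unfolding avoids_def by blast
  have "\<exists>T. \<forall>n::nat. T n \<in> q \<and> (T n \<sqsubset> T (Suc n) \<and> (\<exists>\<alpha><lam. \<not> avoids n \<alpha> (T (Suc n))))"
  proof (rule dependent_nat_choice)
    show "\<exists>t. t \<in> q"
      using empty_in_tree[OF closed] by blast
    fix t n assume t: "t \<in> q"
    obtain b where b: "t \<frown> b \<in> q"
      using OSucc_nonempty[OF closed t] unfolding OSucc_def by blast
    then obtain v where v: "v \<in> q" "t \<frown> b \<subseteq>\<^sub>m v" "\<exists>\<alpha><lam. \<not> avoids n \<alpha> v"
      using extend by blast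
    have "t \<sqsubset> v"
      using prefix_less_le_trans[OF tree_snoc(3)[OF closed t] v(2) tree_is_seq[OF closed v(1)]] .
    with v show "\<exists>v. v \<in> q \<and> (t \<sqsubset> v \<and> (\<exists>\<alpha><lam. \<not> avoids n \<alpha> v))"
      by blast
  qed
  then obtain T a where T: "\<And>n. T n \<in> q" "\<And>n. T n \<sqsubset> T (Suc n)"
    and a: "\<And>n. a n < lam" "\<And>n. \<not> avoids n (a n) (T (Suc n))"
    by metis
  obtain u where u: "u \<in> q" "\<And>n. T n \<sqsubset> u"
    using tree_countable_union[OF closed, of T, OF T] by blast
  obtain \<alpha> where \<alpha>: "\<alpha> < lam" "\<And>n. a n < \<alpha>"
    using countable_bounded[of a, OF a(1)] by blast
  obtain s where s: "s \<in> q" "u \<subseteq>\<^sub>m s" "branching \<Theta> q \<alpha> s"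
    using perfect_branching[OF q u(1) \<alpha>(1)] by blast
  obtain n where n: "len s \<notin> A n"
    using empty tree_len_less[OF closed s(1)] by blast
  have "branching \<Theta> q (a n) s"
    using s(3) splitting_mono[OF _ less_imp_le[OF \<alpha>(2)] \<alpha>(1)] unfolding branching_def by blast
  moreover have "T (Suc n) \<subseteq>\<^sub>m s"
    using prefix_lessD(1)[OF u(2)] s(2) by (rule map_le_trans)
  ultimately show False
    using a(2) s(1) n unfolding avoids_def by blast
qed

theorem perfect_forcing_adds_new_function:
  "adds_new_function (perfect_forcing \<Theta>) (\<subseteq>) {..<lam} {0, 1 :: nat}"
proof (rule tree_forcing.adds_new_function_of_descent[OF tree_forcing_perfect, of _ split_descent])
  show "\<exists>r'\<in>perfect_forcing \<Theta>. r' \<subseteq> r \<and> split_descent p r'" if "r \<in> perfect_forcing \<Theta>" "r \<subseteq> p"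
    for p r
    using that by (rule split_descent_dense)
  show False if "\<And>n::nat. split_descent (a n) (a (Suc n))" "\<And>n. s \<in> Split (a n)" for a s
    using no_split_descent_chain[of a s] that by blast
next
  fix q and A :: "nat \<Rightarrow> 'o set"
  assume q: "q \<in> perfect_forcing \<Theta>" and empty: "\<And>\<beta>. \<beta> < lam \<Longrightarrow> \<exists>n. \<beta> \<notin> A n"
    and dense: "\<And>n r. r \<in> perfect_forcing \<Theta> \<Longrightarrow> r \<subseteq> q \<Longrightarrow>
      \<exists>r'\<in>perfect_forcing \<Theta>. r' \<subseteq> r \<and> (\<forall>s\<in>Split r'. len s \<in> A n)"
  note closed = closed_tree_perfect[OF q]
  obtain n t where t: "t \<in> q" and outside: "\<And>v \<alpha>. v \<in> q \<Longrightarrow> t \<subseteq>\<^sub>m v \<Longrightarrow> \<alpha> < lam \<Longrightarrow>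
      \<exists>s\<in>q. v \<subseteq>\<^sub>m s \<and> branching \<Theta> q \<alpha> s \<and> len s \<notin> A n"
    using branching_outside_some_level_set[OF q, of A] empty by blast
  have outside_cone: "\<exists>s\<in>cone q t. u \<subseteq>\<^sub>m s \<and> branching \<Theta> (cone q t) \<alpha> s \<and> len s \<notin> A n"
    if "u \<in> cone q t" "\<alpha> < lam" for u \<alpha>
    using branching_dense_cone[OF closed t outside that(1)] that(2) by blast
  obtain r where r: "r \<in> perfect_forcing \<Theta>" "r \<subseteq> cone q t" "\<And>s. s \<in> Split r \<Longrightarrow> len s \<notin> A n"
    using perfect_subtree_of_dense_branching[OF closed_tree_cone[OF closed t] outside_cone] by blast
  then obtain r' where r': "r' \<in> perfect_forcing \<Theta>" "r' \<subseteq> r" "\<forall>s\<in>Split r'. len s \<in> A n"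
    using dense[of r] cone_subset by blast
  obtain s where "s \<in> r'" "branching \<Theta> r' omega s"
    using perfect_branching[OF r'(1) empty_in_tree[OF closed_tree_perfect[OF r'(1)]] omega_less_lam] by blast
  then have "s \<in> Split r'"
    using Split_of_splitting omega_less_lam unfolding branching_def by blast
  then show False
    using r(3) r'(2,3) Split_mono by blast
qed

end

section \<open>Splitting-closed trees\<close>

context cardinal_tower
begin

definition scl_forcing :: "('o \<Rightarrow> 'o set \<Rightarrow> bool) \<Rightarrow> 'o node set set" where
  "scl_forcing \<Theta> = {p \<in> perfect_forcing \<Theta>. splitting_closed lam (branching \<Theta> p) p}"

lemma scl_perfect: "p \<in> scl_forcing \<Theta> \<Longrightarrow> p \<in> perfect_forcing \<Theta>"
  unfolding scl_forcing_def by blast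

lemma scl_forcing_cone:
  assumes p: "p \<in> scl_forcing \<Theta>" and t: "t \<in> p" shows "cone p t \<in> scl_forcing \<Theta>"
proof -
  note perfect = scl_perfect[OF p] and closed = closed_tree_perfect[OF scl_perfect[OF p]]
  have branching_cone: "branching \<Theta> (cone p t) \<alpha> s \<longleftrightarrow> branching \<Theta> p \<alpha> s" if "s \<in> p" "t \<subseteq>\<^sub>m s" for s \<alpha>
    using branching_cong[OF OSucc_cone[OF closed t that]] .
  have "splitting_closed lam (branching \<Theta> (cone p t)) (cone p t)"
    unfolding splitting_closed_iff[OF closed_tree_cone[OF closed t]]
  proof (intro allI ballI impI, elim conjE)
    fix \<delta> w u
    assume u: "u \<in> cone p t" and \<delta>: "\<delta> < lam" "is_limit \<delta>" and union: "seq_union {..<\<delta>} w u"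
      and w: "\<forall>\<alpha><\<delta>. w \<alpha> \<in> cone p t \<and> branching \<Theta> (cone p t) \<alpha> (w \<alpha>)"
      and increasing: "\<forall>\<alpha> \<beta>. \<alpha> < \<beta> \<and> \<beta> < \<delta> \<longrightarrow> w \<alpha> \<sqsubset> w \<beta>"
    have above: "w \<alpha> \<in> p" "t \<subseteq>\<^sub>m w \<alpha>" if "\<alpha> < \<delta>" for \<alpha>
    proof -
      have "w \<alpha> \<in> Split (cone p t)"
        using w that Split_of_splitting \<delta>(1) unfolding branching_def by (meson less_trans)
      then show "w \<alpha> \<in> p" "t \<subseteq>\<^sub>m w \<alpha>"
        using Split_subset cone_subset Split_cone[OF closed t] by blast+
    qed
    then have "\<forall>\<alpha><\<delta>. w \<alpha> \<in> p \<and> branching \<Theta> p \<alpha> (w \<alpha>)"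
      using w branching_cone by blast
    moreover have "splitting_closed lam (branching \<Theta> p) p"
      using p unfolding scl_forcing_def by blast
    moreover have "u \<in> p"
      using u cone_subset by blast
    ultimately have "branching \<Theta> p \<delta> u"
      unfolding splitting_closed_iff[OF closed] using \<delta> increasing union by blast
    moreover obtain \<alpha> where "\<alpha> < \<delta>"
      using \<delta>(2) unfolding is_limit_def by blast
    then have "t \<subseteq>\<^sub>m u"
      using above(2) union prefix_lessD(1) map_le_trans unfolding seq_union_def by blast
    ultimately show "branching \<Theta> (cone p t) \<delta> u"
      using branching_cone \<open>u \<in> p\<close> by blast
  qed
  then show ?thesis
    unfolding scl_forcing_def using perfect_forcing_cone[OF perfect t] by blast
qed

lemma tree_forcing_scl: "tree_forcing lam k (scl_forcing \<Theta>)"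
  by unfold_locales (use closed_tree_perfect scl_perfect scl_forcing_cone in blast)+

end

locale scl_tree = cardinal_tower lam k
  for lam :: "'o::wellorder" and k :: "'o \<Rightarrow> 'o" +
  fixes \<Theta> :: "'o \<Rightarrow> 'o set \<Rightarrow> bool" and p :: "'o node set"
  assumes scl: "p \<in> scl_forcing \<Theta>"
begin

sublocale indexed_tree lam k p "{s \<in> p. \<Theta> (len s) (OSucc p s)}"
  by (rule indexed_tree_perfect[OF scl_perfect[OF scl]])

lemma limit_of_Q_in_Q:
  assumes "u \<in> p" "is_limit (len u)" "\<And>\<beta>. \<beta> < len u \<Longrightarrow> \<exists>v\<in>Q. v \<sqsubset> u \<and> \<beta> < len v"
  shows "u \<in> Q"
proof (rule limit_in_Q[OF _ assms])
  have "splitting_closed lam (branching \<Theta> p) p"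
    using scl unfolding scl_forcing_def by blast
  then show "splitting_closed lam (\<lambda>\<alpha> t. splitting k p \<alpha> t \<and> t \<in> {s \<in> p. \<Theta> (len s) (OSucc p s)}) p"
    unfolding splitting_closed_iff[OF closed] branching_def by blast
qed

lemma seq_union_in_Q:
  assumes "u \<in> p" "I \<noteq> {}" "seq_union I w u" "\<And>i. i \<in> I \<Longrightarrow> w i \<in> Q" shows "u \<in> Q"
  using assms(1)
proof (rule limit_of_Q_in_Q)
  show "is_limit (len u)"
    using seq_union_is_limit[OF assms(3,2)] .
  show "\<exists>v\<in>Q. v \<sqsubset> u \<and> \<beta> < len v" if "\<beta> < len u" for \<beta>
    using assms(3,4) that unfolding seq_union_def by blast
qed

lemma branch_limit_in_Q:
  assumes b: "b \<in> branches p" and d: "d < lam" "is_limit d"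
    and cofinal: "\<And>x. x < d \<Longrightarrow> \<exists>y>x. y < d \<and> b |` {..<y} \<in> Q"
  shows "b |` {..<d} \<in> Q"
proof (rule limit_of_Q_in_Q)
  note node = branch_restrict[OF closed b]
  show "b |` {..<d} \<in> p" "is_limit (len (b |` {..<d}))"
    using node d by simp_all
  show "\<exists>v\<in>Q. v \<sqsubset> b |` {..<d} \<and> x < len v" if "x < len (b |` {..<d})" for x
  proof -
    have "x < d"
      using that node(2)[OF d(1)] by simp
    then obtain y where y: "x < y" "y < d" "b |` {..<y} \<in> Q"
      using cofinal by blast
    moreover have "b |` {..<y} \<sqsubset> b |` {..<d}"
      using b y(2) d(1) unfolding branches_def by (intro restrict_prefix_less_restrict) auto
    ultimately show ?thesis
      using node(2)[of y] d(1) by (intro bexI[of _ "b |` {..<y}"]) auto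
  qed
qed

lemma splitting_levels_contain_club: "\<exists>C. club_in C lam \<and> C \<subseteq> len ` Split p"
proof -
  have Y: "OSucc p s \<noteq> {} \<and> OSucc p s \<subseteq> OSucc p s" if "s \<in> Q" for s
    using OSucc_nonempty[OF closed] that Q_subset by blast
  have closed': "closed_tree (prune (OSucc p))"
    using Y by (rule closed_tree_prune)
  obtain b where b: "b \<in> branches (prune (OSucc p))"
    using branch_exists[OF closed' empty_in_tree[OF closed']] by blast
  then have bp: "b \<in> branches p"
    unfolding branches_def using prune_subset by blast
  define C where "C = {\<beta>. \<beta> < lam \<and> b |` {..<\<beta>} \<in> Q}"
  have "d \<in> C" if "d < lam" "is_limit d" "\<forall>x<d. \<exists>y\<in>C. x < y \<and> y < d" for d
    using branch_limit_in_Q[OF bp that(1,2)] that(1,3) unfolding C_def by blast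
  moreover have "\<exists>y\<in>C. x \<le> y" if "x < lam" for x
    using branch_meets_Q[OF Y b that] unfolding C_def by blast
  ultimately have "club_in C lam"
    unfolding club_in_def C_def by auto
  moreover have "C \<subseteq> len ` Split p"
  proof
    fix \<beta> assume "\<beta> \<in> C"
    then have "\<beta> = len (b |` {..<\<beta>})" "b |` {..<\<beta>} \<in> Split p"
      using branch_restrict(2)[OF closed bp] Q_subset_Split unfolding C_def by auto
    then show "\<beta> \<in> len ` Split p"
      by (rule image_eqI)
  qed
  ultimately show ?thesis
    by blast
qed

context
  fixes Y :: "'o node \<Rightarrow> 'o set"
  assumes Y: "\<And>s. s \<in> Q \<Longrightarrow> Y s \<noteq> {} \<and> Y s \<subseteq> OSucc p s"
begin

lemma branching_prune:
  assumes s: "s \<in> prune Y" "branching \<Theta> (prune Y) \<alpha> s" and "\<alpha> < lam"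
  shows "s \<in> Q" "branching \<Theta> p \<alpha> s"
proof -
  have "s \<in> Split (prune Y)"
    using Split_of_splitting[OF s(1) _ \<open>\<alpha> < lam\<close>] s(2) unfolding branching_def by blast
  then show "s \<in> Q"
    using Split_prune[OF Y] by blast
  have "|{..<k \<alpha>}| \<le>o |OSucc (prune Y) s|"
    using s(2) unfolding branching_def splitting_iff by blast
  then have "splitting k p \<alpha> s"
    unfolding splitting_iff using card_of_mono1[OF OSucc_mono[OF prune_subset]] ordLeq_transitive
    by blast
  then show "branching \<Theta> p \<alpha> s"
    using \<open>s \<in> Q\<close> Q_subset unfolding branching_def Q_def by blast
qed

lemma prune_scl:
  assumes large: "\<And>s. s \<in> Q \<Longrightarrow> \<Theta> (len s) (Y s) \<and> |OSucc p s| \<le>o |Y s|"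
  shows "prune Y \<in> scl_forcing \<Theta>"
proof -
  have closed': "closed_tree (prune Y)"
    using Y by (rule closed_tree_prune)
  have "prune Y \<in> perfect_forcing \<Theta>"
    using prune_perfect[OF Y] idx_unbounded[OF Y] large by blast
  moreover have "splitting_closed lam (branching \<Theta> (prune Y)) (prune Y)"
    unfolding splitting_closed_iff[OF closed']
  proof (intro allI ballI impI, elim conjE)
    fix \<delta> w u
    assume u: "u \<in> prune Y" and \<delta>: "\<delta> < lam" "is_limit \<delta>" and union: "seq_union {..<\<delta>} w u"
      and w: "\<forall>\<alpha><\<delta>. w \<alpha> \<in> prune Y \<and> branching \<Theta> (prune Y) \<alpha> (w \<alpha>)"
      and increasing: "\<forall>\<alpha> \<beta>. \<alpha> < \<beta> \<and> \<beta> < \<delta> \<longrightarrow> w \<alpha> \<sqsubset> w \<beta>"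
    have up: "u \<in> p"
      using u prune_subset by blast
    have wQ: "w \<alpha> \<in> Q" "w \<alpha> \<in> p \<and> branching \<Theta> p \<alpha> (w \<alpha>)" if "\<alpha> < \<delta>" for \<alpha>
      using branching_prune[of "w \<alpha>" \<alpha>] w that \<delta>(1) Q_subset by auto
    moreover have "splitting_closed lam (branching \<Theta> p) p"
      using scl unfolding scl_forcing_def by blast
    ultimately have "branching \<Theta> p \<delta> u"
      unfolding splitting_closed_iff[OF closed] using up \<delta> increasing union by blast
    have "{..<\<delta>} \<noteq> {}"
      using \<delta>(2) unfolding is_limit_def by blast
    then have "u \<in> Q"
      using seq_union_in_Q[OF up _ union] wQ(1) by simp
    then have OSucc: "OSucc (prune Y) u = Y u"
      using OSucc_prune[OF Y u] by simp
    have "|{..<k \<delta>}| \<le>o |Y u|"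
      using \<open>branching \<Theta> p \<delta> u\<close> large[OF \<open>u \<in> Q\<close>] ordLeq_transitive
      unfolding branching_def splitting_iff by blast
    then show "branching \<Theta> (prune Y) \<delta> u"
      unfolding branching_def splitting_iff OSucc using large[OF \<open>u \<in> Q\<close>] by blast
  qed
  ultimately show ?thesis
    unfolding scl_forcing_def by blast
qed

end

end

subsection \<open>Lowering the successors of splitting nodes\<close>

definition successor_descent :: "'o::wellorder node set \<Rightarrow> 'o node set \<Rightarrow> bool" where
  "successor_descent p r \<longleftrightarrow> (\<forall>s\<in>Split r. \<exists>e. \<forall>b\<in>OSucc r s. e b \<in> OSucc p s \<and> e b < b \<and>
     (\<forall>b'\<in>OSucc r s. b' < b \<longrightarrow> e b' < e b))"

lemma no_successor_descent_chain:
  assumes "\<And>n::nat. successor_descent (a n) (a (Suc n))" "\<And>n. s \<in> Split (a n)"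
  shows "\<exists>n. b \<notin> OSucc (a n) s"
proof -
  have "\<forall>n. \<exists>e. \<forall>b\<in>OSucc (a (Suc n)) s. e b \<in> OSucc (a n) s \<and> e b < b \<and>
     (\<forall>b'\<in>OSucc (a (Suc n)) s. b' < b \<longrightarrow> e b' < e b)"
    using assms unfolding successor_descent_def by blast
  then obtain e where "\<And>n b. b \<in> OSucc (a (Suc n)) s \<Longrightarrow> e n b \<in> OSucc (a n) s \<and> e n b < b \<and>
     (\<forall>b'\<in>OSucc (a (Suc n)) s. b' < b \<longrightarrow> e n b' < e n b)"
    by metis
  then show ?thesis
    by (intro no_infinite_regression[OF wfp_on_less, of "\<lambda>n. OSucc (a n) s" e]) blast+
qed

lemma (in guided_tree) successor_descent_prune:
  assumes nonempty: "\<And>s. s \<in> Q \<Longrightarrow> successor_elements (OSucc p s) \<noteq> {}" and "p \<subseteq> q"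
  shows "successor_descent q (prune (\<lambda>s. successor_elements (OSucc p s)))"
    (is "successor_descent q ?r")
  unfolding successor_descent_def
proof
  fix s assume s: "s \<in> Split ?r"
  have "successor_elements (OSucc p s) \<noteq> {} \<and> successor_elements (OSucc p s) \<subseteq> OSucc p s"
    if "s \<in> Q" for s
    using nonempty[OF that] unfolding successor_elements_def by blast
  then have "OSucc ?r s = successor_elements (OSucc p s)"
    using Split_prune[of "\<lambda>s. successor_elements (OSucc p s)" s] s by simp
  then have "\<exists>a. pred_in (OSucc p s) b a" if "b \<in> OSucc ?r s" for b
    using that unfolding successor_elements_def by blast
  then obtain e where e: "\<And>b. b \<in> OSucc ?r s \<Longrightarrow> pred_in (OSucc p s) b (e b)"
    by metis
  have "e b \<in> OSucc q s \<and> e b < b" if "b \<in> OSucc ?r s" for b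
    using e[OF that] OSucc_mono[OF \<open>p \<subseteq> q\<close>] unfolding pred_in_def by blast
  moreover have "e b' < e b" if "b \<in> OSucc ?r s" "b' \<in> OSucc ?r s" "b' < b" for b b'
    using pred_in_strict_mono[OF e e] that OSucc_mono[OF prune_subset] by blast
  ultimately show "\<exists>e. \<forall>b\<in>OSucc ?r s. e b \<in> OSucc q s \<and> e b < b \<and>
      (\<forall>b'\<in>OSucc ?r s. b' < b \<longrightarrow> e b' < e b)"
    by blast
qed

context cardinal_tower
begin

lemma successor_descent_dense:
  assumes r: "r \<in> scl_forcing (\<lambda>_ _. True)" and "r \<subseteq> p"
  shows "\<exists>r'\<in>scl_forcing (\<lambda>_ _. True). r' \<subseteq> r \<and> successor_descent p r'"
proof -
  interpret scl_tree lam k "\<lambda>_ _. True" r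
    by unfold_locales (rule r)
  let ?Y = "\<lambda>s. successor_elements (OSucc r s)"
  have card: "|OSucc r s| \<le>o |?Y s|" "infinite (?Y s)" if "s \<in> Q" for s
  proof -
    have "infinite (OSucc r s)"
      using infinite_OSucc_of_splitting Q_splitting idx_less_lam Q_subset that by blast
    then show "|OSucc r s| \<le>o |?Y s|"
      by (rule card_of_successor_elements)
    then show "infinite (?Y s)"
      using \<open>infinite (OSucc r s)\<close> by (rule card_of_ordLeq_infinite)
  qed
  have nonempty: "?Y s \<noteq> {}" if "s \<in> Q" for s
    using infinite_imp_nonempty[OF card(2)[OF that]] .
  moreover have "?Y s \<subseteq> OSucc r s" for s
    unfolding successor_elements_def by blast
  ultimately have "prune ?Y \<in> scl_forcing (\<lambda>_ _. True)"
    using prune_scl[of ?Y] card(1) by blast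
  moreover have "successor_descent p (prune ?Y)"
    using nonempty \<open>r \<subseteq> p\<close> by (rule successor_descent_prune)
  ultimately show ?thesis
    using prune_subset by blast
qed

theorem scl_forcing_adds_new_function:
  "adds_new_function (scl_forcing (\<lambda>_ _. True)) (\<subseteq>) {..<lam} {0, 1 :: nat}"
proof (rule tree_forcing.adds_new_function_of_descent[OF tree_forcing_scl, of _ successor_descent])
  show "\<exists>r'\<in>scl_forcing (\<lambda>_ _. True). r' \<subseteq> r \<and> successor_descent p r'"
    if "r \<in> scl_forcing (\<lambda>_ _. True)" "r \<subseteq> p" for p r
    using that by (rule successor_descent_dense)
next
  fix a :: "nat \<Rightarrow> _" and s t :: "'o node"
  assume a: "\<And>n. a n \<in> scl_forcing (\<lambda>_ _. True)" "\<And>n. successor_descent (a n) (a (Suc n))"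
    "\<And>n. s \<in> Split (a n)" "\<And>n. t \<in> a n" and "s \<sqsubset> t"
  then have "the (t (len s)) \<in> OSucc (a n) s" for n
    using value_in_OSucc closed_tree_perfect scl_perfect by blast
  then show False
    using no_successor_descent_chain[of a s] a(2,3) by blast
next
  fix q and A :: "nat \<Rightarrow> 'o set"
  assume q: "q \<in> scl_forcing (\<lambda>_ _. True)" and empty: "\<And>\<beta>. \<beta> < lam \<Longrightarrow> \<exists>n. \<beta> \<notin> A n"
    and dense: "\<And>n r. r \<in> scl_forcing (\<lambda>_ _. True) \<Longrightarrow> r \<subseteq> q \<Longrightarrow>
      \<exists>r'\<in>scl_forcing (\<lambda>_ _. True). r' \<subseteq> r \<and> (\<forall>s\<in>Split r'. len s \<in> A n)"
  have "\<exists>C. club_in C lam \<and> C \<subseteq> A n" for n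
  proof -
    obtain r' where r': "r' \<in> scl_forcing (\<lambda>_ _. True)" "\<forall>s\<in>Split r'. len s \<in> A n"
      using dense[OF q] by blast
    interpret scl_tree lam k "\<lambda>_ _. True" r'
      by unfold_locales (rule r'(1))
    show ?thesis
      using splitting_levels_contain_club r'(2) by blast
  qed
  then obtain C where C: "\<And>n. club_in (C n) lam" "\<And>n. C n \<subseteq> A n"
    by metis
  then obtain \<beta> where "\<beta> < lam" "\<forall>n. \<beta> \<in> C n"
    using countably_many_clubs_intersect by blast
  then show False
    using empty C(2) by blast
qed

end

section \<open>Scales modulo finite sets\<close>

text \<open>
  A maximal chain of functions modulo finite is unbounded. Families of size continuum are bounded,
  so the chain has larger cofinality and the sets on which it exceeds a given function stabilise
  modulo finite. Among these limit sets there is a least one: on it the chain is a scale.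
\<close>

definition eventually_le :: "(nat \<Rightarrow> 'o::linorder) \<Rightarrow> (nat \<Rightarrow> 'o) \<Rightarrow> bool" (infix "\<le>\<^sup>*" 50) where
  "f \<le>\<^sup>* g \<longleftrightarrow> (\<forall>\<^sub>\<infinity>n. f n \<le> g n)"

definition almost_subset :: "nat set \<Rightarrow> nat set \<Rightarrow> bool" (infix "\<subseteq>\<^sup>*" 50) where
  "A \<subseteq>\<^sup>* B \<longleftrightarrow> finite (A - B)"

definition exceeds :: "(nat \<Rightarrow> 'o::linorder) \<Rightarrow> (nat \<Rightarrow> 'o) \<Rightarrow> nat set" where
  "exceeds f g = {n. g n < f n}"

abbreviation prod_below :: "(nat \<Rightarrow> 'o::linorder) \<Rightarrow> (nat \<Rightarrow> 'o) set" where
  "prod_below K \<equiv> (\<Pi> n\<in>UNIV. {..<K n})"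

definition is_scale :: "(nat \<Rightarrow> 'o::linorder) \<Rightarrow> nat set \<Rightarrow> (nat \<Rightarrow> 'o) set \<Rightarrow> bool" where
  "is_scale K B F \<longleftrightarrow> F \<subseteq> prod_below K \<and> (\<forall>f\<in>F. \<forall>g\<in>F. f \<le>\<^sup>* g \<or> g \<le>\<^sup>* f) \<and>
     (\<forall>g\<in>prod_below K. \<exists>f\<in>F. \<forall>\<^sub>\<infinity>n. n \<in> B \<longrightarrow> g n < f n)"

lemma eventually_le_iff_finite: "f \<le>\<^sup>* g \<longleftrightarrow> finite (exceeds f g)"
  unfolding eventually_le_def exceeds_def eventually_cofinite by (simp add: not_le)

lemma eventually_le_trans_le: "f \<le>\<^sup>* g \<Longrightarrow> (\<And>n. g n \<le> h n) \<Longrightarrow> f \<le>\<^sup>* h"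
  unfolding eventually_le_def by (erule eventually_mono) (rule order_trans)

lemma almost_subset_trans: "A \<subseteq>\<^sup>* B \<Longrightarrow> B \<subseteq>\<^sup>* C \<Longrightarrow> A \<subseteq>\<^sup>* C"
  unfolding almost_subset_def by (rule finite_subset[of _ "(A - B) \<union> (B - C)"]) auto

lemma subset_imp_almost_subset: "A \<subseteq> B \<Longrightarrow> A \<subseteq>\<^sup>* B"
  unfolding almost_subset_def by (metis Diff_eq_empty_iff finite.emptyI)

lemma exceeds_almost_mono:
  assumes "f \<le>\<^sup>* f'" shows "exceeds f g \<subseteq>\<^sup>* exceeds f' g"
proof -
  have "exceeds f g - exceeds f' g \<subseteq> exceeds f f'"
    unfolding exceeds_def by force
  then show ?thesis
    using assms finite_subset unfolding almost_subset_def eventually_le_iff_finite by blast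
qed

context
  fixes K :: "nat \<Rightarrow> 'o::wellorder"
  assumes regular: "\<And>n. regular_infinite_cardinal (K n)"
begin

lemma prod_below_strict_upper_bound:
  assumes h: "h \<in> prod_below K"
  obtains h' where "h' \<in> prod_below K" "\<And>n. h n < h' n"
proof -
  have "\<exists>y<K n. h n < y" for n
    using is_limitD[OF is_limit_regular_cardinal[OF regular]] h by blast
  then obtain h' where "\<And>n. h' n < K n \<and> h n < h' n"
    by metis
  then show ?thesis
    using that[of h'] by blast
qed

lemma maximal_chain_unbounded:
  obtains F where "F \<subseteq> prod_below K" "\<And>f g. f \<in> F \<Longrightarrow> g \<in> F \<Longrightarrow> f \<le>\<^sup>* g \<or> g \<le>\<^sup>* f"
    "\<And>h. h \<in> prod_below K \<Longrightarrow> \<exists>f\<in>F. \<not> f \<le>\<^sup>* h"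
proof -
  interpret pred_on "prod_below K" "(\<le>\<^sup>*)" .
  obtain F where F: "maxchain F"
    using Hausdorff by blast
  have sub: "F \<subseteq> prod_below K"
    using F unfolding maxchain_def chain_def by blast
  have refl: "f \<le>\<^sup>* f" for f :: "nat \<Rightarrow> 'o"
    unfolding eventually_le_def by simp
  have chain: "f \<le>\<^sup>* g \<or> g \<le>\<^sup>* f" if "f \<in> F" "g \<in> F" for f g
    using chain_total[OF maxchain_imp_chain[OF F] that] refl by auto
  have "\<exists>f\<in>F. \<not> f \<le>\<^sup>* h" if h: "h \<in> prod_below K" for h
  proof (rule ccontr)
    assume "\<not> (\<exists>f\<in>F. \<not> f \<le>\<^sup>* h)"
    then have le_h: "f \<le>\<^sup>* h" if "f \<in> F" for f
      using that by blast
    obtain h' where h': "h' \<in> prod_below K" "\<And>n. h n < h' n"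
      using prod_below_strict_upper_bound[OF h] by blast
    have "f \<le>\<^sup>* h'" if "f \<in> F" for f
      using eventually_le_trans_le[OF le_h[OF that]] h'(2) less_imp_le by blast
    then have "pred_on.chain (prod_below K) (\<le>\<^sup>*) (insert h' F)"
      unfolding chain_def using sub h'(1) by (auto dest: chain)
    then have "h' \<in> F"
      using F unfolding maxchain_def by blast
    then have "finite (exceeds h' h)"
      using le_h unfolding eventually_le_iff_finite by blast
    then show False
      using h'(2) unfolding exceeds_def by simp
  qed
  with sub chain show ?thesis
    using that by blast
qed

context
  assumes continuum: "\<And>n. |UNIV :: nat set set| <o |{..<K n}|"
begin

lemma bounded_representatives:
  fixes V :: "(nat \<Rightarrow> 'o) \<Rightarrow> nat set"
  assumes X: "X \<subseteq> prod_below K"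
  obtains h where "h \<in> prod_below K" "\<And>x. x \<in> X \<Longrightarrow> \<exists>y\<in>X. V y = V x \<and> (\<forall>n. y n < h n)"
proof -
  obtain R where R: "R \<subseteq> X" "inj_on V R" "V ` R = V ` X"
    using subset_image_inj[of "V ` X" V X] by auto
  have "|R| \<le>o |UNIV :: nat set set|"
    using R(2) by (intro card_of_ordLeqI[of V]) auto
  have "\<exists>z<K n. \<forall>x\<in>(\<lambda>y. y n) ` R. x < z" for n
  proof (rule regular_cardinal_bounded[OF regular])
    show "(\<lambda>y. y n) ` R \<subseteq> {..<K n}"
      using R(1) X by blast
    show "|(\<lambda>y. y n) ` R| <o |{..<K n}|"
      using card_of_image \<open>|R| \<le>o _\<close> continuum ordLeq_transitive ordLeq_ordLess_trans by blast
  qed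
  then obtain h where h: "\<And>n. h n < K n" "\<And>n y. y \<in> R \<Longrightarrow> y n < h n"
    by (metis imageI)
  have "\<exists>y\<in>X. V y = V x \<and> (\<forall>n. y n < h n)" if "x \<in> X" for x
  proof -
    have "V x \<in> V ` R"
      unfolding R(3) using that by (rule imageI)
    then show ?thesis
      using R(1) h(2) by auto
  qed
  with h(1) show ?thesis
    using that[of h] by blast
qed

context
  fixes F
  assumes F: "F \<subseteq> prod_below K" and chain: "\<And>f g. f \<in> F \<Longrightarrow> g \<in> F \<Longrightarrow> f \<le>\<^sup>* g \<or> g \<le>\<^sup>* f"
    and unbounded: "\<And>h. h \<in> prod_below K \<Longrightarrow> \<exists>f\<in>F. \<not> f \<le>\<^sup>* h"
begin

lemma exceeds_stabilises: "\<exists>f\<in>F. \<forall>f'\<in>F. exceeds f' g \<subseteq>\<^sup>* exceeds f g"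
proof -
  obtain h where h: "h \<in> prod_below K"
    "\<And>f. f \<in> F \<Longrightarrow> \<exists>f'\<in>F. exceeds f' g = exceeds f g \<and> (\<forall>n. f' n < h n)"
    using bounded_representatives[OF F, of "\<lambda>f. exceeds f g"] by blast
  obtain f where f: "f \<in> F" "\<not> f \<le>\<^sup>* h"
    using unbounded[OF h(1)] by blast
  have "exceeds f1 g \<subseteq>\<^sup>* exceeds f g" if "f1 \<in> F" for f1
  proof -
    obtain f' where f': "f' \<in> F" "exceeds f' g = exceeds f1 g" "\<And>n. f' n < h n"
      using h(2)[OF \<open>f1 \<in> F\<close>] by blast
    have "\<not> f \<le>\<^sup>* f'"
      using f(2) f'(3) eventually_le_trans_le less_imp_le by blast
    then have "f' \<le>\<^sup>* f"
      using chain f(1) f'(1) by blast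
    then show ?thesis
      using exceeds_almost_mono f'(2) by metis
  qed
  with f(1) show ?thesis by blast
qed

lemma is_scale_on_infinite_set: "\<exists>B. infinite B \<and> is_scale K B F"
proof -
  obtain top where top: "\<And>g. top g \<in> F" "\<And>g f. f \<in> F \<Longrightarrow> exceeds f g \<subseteq>\<^sup>* exceeds (top g) g"
    using exceeds_stabilises by metis
  define limit where "limit g = exceeds (top g) g" for g
  obtain h where h: "h \<in> prod_below K"
    "\<And>g. g \<in> prod_below K \<Longrightarrow> \<exists>g'\<in>prod_below K. limit g' = limit g \<and> (\<forall>n. g' n < h n)"
    using bounded_representatives[OF subset_refl, of limit] by blast
  have least: "limit h \<subseteq>\<^sup>* limit g" if g: "g \<in> prod_below K" for g
  proof -
    obtain g' where g': "limit g' = limit g" "\<And>n. g' n < h n"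
      using h(2)[OF g] by blast
    then have "limit h \<subseteq> exceeds (top h) g'"
      unfolding limit_def exceeds_def using less_trans by blast
    then show ?thesis
      using almost_subset_trans[OF subset_imp_almost_subset top(2)[OF top(1)]] g'(1)
      unfolding limit_def by metis
  qed
  have "infinite (limit h)"
  proof
    assume "finite (limit h)"
    then have "f \<le>\<^sup>* h" if "f \<in> F" for f
      using top(2)[OF that, of h] unfolding eventually_le_iff_finite almost_subset_def limit_def
      by (metis finite_Diff2)
    then show False
      using unbounded[OF h(1)] by blast
  qed
  moreover have "\<forall>\<^sub>\<infinity>n. n \<in> limit h \<longrightarrow> g n < top g n" if "g \<in> prod_below K" for g
    using least[OF that] unfolding almost_subset_def eventually_cofinite limit_def[of g] exceeds_def
    by (rule rev_finite_subset) auto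
  ultimately show ?thesis
    unfolding is_scale_def using F chain top(1) by blast
qed

end

theorem is_scale_exists: obtains B F where "infinite B" "is_scale K B F"
  using maximal_chain_unbounded is_scale_on_infinite_set by metis

end

end

lemma infinite_splits:
  assumes "infinite (B :: nat set)" obtains A where "A \<subseteq> B" "infinite A" "infinite (B - A)"
proof -
  obtain C :: "nat \<Rightarrow> nat set" where C: "pairwise (\<lambda>i j. disjnt (C i) (C j)) UNIV" "(\<Union>i. C i) \<subseteq> B"
    "\<And>i. infinite (C i)"
    using infinite_infinite_partition[OF assms] by blast
  then have "C 1 \<subseteq> B - C 0"
    unfolding pairwise_def disjnt_def by fastforce
  then show ?thesis
    using that[of "C 0"] C finite_subset by blast
qed

section \<open>Laver trees\<close>

context cardinal_tower
begin

definition laver_forcing :: "('o \<Rightarrow> 'o set \<Rightarrow> bool) \<Rightarrow> 'o node set set" where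
  "laver_forcing \<Theta> = {p. closed_tree p \<and>
     (\<exists>s. laver_stem lam k p s \<and> (\<forall>t\<in>p. s \<subseteq>\<^sub>m t \<longrightarrow> \<Theta> (len t) (OSucc p t)))}"

lemma closed_tree_laver: "p \<in> laver_forcing \<Theta> \<Longrightarrow> closed_tree p"
  unfolding laver_forcing_def by blast

lemma laver_stem_iff:
  "laver_stem lam k p s \<longleftrightarrow> s \<in> p \<and> (\<forall>t\<in>p. s \<subseteq>\<^sub>m t \<or> t \<subseteq>\<^sub>m s) \<and>
     (\<forall>t\<in>p. s \<subseteq>\<^sub>m t \<longrightarrow> |OSucc p t| =o |{..<k (len t)}| )"
  unfolding laver_stem_def
  using ordIso_transitive[OF card_of_Succ] ordIso_transitive[OF ordIso_symmetric[OF card_of_Succ]]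
  by blast

lemma laver_forcing_cone:
  assumes p: "p \<in> laver_forcing \<Theta>" and t: "t \<in> p" shows "cone p t \<in> laver_forcing \<Theta>"
proof -
  note closed = closed_tree_laver[OF p]
  obtain s where s: "s \<in> p" "\<And>u. u \<in> p \<Longrightarrow> s \<subseteq>\<^sub>m u \<or> u \<subseteq>\<^sub>m s"
    "\<And>u. u \<in> p \<Longrightarrow> s \<subseteq>\<^sub>m u \<Longrightarrow> |OSucc p u| =o |{..<k (len u)}|"
    "\<And>u. u \<in> p \<Longrightarrow> s \<subseteq>\<^sub>m u \<Longrightarrow> \<Theta> (len u) (OSucc p u)"
    using p unfolding laver_forcing_def laver_stem_iff by blast
  obtain s' where s': "s' \<in> cone p t" "s \<subseteq>\<^sub>m s'" "t \<subseteq>\<^sub>m s'"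
    "\<And>u. u \<in> cone p t \<Longrightarrow> s' \<subseteq>\<^sub>m u \<or> u \<subseteq>\<^sub>m s'"
  proof (cases "s \<subseteq>\<^sub>m t")
    case True
    then show ?thesis
      using that[of t] t unfolding cone_def by auto
  next
    case False
    then show ?thesis
      using that[of s] s(1,2) t unfolding cone_def by auto
  qed
  have "|OSucc (cone p t) u| =o |{..<k (len u)}|" "\<Theta> (len u) (OSucc (cone p t) u)"
    if u: "u \<in> cone p t" "s' \<subseteq>\<^sub>m u" for u
  proof -
    have "u \<in> p" "t \<subseteq>\<^sub>m u" "s \<subseteq>\<^sub>m u"
      using u cone_subset s'(2,3) map_le_trans by blast+
    then show "|OSucc (cone p t) u| =o |{..<k (len u)}|" "\<Theta> (len u) (OSucc (cone p t) u)"
      using s(3,4) OSucc_cone[OF closed t] by auto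
  qed
  then show ?thesis
    unfolding laver_forcing_def laver_stem_iff using closed_tree_cone[OF closed t] s'(1,4) by blast
qed

lemma tree_forcing_laver: "tree_forcing lam k (laver_forcing \<Theta>)"
  by unfold_locales (use closed_tree_laver laver_forcing_cone in blast)+

subsection \<open>Levels above a node\<close>

definition nth_next :: "'o \<Rightarrow> nat \<Rightarrow> 'o" where
  "nth_next \<gamma> n = (next_ord ^^ n) \<gamma>"

definition level :: "'o node set \<Rightarrow> 'o node \<Rightarrow> nat \<Rightarrow> 'o node set" where
  "level p s n = {t \<in> p. s \<subseteq>\<^sub>m t \<and> len t = nth_next (len s) n}"

definition level_cardinal :: "'o \<Rightarrow> nat \<Rightarrow> 'o" where
  "level_cardinal \<gamma> n = k (nth_next \<gamma> n)"

lemma nth_next_0: "nth_next \<gamma> 0 = \<gamma>"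
  unfolding nth_next_def by simp

lemma nth_next_Suc: "nth_next \<gamma> (Suc n) = next_ord (nth_next \<gamma> n)"
  unfolding nth_next_def by simp

lemma nth_next_lam: "\<gamma> < lam \<Longrightarrow> nth_next \<gamma> n < lam"
  by (induction n) (simp_all add: nth_next_0 nth_next_Suc next_ord_lam)

lemma nth_next_less_Suc: "\<gamma> < lam \<Longrightarrow> nth_next \<gamma> n < nth_next \<gamma> (Suc n)"
  unfolding nth_next_Suc by (rule less_next_ord[OF nth_next_lam])

lemma le_nth_next: "\<gamma> < lam \<Longrightarrow> \<gamma> \<le> nth_next \<gamma> n"
proof (induction n)
  case (Suc n)
  then show ?case
    using nth_next_less_Suc[OF Suc.prems, of n] by simp
qed (simp add: nth_next_0)

lemma level_cardinal_regular: "\<gamma> < lam \<Longrightarrow> regular_infinite_cardinal (level_cardinal \<gamma> n)"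
  unfolding level_cardinal_def by (rule k_regular[OF nth_next_lam])

lemma level_cardinal_less_Suc:
  assumes "\<gamma> < lam" shows "|{..<level_cardinal \<gamma> n}| <o |{..<level_cardinal \<gamma> (Suc n)}|"
proof (rule card_of_lessThan_ordLess)
  show "Card_order (ord_rel (level_cardinal \<gamma> (Suc n)))"
    using Card_order_regular_cardinal level_cardinal_regular[OF assms] .
  show "level_cardinal \<gamma> n < level_cardinal \<gamma> (Suc n)"
    unfolding level_cardinal_def
    using strict_mono_onD[OF k_strict_mono] nth_next_lam[OF assms] nth_next_less_Suc[OF assms]
    by simp
qed

context
  fixes p s
  assumes p: "closed_tree p" and s: "s \<in> p"
begin

lemma level_0: "level p s 0 \<subseteq> {s}"
  unfolding level_def nth_next_0 using seq_le_len_eq[of s] tree_is_seq[OF p] s by fastforce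

lemma level_Suc:
  "level p s (Suc n) \<subseteq> (\<lambda>(t, b). t \<frown> b) ` (level p s n \<times> {..<level_cardinal (len s) n})"
proof
  fix t assume "t \<in> level p s (Suc n)"
  then have t: "t \<in> p" "s \<subseteq>\<^sub>m t" "len t = next_ord (nth_next (len s) n)"
    unfolding level_def nth_next_Suc by blast+
  note seq = tree_is_seq[OF p]
  let ?\<beta> = "nth_next (len s) n"
  have \<beta>: "?\<beta> < lam" "len s \<le> ?\<beta>" "?\<beta> < len t"
    using nth_next_lam le_nth_next nth_next_less_Suc tree_len_less[OF p s]
    unfolding t(3) nth_next_Suc by simp_all
  have len: "len (t |` {..<?\<beta>}) = ?\<beta>"
    using len_restrict[OF seq[OF t(1)]] \<beta>(3) by simp
  have "s \<subseteq>\<^sub>m t |` {..<?\<beta>}"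
    using seq_le_of_len_le[OF seq[OF s] _ seq[OF t(1)] t(2) restrict_lessThan_map_le]
      is_seq_restrict[OF seq[OF t(1)]] \<beta> len by simp
  then have "t |` {..<?\<beta>} \<in> level p s n"
    unfolding level_def using tree_restrict[OF p t(1)] len by blast
  moreover have "the (t ?\<beta>) < level_cardinal (len s) n"
    unfolding level_cardinal_def using tree_value_less[OF p t(1) \<beta>(3)] .
  moreover have "t = t |` {..<?\<beta>} \<frown> the (t ?\<beta>)"
    using restrict_next_ord[OF seq[OF t(1)] \<beta>(3) seq_value[OF seq[OF t(1)] \<beta>(3)]]
    unfolding t(3)[symmetric] restrict_all[OF seq[OF t(1)] order_refl] .
  ultimately show "t \<in> (\<lambda>(t, b). t \<frown> b) ` (level p s n \<times> {..<level_cardinal (len s) n})"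
    by (intro image_eqI[of _ _ "(t |` {..<?\<beta>}, the (t ?\<beta>))"]) auto
qed

lemma card_of_level: "|level p s n| <o |{..<level_cardinal (len s) n}|"
proof (induction n)
  case 0
  have "finite (level p s 0)"
    using level_0 finite_subset by blast
  then show ?case
    using card_of_finite_ordLess_infinite infinite_regular_cardinal level_cardinal_regular
      tree_len_less[OF p s]
    by blast
next
  case (Suc n)
  let ?K = "{..<level_cardinal (len s) n}"
  have "infinite (Field |?K| )"
    unfolding Field_card_of
    using infinite_regular_cardinal level_cardinal_regular tree_len_less[OF p s] by blast
  then have "|level p s n \<times> ?K| \<le>o |?K|"
    using ordLess_imp_ordLeq[OF Suc] card_of_mono1[OF subset_refl] card_of_Card_order
    by (rule card_of_Times_ordLeq_infinite_Field)
  then have "|level p s (Suc n)| \<le>o |?K|"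
    by (rule ordLeq_transitive[OF ordLeq_transitive[OF card_of_mono1[OF level_Suc] card_of_image]])
  then show ?case
    using level_cardinal_less_Suc tree_len_less[OF p s] ordLeq_ordLess_trans by blast
qed

lemma successors_bounded_on_levels:
  obtains g where "g \<in> prod_below (level_cardinal (len s))"
    "\<And>n t. t \<in> level p s n \<Longrightarrow> \<exists>b\<in>OSucc p t. b < g n"
proof -
  define m where "m t = (SOME b. b \<in> OSucc p t)" for t
  have m: "m t \<in> OSucc p t" if "t \<in> p" for t
    unfolding m_def using OSucc_nonempty[OF p that] by (simp add: some_in_eq)
  have "\<exists>z<level_cardinal (len s) n. \<forall>x\<in>m ` level p s n. x < z" for n
  proof (rule regular_cardinal_bounded)
    show "regular_infinite_cardinal (level_cardinal (len s) n)"
      using level_cardinal_regular tree_len_less[OF p s] .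
    show "m ` level p s n \<subseteq> {..<level_cardinal (len s) n}"
      using OSucc_less[OF p _ m] unfolding level_def level_cardinal_def by force
    show "|m ` level p s n| <o |{..<level_cardinal (len s) n}|"
      using card_of_image card_of_level by (rule ordLeq_ordLess_trans)
  qed
  then obtain g where "\<And>n. g n < level_cardinal (len s) n" "\<And>n t. t \<in> level p s n \<Longrightarrow> m t < g n"
    by (metis imageI)
  then show ?thesis
    using that[of g] m unfolding level_def by blast
qed

end

subsection \<open>Sets realised by a node\<close>

definition realises :: "'o \<Rightarrow> nat set \<Rightarrow> (nat \<Rightarrow> 'o) \<Rightarrow> nat set \<Rightarrow> 'o node \<Rightarrow> bool" where
  "realises \<gamma> B f A u \<longleftrightarrow> (\<forall>\<^sub>\<infinity>n. n \<in> B \<longrightarrow> (n \<in> A \<longleftrightarrow> f n \<le> the (u (nth_next \<gamma> n))))"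

context
  fixes p :: "'o node set" and s :: "'o node" and f g :: "nat \<Rightarrow> 'o"
  assumes p: "closed_tree p" and s: "s \<in> p"
    and full: "\<And>t. t \<in> p \<Longrightarrow> s \<subseteq>\<^sub>m t \<Longrightarrow> |{..<k (len t)}| \<le>o |OSucc p t|"
    and f: "f \<in> prod_below (level_cardinal (len s))"
    and g: "\<And>n t. t \<in> level p s n \<Longrightarrow> \<exists>b\<in>OSucc p t. b < g n"
begin

lemma level_extension:
  assumes "t \<in> level p s n"
  shows "\<exists>b. t \<frown> b \<in> level p s (Suc n) \<and> (if n \<in> A then f n \<le> b else b < g n)"
proof -
  have t: "t \<in> p" "s \<subseteq>\<^sub>m t" "len t = nth_next (len s) n"
    using assms unfolding level_def by blast+
  have "OSucc p t \<subseteq> {..<k (len t)}"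
    using OSucc_less[OF p t(1)] by blast
  then have "\<forall>x<k (len t). \<exists>b\<in>OSucc p t. x \<le> b"
    using regular_cardinal_unbounded_iff[OF k_regular[OF tree_len_less[OF p t(1)]]] full[OF t(1,2)]
    by blast
  moreover have "f n < k (len t)"
    using f unfolding level_cardinal_def t(3) by blast
  ultimately obtain b where b: "b \<in> OSucc p t" "if n \<in> A then f n \<le> b else b < g n"
    using g[OF assms] by (cases "n \<in> A") auto
  have "t \<frown> b \<in> level p s (Suc n)"
    using b(1) map_le_trans[OF t(2) prefix_lessD(1)[OF tree_snoc(3)[OF p t(1)]]]
      tree_snoc(2)[OF p t(1)]
    unfolding level_def OSucc_def nth_next_Suc t(3) by blast
  with b(2) show ?thesis
    by blast
qed

lemma laver_node_realising:
  assumes less: "\<forall>\<^sub>\<infinity>n. n \<in> B \<longrightarrow> g n < f n"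
  shows "\<exists>u\<in>p. len u = strict_sup UNIV (nth_next (len s)) \<and> realises (len s) B f A u"
proof -
  have "\<exists>T. \<forall>n. T n \<in> level p s n \<and> (\<exists>b. T (Suc n) = T n \<frown> b \<and>
    (if n \<in> A then f n \<le> b else b < g n))"
  proof (rule dependent_nat_choice)
    show "\<exists>t. t \<in> level p s 0"
      using s unfolding level_def nth_next_0 by auto
  qed (use level_extension in blast)
  then obtain T b where T: "\<And>n. T n \<in> level p s n" "\<And>n. T (Suc n) = T n \<frown> b n"
    and b: "\<And>n. if n \<in> A then f n \<le> b n else b n < g n"
    by metis
  have node: "T n \<in> p" "len (T n) = nth_next (len s) n" for n
    using T(1) unfolding level_def by blast+
  have "T n \<sqsubset> T (Suc n)" for n
    unfolding T(2) by (rule tree_snoc(3)[OF p node(1)])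
  then obtain u where u: "u \<in> p" "len u = strict_sup UNIV (nth_next (len s))" "\<And>n. T n \<sqsubset> u"
    using tree_countable_union[OF p, of T] node by auto
  have "u (nth_next (len s) n) = Some (b n)" for n
    using snoc_le_iff[OF tree_is_seq[OF p node(1)] prefix_lessD(1)[OF u(3)]]
      prefix_lessD(1)[OF u(3)]
      T(2) node(2) by metis
  then have "n \<in> B \<longrightarrow> (n \<in> A \<longleftrightarrow> f n \<le> the (u (nth_next (len s) n)))" if "n \<in> B \<longrightarrow> g n < f n" for n
    using that b[of n] by (auto split: if_splits)
  then have "realises (len s) B f A u"
    unfolding realises_def using less by (rule eventually_mono[rotated])
  with u(1,2) show ?thesis
    by blast
qed

end

lemma laver_scale_function_realises_all:
  assumes p: "closed_tree p" and s: "s \<in> p"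
    and full: "\<And>t. t \<in> p \<Longrightarrow> s \<subseteq>\<^sub>m t \<Longrightarrow> |{..<k (len t)}| \<le>o |OSucc p t|"
    and scale: "is_scale (level_cardinal (len s)) B F"
  shows "\<exists>f\<in>F. \<forall>X. \<exists>u\<in>p. len u = strict_sup UNIV (nth_next (len s)) \<and> realises (len s) B f X u"
proof -
  obtain g where g: "g \<in> prod_below (level_cardinal (len s))"
    "\<And>n t. t \<in> level p s n \<Longrightarrow> \<exists>b\<in>OSucc p t. b < g n"
    using successors_bounded_on_levels[OF p s] by blast
  obtain f where f: "f \<in> F" "f \<in> prod_below (level_cardinal (len s))" "\<forall>\<^sub>\<infinity>n. n \<in> B \<longrightarrow> g n < f n"
    using scale g(1) unfolding is_scale_def by blast
  have "\<exists>u\<in>p. len u = strict_sup UNIV (nth_next (len s)) \<and> realises (len s) B f X u" for X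
    using laver_node_realising[OF p s full f(2) g(2) f(3)] .
  with f(1) show ?thesis
    by blast
qed

lemma realises_unique:
  assumes "f \<le>\<^sup>* f' \<or> f' \<le>\<^sup>* f" "A \<subseteq> B" "infinite A" "infinite (B - A)"
    and "realises \<gamma> B f (B - A) v"
  shows "\<not> realises \<gamma> B f' A v"
proof
  assume "realises \<gamma> B f' A v"
  with assms(5) have realised: "\<forall>\<^sub>\<infinity>n. (n \<in> B \<longrightarrow> (n \<in> B - A \<longleftrightarrow> f n \<le> the (v (nth_next \<gamma> n)))) \<and>
      (n \<in> B \<longrightarrow> (n \<in> A \<longleftrightarrow> f' n \<le> the (v (nth_next \<gamma> n))))"
    unfolding realises_def by (rule eventually_conj)
  from assms(1) show False
  proof
    assume "f \<le>\<^sup>* f'"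
    with realised have "\<forall>\<^sub>\<infinity>n. n \<notin> A"
      unfolding eventually_le_def by eventually_elim (use assms(2) order_trans in blast)
    then show False
      using assms(3) unfolding eventually_cofinite by simp
  next
    assume "f' \<le>\<^sup>* f"
    with realised have "\<forall>\<^sub>\<infinity>n. n \<notin> B - A"
      unfolding eventually_le_def by eventually_elim (use order_trans in blast)
    then show False
      using assms(4) unfolding eventually_cofinite by (simp add: set_diff_eq)
  qed
qed

lemma laver_full_above:
  assumes p: "p \<in> laver_forcing \<Theta>" and "\<gamma> < lam"
  obtains s where "s \<in> p" "\<gamma> \<le> len s" "\<And>t. t \<in> p \<Longrightarrow> s \<subseteq>\<^sub>m t \<Longrightarrow> |{..<k (len t)}| \<le>o |OSucc p t|"
proof -
  note closed = closed_tree_laver[OF p]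
  obtain s0 where s0: "s0 \<in> p" "\<And>u. u \<in> p \<Longrightarrow> s0 \<subseteq>\<^sub>m u \<Longrightarrow> |OSucc p u| =o |{..<k (len u)}|"
    using p unfolding laver_forcing_def laver_stem_iff by blast
  have "max (len s0) \<gamma> < lam"
    using tree_len_less[OF closed s0(1)] \<open>\<gamma> < lam\<close> by simp
  then obtain s where s: "s \<in> p" "s0 \<subseteq>\<^sub>m s" "len s = max (len s0) \<gamma>"
    using tree_extend_len[OF closed s0(1)] by (metis max.cobounded1)
  have "|{..<k (len t)}| \<le>o |OSucc p t|" if "t \<in> p" "s \<subseteq>\<^sub>m t" for t
    using s0(2)[OF that(1) map_le_trans[OF s(2) that(2)]] ordIso_symmetric ordIso_imp_ordLeq
    by blast
  then show ?thesis
    using that[of s] s(1,3) by simp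
qed

context
  fixes \<gamma>0
  assumes \<gamma>0: "\<gamma>0 < lam" "|UNIV :: nat set set| <o |{..<k \<gamma>0}|"
begin

lemma level_cardinal_scale_exists:
  assumes \<gamma>: "\<gamma>0 \<le> \<gamma>" "\<gamma> < lam"
  shows "\<exists>B A F. A \<subseteq> B \<and> infinite A \<and> infinite (B - A) \<and> is_scale (level_cardinal \<gamma>) B F"
proof -
  have continuum: "|UNIV :: nat set set| <o |{..<level_cardinal \<gamma> n}|" for n
  proof -
    have "{..<k \<gamma>0} \<subseteq> {..<level_cardinal \<gamma> n}"
      unfolding level_cardinal_def
      using k_mono[of \<gamma>0 "nth_next \<gamma> n"] \<gamma> le_nth_next[OF \<gamma>(2), of n] nth_next_lam[OF \<gamma>(2), of n]
      by simp
    then show ?thesis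
      using \<gamma>0(2) card_of_mono1 ordLess_ordLeq_trans by blast
  qed
  obtain B F where "infinite B" "is_scale (level_cardinal \<gamma>) B F"
    by (rule is_scale_exists[OF level_cardinal_regular[OF \<gamma>(2)] continuum])
  then show ?thesis
    using infinite_splits by metis
qed

theorem laver_forcing_adds_new_function:
  "adds_new_function (laver_forcing \<Theta>) (\<subseteq>) {..<lam} {0, 1 :: nat}"
proof -
  obtain B A F where scale: "\<And>\<gamma>. \<gamma>0 \<le> \<gamma> \<Longrightarrow> \<gamma> < lam \<Longrightarrow> A \<gamma> \<subseteq> B \<gamma> \<and> infinite (A \<gamma>) \<and>
      infinite (B \<gamma> - A \<gamma>) \<and> is_scale (level_cardinal \<gamma>) (B \<gamma>) (F \<gamma>)"
    using level_cardinal_scale_exists by metis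
  let ?c = "\<lambda>\<gamma> t. \<exists>f\<in>F \<gamma>. realises \<gamma> (B \<gamma>) f (A \<gamma>) t"
  show ?thesis
  proof (rule tree_forcing.adds_new_function_of_level_colouring[OF tree_forcing_laver,
        of _ "\<lambda>\<gamma>. strict_sup UNIV (nth_next \<gamma>)" ?c])
    fix p assume p: "p \<in> laver_forcing \<Theta>"
    note closed = closed_tree_laver[OF p]
    obtain s where s: "s \<in> p" "\<gamma>0 \<le> len s"
      and full: "\<And>t. t \<in> p \<Longrightarrow> s \<subseteq>\<^sub>m t \<Longrightarrow> |{..<k (len t)}| \<le>o |OSucc p t|"
      using laver_full_above[OF p \<gamma>0(1)] by blast
    let ?\<gamma> = "len s"
    have \<gamma>: "?\<gamma> < lam"
      using tree_len_less[OF closed s(1)] .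
    obtain f where f: "f \<in> F ?\<gamma>"
      "\<And>X. \<exists>u\<in>p. len u = strict_sup UNIV (nth_next ?\<gamma>) \<and> realises ?\<gamma> (B ?\<gamma>) f X u"
      using laver_scale_function_realises_all[OF closed s(1) full] scale[OF s(2) \<gamma>] by metis
    obtain t where t: "t \<in> p" "len t = strict_sup UNIV (nth_next ?\<gamma>)"
      "realises ?\<gamma> (B ?\<gamma>) f (A ?\<gamma>) t"
      using f(2) by blast
    obtain u where u: "u \<in> p" "len u = strict_sup UNIV (nth_next ?\<gamma>)"
      "realises ?\<gamma> (B ?\<gamma>) f (B ?\<gamma> - A ?\<gamma>) u"
      using f(2) by blast
    have "\<not> ?c ?\<gamma> u"
      using realises_unique[OF _ _ _ _ u(3)] scale[OF s(2) \<gamma>] f(1) unfolding is_scale_def by blast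
    then show "\<exists>\<gamma><lam. \<exists>t\<in>p. \<exists>u\<in>p. len t = strict_sup UNIV (nth_next \<gamma>) \<and>
        len u = strict_sup UNIV (nth_next \<gamma>) \<and> ?c \<gamma> t \<and> \<not> ?c \<gamma> u"
      using \<gamma> t u(1,2) f(1) by blast
  qed
qed

end

end

section \<open>Splitting-closed trees with clubs of successors\<close>

context cardinal_tower
begin

definition contains_club :: "'o \<Rightarrow> 'o set \<Rightarrow> bool" where
  "contains_club l X \<longleftrightarrow> (\<exists>C. club_in C (k l) \<and> C \<subseteq> X)"

definition cofinality_omega_stationary :: "'o \<Rightarrow> 'o set \<Rightarrow> bool" where
  "cofinality_omega_stationary l X \<longleftrightarrow> X \<subseteq> {\<beta>. \<beta> < k l \<and> cf \<beta> = omega} \<and> stationary_in X (k l)"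

lemma club_has_cofinality_omega:
  assumes "l < lam" "lam < k l" "club_in C (k l)" shows "\<exists>b\<in>C. cf b = omega"
  using club_in_regular_cardinal_has_cofinality[OF k_regular[OF assms(1)] assms(3), of omega]
    cf_omega is_limit_omega infinite_below_omega[OF infinite_lam]
      less_trans[OF omega_less_lam assms(2)] by blast

lemma club_has_cofinality_lam:
  assumes "l < lam" "lam < k l" "club_in C (k l)" shows "\<exists>b\<in>C. cf b = lam"
  using club_in_regular_cardinal_has_cofinality[OF k_regular[OF assms(1)] assms(3,2) cf_lam is_limit_lam] .

theorem scl_club_forcing_adds_new_function:
  assumes \<beta>: "\<beta> < lam" "lam < k \<beta>"
  shows "adds_new_function (scl_forcing contains_club) (\<subseteq>) {..<lam} {0, 1 :: nat}"
proof (rule tree_forcing.adds_new_function_of_level_colouring[OF tree_forcing_scl,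
      of _ next_ord "\<lambda>\<gamma> t. cf (the (t \<gamma>)) = omega"])
  fix q assume q: "q \<in> scl_forcing contains_club"
  note perfect = scl_perfect[OF q] and closed = closed_tree_perfect[OF scl_perfect[OF q]]
  obtain u where u: "u \<in> q" "len u = \<beta>"
    using tree_has_len[OF closed \<beta>(1)] by blast
  obtain s where s: "s \<in> q" "u \<subseteq>\<^sub>m s" "contains_club (len s) (OSucc q s)"
    using perfect_branching[OF perfect u(1) \<beta>(1)] unfolding branching_def by blast
  note s_len = tree_len_less[OF closed s(1)]
  have "\<beta> \<le> len s"
    using seq_le_len[OF _ _ s(2)] tree_is_seq[OF closed] u s(1) by blast
  then have "lam < k (len s)"
    using \<beta>(2) k_mono s_len less_le_trans by blast
  obtain C where C: "club_in C (k (len s))" "C \<subseteq> OSucc q s"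
    using s(3) unfolding contains_club_def by blast
  obtain b where b: "b \<in> C" "cf b = omega"
    using club_has_cofinality_omega[OF s_len \<open>lam < k (len s)\<close> C(1)] by blast
  obtain b' where b': "b' \<in> C" "cf b' = lam"
    using club_has_cofinality_lam[OF s_len \<open>lam < k (len s)\<close> C(1)] by blast
  have "s \<frown> b \<in> q" "s \<frown> b' \<in> q"
    using b(1) b'(1) C(2) unfolding OSucc_def by blast+
  moreover have "cf (the ((s \<frown> b) (len s))) = omega" "cf (the ((s \<frown> b') (len s))) \<noteq> omega"
    using b(2) b'(2) omega_less_lam by simp_all
  ultimately show "\<exists>\<gamma><lam. \<exists>t\<in>q. \<exists>u\<in>q. len t = next_ord \<gamma> \<and> len u = next_ord \<gamma> \<and>
      cf (the (t \<gamma>)) = omega \<and> cf (the (u \<gamma>)) \<noteq> omega"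
    using s_len tree_snoc(2)[OF closed s(1)] by blast
qed

end

section \<open>The eight forcings\<close>

lemma strict_mono_on_lessThan_le:
  fixes f :: "'o::wellorder \<Rightarrow> 'o"
  assumes "strict_mono_on {..<d} f" "x < d" shows "x \<le> f x"
  using assms(2)
proof (induction x rule: less_induct)
  case (less x)
  show ?case
  proof (rule ccontr)
    assume "\<not> x \<le> f x"
    then have "f x < x" by simp
    then have "f x \<le> f (f x)" "f (f x) < f x"
      using less less_trans strict_mono_onD[OF assms(1)] by auto
    then show False by simp
  qed
qed

context cardinal_tower
begin

lemma card_of_cofinality_omega_stationary:
  assumes "l < lam" "cofinality_omega_stationary l X" shows "|{..<k l}| \<le>o |X|"
  using regular_cardinal_unbounded_iff[OF k_regular[OF assms(1)], of X]
    stationary_in_unbounded[of X "k l"] assms(2)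
  unfolding cofinality_omega_stationary_def by blast

lemma card_of_contains_club:
  assumes "l < lam" "contains_club l X" shows "|{..<k l}| \<le>o |X|"
proof -
  obtain C where C: "club_in C (k l)" "C \<subseteq> X"
    using assms(2) unfolding contains_club_def by blast
  then have "|{..<k l}| \<le>o |C|"
    using regular_cardinal_unbounded_iff[OF k_regular[OF assms(1)], of C]
    unfolding club_in_def by blast
  then show ?thesis
    using card_of_mono1[OF C(2)] by (rule ordLeq_transitive)
qed

lemma perfect_tree_eq_perfect_forcing:
  assumes card: "\<And>l X. l < lam \<Longrightarrow> \<Theta> l X \<Longrightarrow> |{..<k l}| \<le>o |X|"
  shows "{p. perfect_tree lam k p \<and> (\<forall>s\<in>p. \<exists>t\<in>p. s \<subseteq>\<^sub>m t \<and> \<Theta> (len t) (OSucc p t))} =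
    perfect_forcing \<Theta>"
proof (intro set_eqI iffI)
  fix p assume "p \<in> {p. perfect_tree lam k p \<and> (\<forall>s\<in>p. \<exists>t\<in>p. s \<subseteq>\<^sub>m t \<and> \<Theta> (len t) (OSucc p t))}"
  then have closed: "closed_tree p"
    and large: "\<And>s. s \<in> p \<Longrightarrow> \<exists>t\<in>p. s \<subseteq>\<^sub>m t \<and> \<Theta> (len t) (OSucc p t)"
    unfolding perfect_tree_def closed_tree_def by blast+
  have "\<exists>s\<in>p. t \<subseteq>\<^sub>m s \<and> branching \<Theta> p \<alpha> s" if t: "t \<in> p" "\<alpha> < lam" for t \<alpha>
  proof -
    have "max \<alpha> (len t) < lam" "len t \<le> max \<alpha> (len t)"
      using t(2) tree_len_less[OF closed t(1)] by simp_all
    then obtain u where u: "u \<in> p" "t \<subseteq>\<^sub>m u" "\<alpha> \<le> len u"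
      by (rule tree_extend_len[OF closed t(1)]) auto
    obtain s where s: "s \<in> p" "u \<subseteq>\<^sub>m s" "\<Theta> (len s) (OSucc p s)"
      using large[OF u(1)] by blast
    have "\<alpha> \<le> len s"
      using u(3) seq_le_len[OF _ _ s(2)] tree_is_seq[OF closed] u(1) s(1) order_trans by blast
    moreover have "splitting k p (len s) s"
      unfolding splitting_iff using card tree_len_less[OF closed s(1)] s(3) .
    ultimately have "branching \<Theta> p \<alpha> s"
      unfolding branching_def using splitting_mono tree_len_less[OF closed s(1)] s(3) by blast
    then show ?thesis
      using s(1) map_le_trans[OF u(2) s(2)] by blast
  qed
  then show "p \<in> perfect_forcing \<Theta>"
    unfolding perfect_forcing_def using closed by blast
next
  fix p assume p: "p \<in> perfect_forcing \<Theta>"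
  have "\<exists>t\<in>p. s \<subseteq>\<^sub>m t \<and> splitting k p \<alpha> t" if "s \<in> p" "\<alpha> < lam" for s \<alpha>
    using perfect_branching[OF p that] unfolding branching_def by blast
  then have "perfect_tree lam k p"
    using closed_tree_perfect[OF p] unfolding perfect_tree_def closed_tree_def ever_branching_def
    by blast
  then show "p \<in> {p. perfect_tree lam k p \<and> (\<forall>s\<in>p. \<exists>t\<in>p. s \<subseteq>\<^sub>m t \<and> \<Theta> (len t) (OSucc p t))}"
    using perfect_branching[OF p] omega_less_lam unfolding branching_def by blast
qed

lemma MM_eq: "MM lam k = perfect_forcing (\<lambda>_ _. True)"
  unfolding MM_def perfect_forcing_def perfect_tree_def closed_tree_def ever_branching_def
    branching_def by auto

lemma MM_stat_eq: "MM_stat lam k = perfect_forcing cofinality_omega_stationary"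
  using perfect_tree_eq_perfect_forcing[OF card_of_cofinality_omega_stationary]
  unfolding MM_stat_def stat_branching_def cofinality_omega_stationary_def by simp

lemma MM_club_eq: "MM_club lam k = perfect_forcing contains_club"
  using perfect_tree_eq_perfect_forcing[OF card_of_contains_club]
  unfolding MM_club_def club_branching_def contains_club_def by simp

lemma scl_MM_eq: "scl_MM lam k = scl_forcing (\<lambda>_ _. True)"
  unfolding scl_MM_def scl_forcing_def MM_eq branching_def by simp

lemma scl_MM_club_eq: "scl_MM_club lam k = scl_forcing contains_club"
  unfolding scl_MM_club_def scl_forcing_def MM_club_eq club_branching_def contains_club_def
    branching_def by simp

lemma LL_eq: "LL lam k = laver_forcing (\<lambda>_ _. True)"
  unfolding LL_def laver_forcing_def closed_tree_def by simp

lemma LL_stat_eq: "LL_stat lam k = laver_forcing cofinality_omega_stationary"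
  unfolding LL_stat_def laver_forcing_def closed_tree_def stat_branching_def
    cofinality_omega_stationary_def by simp

lemma LL_club_eq: "LL_club lam k = laver_forcing contains_club"
  unfolding LL_club_def laver_forcing_def closed_tree_def club_branching_def contains_club_def
  by simp

lemmas forcing_eqs = MM_eq MM_stat_eq MM_club_eq scl_MM_eq scl_MM_club_eq LL_eq LL_stat_eq
  LL_club_eq

subsection \<open>Product trees\<close>

definition product_tree :: "('o \<Rightarrow> 'o set) \<Rightarrow> 'o node set" where
  "product_tree S = subtree (nodes lam k) (\<lambda>t. S (len t))"

context
  fixes S :: "'o \<Rightarrow> 'o set" and \<gamma> :: 'o and \<Theta> :: "'o \<Rightarrow> 'o set \<Rightarrow> bool"
  assumes S: "\<And>\<beta>. \<beta> < lam \<Longrightarrow> S \<beta> \<noteq> {} \<and> S \<beta> \<subseteq> {..<k \<beta>}"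
    and \<gamma>: "\<gamma> < lam" and singleton: "\<And>\<beta>. \<beta> < \<gamma> \<Longrightarrow> \<exists>b. S \<beta> = {b}"
    and large: "\<And>\<beta>. \<gamma> \<le> \<beta> \<Longrightarrow> \<beta> < lam \<Longrightarrow> \<Theta> \<beta> (S \<beta>) \<and> |{..<k \<beta>}| \<le>o |S \<beta>|"
begin

lemma OSucc_product_tree:
  assumes "t \<in> product_tree S" shows "OSucc (product_tree S) t = S (len t)"
proof -
  have t: "t \<in> nodes lam k"
    using assms subtree_subset unfolding product_tree_def by blast
  have "OSucc (product_tree S) t = {..<k (len t)} \<inter> S (len t)"
    using OSucc_subtree[OF closed_tree_nodes] assms OSucc_nodes[OF t]
    unfolding product_tree_def by blast
  then show ?thesis
    using S[of "len t"] t nodes_iff by blast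
qed

lemma closed_tree_product_tree: "closed_tree (product_tree S)"
  unfolding product_tree_def
proof (rule closed_tree_subtree[OF closed_tree_nodes])
  fix t assume "t \<in> subtree (nodes lam k) (\<lambda>t. S (len t))"
  then have t: "t \<in> nodes lam k"
    using subtree_subset by blast
  then show "OSucc (nodes lam k) t \<inter> S (len t) \<noteq> {}"
    unfolding OSucc_nodes[OF t] using S[of "len t"] nodes_iff by blast
qed

lemma branching_product_tree:
  assumes "t \<in> product_tree S" "\<gamma> \<le> len t" "\<alpha> \<le> len t" shows "branching \<Theta> (product_tree S) \<alpha> t"
proof -
  note len = tree_len_less[OF closed_tree_product_tree assms(1)]
  have "splitting k (product_tree S) (len t) t"
    unfolding splitting_iff OSucc_product_tree[OF assms(1)] using large[OF assms(2) len] by blast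
  then show ?thesis
    unfolding branching_def OSucc_product_tree[OF assms(1)]
    using splitting_mono[OF _ assms(3) len] large[OF assms(2) len] by blast
qed

lemma product_tree_perfect: "product_tree S \<in> perfect_forcing \<Theta>"
proof -
  have "\<exists>s\<in>product_tree S. t \<subseteq>\<^sub>m s \<and> branching \<Theta> (product_tree S) \<alpha> s"
    if t: "t \<in> product_tree S" "\<alpha> < lam" for t \<alpha>
  proof -
    have "max (max \<alpha> \<gamma>) (len t) < lam"
      using t(2) \<gamma> tree_len_less[OF closed_tree_product_tree t(1)] by simp
    then obtain s where "s \<in> product_tree S" "t \<subseteq>\<^sub>m s" "len s = max (max \<alpha> \<gamma>) (len t)"
      using tree_extend_len[OF closed_tree_product_tree t(1)] max.cobounded2 by blast
    then show ?thesis
      using branching_product_tree[of s \<alpha>] by (auto simp: le_max_iff_disj)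
  qed
  then show ?thesis
    unfolding perfect_forcing_def using closed_tree_product_tree by blast
qed

lemma product_tree_laver: "product_tree S \<in> laver_forcing \<Theta>"
proof -
  note closed = closed_tree_product_tree
  obtain s where s: "s \<in> product_tree S" "len s = \<gamma>"
    using tree_has_len[OF closed \<gamma>] by blast
  note seq = tree_is_seq[OF closed]
  have comparable: "s \<subseteq>\<^sub>m t \<or> t \<subseteq>\<^sub>m s" if t: "t \<in> product_tree S" for t
  proof (rule ccontr)
    assume "\<not> (s \<subseteq>\<^sub>m t \<or> t \<subseteq>\<^sub>m s)"
    then obtain x where x: "x < len s" "x < len t" "s x \<noteq> t x"
      using seq_first_difference[OF seq[OF s(1)] seq[OF t]] by blast
    have "the (s x) \<in> S x" "the (t x) \<in> S x"
      using s(1) t x(1,2) len_restrict[OF seq[OF s(1)], of x] len_restrict[OF seq[OF t], of x]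
      unfolding product_tree_def subtree_def by auto
    then have "the (s x) = the (t x)"
      using singleton[of x] x(1) s(2) by auto
    then show False
      using x seq_value[OF seq[OF s(1)]] seq_value[OF seq[OF t]] by metis
  qed
  have "|OSucc (product_tree S) t| =o |{..<k (len t)}|" "\<Theta> (len t) (OSucc (product_tree S) t)"
    if t: "t \<in> product_tree S" "s \<subseteq>\<^sub>m t" for t
  proof -
    have len: "\<gamma> \<le> len t" "len t < lam"
      using seq_le_len[OF seq[OF s(1)] seq[OF t(1)] t(2)] s(2) tree_len_less[OF closed t(1)]
      by simp_all
    then show "|OSucc (product_tree S) t| =o |{..<k (len t)}|"
      "\<Theta> (len t) (OSucc (product_tree S) t)"
      unfolding OSucc_product_tree[OF t(1)] ordIso_iff_ordLeq
      using large[OF len] card_of_mono1[of "S (len t)"] S[OF len(2)] by blast+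
  qed
  then show ?thesis
    unfolding laver_forcing_def laver_stem_iff using closed s(1) comparable by blast
qed

lemma product_tree_scl:
  assumes "\<gamma> = zero_ord" shows "product_tree S \<in> scl_forcing \<Theta>"
proof -
  have "splitting_closed lam (branching \<Theta> (product_tree S)) (product_tree S)"
    unfolding splitting_closed_iff[OF closed_tree_product_tree]
  proof (intro allI ballI impI, elim conjE)
    fix \<delta> :: 'o and w u
    assume u: "u \<in> product_tree S" and union: "seq_union {..<\<delta>} w u"
      and increasing: "\<forall>\<alpha> \<beta>. \<alpha> < \<beta> \<and> \<beta> < \<delta> \<longrightarrow> w \<alpha> \<sqsubset> w \<beta>"
    have "strict_mono_on {..<\<delta>} (\<lambda>\<alpha>. len (w \<alpha>))"
      using increasing prefix_lessD(2) by (intro strict_mono_onI) auto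
    then have "\<alpha> < len u" if "\<alpha> < \<delta>" for \<alpha>
      using strict_mono_on_lessThan_le[of \<delta> "\<lambda>\<alpha>. len (w \<alpha>)" \<alpha>] union that prefix_lessD(2)
      unfolding seq_union_def by (metis lessThan_iff le_less_trans)
    then have "\<delta> \<le> len u"
      by (meson leI less_irrefl)
    then show "branching \<Theta> (product_tree S) \<delta> u"
      using branching_product_tree[OF u] assms by simp
  qed
  then show ?thesis
    unfolding scl_forcing_def using product_tree_perfect by blast
qed

end

lemma forcings_nonempty_of_full:
  assumes "\<And>\<beta>. \<beta> < lam \<Longrightarrow> \<Theta> \<beta> {..<k \<beta>}"
  shows "perfect_forcing \<Theta> \<noteq> {}" "scl_forcing \<Theta> \<noteq> {}" "laver_forcing \<Theta> \<noteq> {}"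
proof -
  let ?S = "\<lambda>\<beta>. {..<k \<beta>}"
  have S: "?S \<beta> \<noteq> {} \<and> ?S \<beta> \<subseteq> {..<k \<beta>}" if "\<beta> < lam" for \<beta>
    using infinite_imp_nonempty[OF k_infinite[OF that]] by blast
  have large: "\<Theta> \<beta> (?S \<beta>) \<and> |{..<k \<beta>}| \<le>o |?S \<beta>|" if "\<beta> < lam" for \<beta>
    using assms that card_of_mono1[OF subset_refl] by blast
  have "product_tree ?S \<in> perfect_forcing \<Theta>"
    by (rule product_tree_perfect[of ?S zero_ord]) (use S zero_ord_lam large in auto)
  moreover have "product_tree ?S \<in> scl_forcing \<Theta>"
    by (rule product_tree_scl[of ?S zero_ord]) (use S zero_ord_lam large in auto)
  moreover have "product_tree ?S \<in> laver_forcing \<Theta>"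
    by (rule product_tree_laver[of ?S zero_ord]) (use S zero_ord_lam large in auto)
  ultimately show "perfect_forcing \<Theta> \<noteq> {}" "scl_forcing \<Theta> \<noteq> {}" "laver_forcing \<Theta> \<noteq> {}"
    by blast+
qed

lemma stationary_forcings_nonempty:
  assumes \<gamma>: "\<gamma> < lam" "lam < k \<gamma>"
  shows "perfect_forcing cofinality_omega_stationary \<noteq> {}"
    "laver_forcing cofinality_omega_stationary \<noteq> {}"
proof -
  define S where "S \<beta> = (if \<beta> < \<gamma> then {zero_ord} else {b. b < k \<beta> \<and> cf b = omega})" for \<beta>
  have stationary: "cofinality_omega_stationary \<beta> (S \<beta>)" if \<beta>: "\<gamma> \<le> \<beta>" "\<beta> < lam" for \<beta>
  proof -
    have "lam < k \<beta>"
      using \<gamma>(2) k_mono[OF \<beta>] by (rule less_le_trans)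
    then have "S \<beta> \<inter> C \<noteq> {}" if "club_in C (k \<beta>)" for C
      using club_has_cofinality_omega[OF \<beta>(2) _ that] that \<beta>(1) unfolding S_def club_in_def by auto
    then show ?thesis
      unfolding cofinality_omega_stationary_def stationary_in_def using \<beta>(1)
      by (auto simp: S_def leD)
  qed
  have card: "|{..<k \<beta>}| \<le>o |S \<beta>|" if "\<gamma> \<le> \<beta>" "\<beta> < lam" for \<beta>
    using card_of_cofinality_omega_stationary stationary that by blast
  have S: "S \<beta> \<noteq> {} \<and> S \<beta> \<subseteq> {..<k \<beta>}" if \<beta>: "\<beta> < lam" for \<beta>
  proof (cases "\<beta> < \<gamma>")
    case True
    have "zero_ord < k \<beta>"
      using infinite_imp_nonempty[OF k_infinite[OF \<beta>]] zero_ord_le le_less_trans by blast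
    then show ?thesis
      unfolding S_def using True by simp
  next
    case False
    then have "infinite (S \<beta>)"
      using card_of_ordLeq_infinite[OF card] k_infinite \<beta> by simp
    then show ?thesis
      unfolding S_def using False infinite_imp_nonempty by auto
  qed
  have "\<exists>b. S \<beta> = {b}" if "\<beta> < \<gamma>" for \<beta>
    using that unfolding S_def by simp
  then show "perfect_forcing cofinality_omega_stationary \<noteq> {}"
    "laver_forcing cofinality_omega_stationary \<noteq> {}"
    using product_tree_perfect[OF S \<gamma>(1)] product_tree_laver[OF S \<gamma>(1)] stationary card
    by (metis empty_iff)+
qed

theorem forcings_add_new_function:
  assumes lam_small: "\<beta> < lam" "lam < k \<beta>"
    and continuum_small: "\<gamma> < lam" "|UNIV :: nat set set| <o |{..<k \<gamma>}|"
    and P: "P \<in> {MM lam k, MM_stat lam k, MM_club lam k, scl_MM lam k, scl_MM_club lam k,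
      LL lam k, LL_stat lam k, LL_club lam k}"
  shows "adds_new_function P (\<subseteq>) {..<lam} {0, 1 :: nat}" "P \<noteq> {}"
proof -
  show "adds_new_function P (\<subseteq>) {..<lam} {0, 1 :: nat}"
    using P perfect_forcing_adds_new_function scl_forcing_adds_new_function
      scl_club_forcing_adds_new_function[OF lam_small]
        laver_forcing_adds_new_function[OF continuum_small]
    unfolding forcing_eqs by (elim insertE) simp_all
  have "contains_club \<beta> {..<k \<beta>}" for \<beta>
    unfolding contains_club_def using club_in_full by blast
  then show "P \<noteq> {}"
    using P forcings_nonempty_of_full[of "\<lambda>_ _. True"] forcings_nonempty_of_full[of contains_club]
      stationary_forcings_nonempty[OF lam_small]
    unfolding forcing_eqs by (elim insertE) simp_all
qed

end

subsection \<open>Towers cofinal in a singular cardinal\<close>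

context
  fixes \<kappa> lam :: "'o::wellorder" and k :: "'o \<Rightarrow> 'o"
  assumes singular: "singular_cardinal \<kappa>" and cf: "cf \<kappa> = lam" and omega: "omega < lam"
    and sequence: "cardinal_sequence \<kappa> lam k"
begin

lemma cardinal_sequence_cofinal:
  assumes "x < \<kappa>" shows "\<exists>\<alpha><lam. x < k \<alpha>"
proof (rule ccontr)
  assume "\<not> (\<exists>\<alpha><lam. x < k \<alpha>)"
  then have "\<kappa> \<le> x"
    using sequence unfolding cardinal_sequence_def by (meson leI)
  with assms show False by simp
qed

lemma cardinal_sequence_less:
  assumes "\<alpha> < lam" shows "k \<alpha> < \<kappa>"
proof -
  have "k \<alpha> \<noteq> \<kappa>"
    using sequence assms cf_regular_cardinal[of "k \<alpha>"] singular
    unfolding cardinal_sequence_def singular_cardinal_def by auto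
  moreover have "k \<alpha> \<le> \<kappa>"
    using sequence assms unfolding cardinal_sequence_def by blast
  ultimately show ?thesis
    by simp
qed

lemma cofinality_less_singular: "lam < \<kappa>"
  using singular cf unfolding singular_cardinal_def by blast

lemma cardinal_tower_of_singular: "cardinal_tower lam k"
proof
  show mono: "strict_mono_on {..<lam} k"
    using sequence unfolding cardinal_sequence_def by blast
  show "regular_infinite_cardinal (k \<alpha>)" if "\<alpha> < lam" for \<alpha>
    using sequence that unfolding cardinal_sequence_def by blast
  have "cf \<kappa> = cf lam"
    using mono
  proof (rule cf_eq_cf_of_strict_mono_cofinal)
    show "k ` {..<lam} \<subseteq> {..<\<kappa>}"
      using cardinal_sequence_less by blast
    show "\<exists>\<alpha><lam. x \<le> k \<alpha>" if "x < \<kappa>" for x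
      using cardinal_sequence_cofinal[OF that] less_imp_le by blast
  qed
  then show "cf lam = lam"
    using cf by simp
  have "infinite {..<\<kappa>}"
    using singular unfolding singular_cardinal_def cinfinite_def Field_ord_rel by blast
  then have "infinite {..<omega::'o}"
    by (rule infinite_below_omega)
  moreover have "{..<omega} \<subseteq> {..<lam}"
    using omega by auto
  ultimately show "infinite {..<lam}"
    using finite_subset by blast
qed (rule omega)

lemma continuum_less_cardinal_sequence:
  assumes "\<And>\<tau>. \<tau> < \<kappa> \<Longrightarrow> is_cardinal \<tau> \<Longrightarrow> ord_rel \<tau> ^c ord_rel lam <o ord_rel \<kappa>"
  shows "\<exists>\<gamma><lam. |UNIV :: nat set set| <o |{..<k \<gamma>}|"
proof -
  interpret cardinal_tower lam k
    by (rule cardinal_tower_of_singular)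
  have "|UNIV :: nat set set| =o ctwo ^c |UNIV :: nat set|"
    using card_of_Pow_Func[of "UNIV :: nat set"]
    unfolding cexp_def ctwo_def Field_card_of Pow_UNIV .
  moreover have "ctwo ^c |UNIV :: nat set| \<le>o |{..<k omega}| ^c |{..<lam}|"
  proof (rule cexp_mono')
    show "ctwo \<le>o |{..<k omega}|"
      using k_infinite[OF omega] by (intro ctwo_ordLeq_Cinfinite)
        (simp add: cinfinite_def Field_card_of card_of_card_order_on)
    show "|UNIV :: nat set| \<le>o |{..<lam}|"
      using infinite_lam infinite_iff_card_of_nat by blast
  qed (simp add: Field_card_of)
  moreover have "|{..<k omega}| ^c |{..<lam}| = ord_rel (k omega) ^c ord_rel lam"
    unfolding cexp_def Field_card_of Field_ord_rel ..
  moreover have "is_cardinal (k omega)"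
    using Card_order_regular_cardinal[OF k_regular[OF omega]] unfolding is_cardinal_def .
  ultimately have "|UNIV :: nat set set| <o ord_rel \<kappa>"
    using assms[OF cardinal_sequence_less[OF omega]] ordIso_ordLeq_trans ordLeq_ordLess_trans
    by metis
  then obtain a where a: "a < \<kappa>" "|UNIV :: nat set set| \<le>o |{..<a}|"
    by (rule ordLess_card_of_lessThan)
  then obtain \<gamma> where \<gamma>: "\<gamma> < lam" "a < k \<gamma>"
    using cardinal_sequence_cofinal by blast
  then have "|{..<a}| <o |{..<k \<gamma>}|"
    using card_of_lessThan_ordLess Card_order_regular_cardinal k_regular by blast
  then show ?thesis
    using a(2) \<gamma>(1) ordLeq_ordLess_trans by blast
qed

end

theorem theorem3p1:
  fixes \<kappa> lam :: "'o::wellorder" and k :: "'o \<Rightarrow> 'o" and P :: "'o node set set"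
  assumes "singular_cardinal \<kappa>"
    and "cf \<kappa> = lam" and "omega < lam"
    and "\<And>\<tau>. \<tau> < \<kappa> \<Longrightarrow> is_cardinal \<tau> \<Longrightarrow> ord_rel \<tau> ^c ord_rel lam <o ord_rel \<kappa>"
    and "cardinal_sequence \<kappa> lam k"
    and "P \<in> {MM lam k, MM_stat lam k, MM_club lam k, scl_MM lam k, scl_MM_club lam k,
               LL lam k, LL_stat lam k, LL_club lam k}"
  shows "\<not> distributive P (\<subseteq>) {..<lam} {0, 1 :: nat} \<and>
         adds_new_function P (\<subseteq>) {..<lam} {0, 1 :: nat}"
proof -
  interpret cardinal_tower lam k
    using assms(1-3,5) by (rule cardinal_tower_of_singular)
  interpret forcing P "(\<subseteq>)"
    by unfold_locales auto
  obtain \<beta> where "\<beta> < lam" "lam < k \<beta>"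
    using cardinal_sequence_cofinal[OF assms(1-3,5) cofinality_less_singular[OF assms(1-3,5)]]
    by blast
  moreover obtain \<gamma> where "\<gamma> < lam" "|UNIV :: nat set set| <o |{..<k \<gamma>}|"
    using continuum_less_cardinal_sequence[OF assms(1-3,5,4)] by blast
  ultimately have "adds_new_function P (\<subseteq>) {..<lam} {0, 1 :: nat}" "P \<noteq> {}"
    using assms(6) by (rule forcings_add_new_function)+
  then show ?thesis
    using adds_new_function_not_distributive by blast
qed

end
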